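(* Let $d\ge 2$ be a squarefree integer, $K=\mathbb{Q}(\sqrt d)$, and let $f\in\mathbb{N}$ be squarefree such that $f$ is divisible by a ramified prime, $f$ is not divisible by a split prime and $|\mathrm{Pic}(\mathcal{O}_f)|=|\mathrm{Pic}(\mathcal{O}_K)|=2$. Suppose that for each $\alpha\in\{-1,1\}$ and each ramified $p\in\mathbb{P}$ with $p\mid f$, at least one of the following holds: ($p$ is odd and $\left(\frac{\alpha d/p}{p}\right)=-1$), or (there is some odd $q\in\mathbb{P}$ such that $q\mid df$ and $\left(\frac{-\alpha p}{q}\right)=-1$). Then $\min\Delta(\mathcal{O}_f)=2$.
   Context: $\mathbb{P}$ is the set of primes, $\mathbb{N}$ the positive integers, and $\left(\frac{a}{b}\right)$ is the Kronecker symbol. For squarefree $d\ge2$ and $K=\mathbb{Q}(\sqrt d)$: $\mathcal{O}_K$ is the ring of integers; $\omega=\sqrt d$ if $d\equiv 2,3 \bmod 4$ and $\omega=\frac{1+\sqrt d}{2}$ if $d\equiv 1\bmod 4$; $\mathsf{d}_K=4d$ if $d\equiv 2,3\bmod 4$ and $\mathsf{d}_K=d$ if $d\equiv1\bmod 4$. For $f\in\mathbb{N}$, $\mathcal{O}_f=\mathbb{Z}+f\omega\mathbb{Z}$ is the order in $K$ with conductor $f$. A prime $p$ is inert, ramified, split if $\left(\frac{\mathsf{d}_K}{p}\right)$ equals $-1,0,1$ respectively. $\mathrm{Pic}(R)$ is the Picard group of $R$. Set of distances: let $D$ be an integral domain. An atom of $D$ is a nonzero nonunit that is not a product of two nonunits.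 For nonzero $a\in D$, $\mathsf{L}(a)$ is the set of all integers $k\ge 0$ such that $a=\eta u_1\cdots u_k$ with $\eta$ a unit and $u_i$ atoms. $\Delta(\mathsf{L}(a))$ is the set of all $n\in\mathbb{N}$ such that there are $k<\ell$ in $\mathsf{L}(a)$ with $n=\ell-k$ and no element of $\mathsf{L}(a)$ strictly between $k$ and $\ell$. $\Delta(D)=\bigcup_{0\ne a\in D}\Delta(\mathsf{L}(a))$. Convention: $\min\Delta(D)=0$ if $\Delta(D)=\emptyset$. *)

theory Defs
  imports "HOL-Algebra.Algebra" "HOL-Number_Theory.Number_Theory"
    "HOL-Computational_Algebra.Computational_Algebra"
begin

hide_const (open) Divisibility.prime Polynomial.order

section \<open>Kronecker symbol\<close>

definition kronecker_prime :: "int \<Rightarrow> int \<Rightarrow> int" where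
  "kronecker_prime a p =
     (if p = 2 then (if even a then 0 else if a mod 8 = 1 \<or> a mod 8 = 7 then 1 else - 1)
      else Legendre a p)"

text \<open>For \<open>b \<noteq> 0\<close> the sign in front is the contribution of the unit part of \<open>b\<close>: the symbol
  over \<open>- 1\<close> is the sign of \<open>a\<close>, with sign \<open>1\<close> for \<open>a = 0\<close>.\<close>

definition kronecker :: "int \<Rightarrow> int \<Rightarrow> int" where
  "kronecker a b =
     (if b = 0 then (if \<bar>a\<bar> = 1 then 1 else 0)
      else (if a < 0 \<and> b < 0 then - 1 else 1) *
           (\<Prod>p\<in>prime_factors b. kronecker_prime a p ^ multiplicity p b))"

lemma kronecker_prime_eq:
  assumes "prime p"
  shows "kronecker a p = kronecker_prime a p"
  using assms prime_gt_0_int[OF assms]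
  by (auto simp: kronecker_def prime_factorization_prime)


section \<open>Sets of lengths and sets of distances\<close>

text \<open>In a domain, the atoms are the elements satisfying the library's \<^const>\<open>ring_irreducible\<close>.\<close>

lemma (in domain) ring_irreducible_iff_atom:
  assumes "a \<in> carrier R"
  shows "ring_irreducible a \<longleftrightarrow>
    a \<noteq> \<zero> \<and> a \<notin> Units R \<and>
    \<not> (\<exists>b\<in>carrier R - Units R. \<exists>c\<in>carrier R - Units R. a = b \<otimes> c)"
proof
  assume "ring_irreducible a"
  then show "a \<noteq> \<zero> \<and> a \<notin> Units R \<and>
    \<not> (\<exists>b\<in>carrier R - Units R. \<exists>c\<in>carrier R - Units R. a = b \<otimes> c)"
    using ring_irreducibleE[OF assms] by blast
next
  assume "a \<noteq> \<zero> \<and> a \<notin> Units R \<and>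
    \<not> (\<exists>b\<in>carrier R - Units R. \<exists>c\<in>carrier R - Units R. a = b \<otimes> c)"
  then show "ring_irreducible a"
    using assms by (intro ring_irreducibleI) auto
qed

definition length_set :: "('a, 'b) ring_scheme \<Rightarrow> 'a \<Rightarrow> nat set" where
  "length_set R a =
     {k. \<exists>\<eta> us. \<eta> \<in> Units R \<and> length us = k \<and>
           (\<forall>u\<in>set us. u \<in> carrier R \<and> ring_irreducible\<^bsub>R\<^esub> u) \<and>
           a = \<eta> \<otimes>\<^bsub>R\<^esub> foldr (\<otimes>\<^bsub>R\<^esub>) us \<one>\<^bsub>R\<^esub>}"

definition distances :: "nat set \<Rightarrow> nat set" where
  "distances L = {n. 0 < n \<and> (\<exists>k\<in>L. \<exists>l\<in>L. k < l \<and> n = l - k \<and> \<not> (\<exists>m\<in>L. k < m \<and> m < l))}"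

definition distance_set :: "('a, 'b) ring_scheme \<Rightarrow> nat set" where
  "distance_set R = (\<Union>a\<in>carrier R - {\<zero>\<^bsub>R\<^esub>}. distances (length_set R a))"

definition min_distance :: "('a, 'b) ring_scheme \<Rightarrow> nat" where
  "min_distance R = (if distance_set R = {} then 0 else (LEAST n. n \<in> distance_set R))"


section \<open>Picard group\<close>

text \<open>Throughout, \<open>R\<close> is (the carrier of) a subring of the field \<open>K\<close> whose field of fractions is
  \<open>K\<close>. The operation \<^const>\<open>ideal_prod\<close>, taken in \<open>K\<close>, is the usual product of
  \<open>R\<close>-submodules of \<open>K\<close>: all finite sums of products. The Picard group is the group of
  invertible fractional ideals modulo the nonzero principal ones.\<close>

definition fractional_ideal :: "('a, 'b) ring_scheme \<Rightarrow> 'a set \<Rightarrow> 'a set \<Rightarrow> bool" where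
  "fractional_ideal K R I \<longleftrightarrow>
     subgroup I (add_monoid K) \<and>
     (\<forall>r\<in>R. \<forall>x\<in>I. r \<otimes>\<^bsub>K\<^esub> x \<in> I) \<and>
     (\<exists>r\<in>R - {\<zero>\<^bsub>K\<^esub>}. \<forall>x\<in>I. r \<otimes>\<^bsub>K\<^esub> x \<in> R)"

definition fractional_ideal_monoid :: "('a, 'b) ring_scheme \<Rightarrow> 'a set \<Rightarrow> 'a set monoid" where
  "fractional_ideal_monoid K R =
     \<lparr>carrier = {I. fractional_ideal K R I}, monoid.mult = ideal_prod K, one = R\<rparr>"

definition principal_fractional_ideals :: "('a, 'b) ring_scheme \<Rightarrow> 'a set \<Rightarrow> 'a set set" where
  "principal_fractional_ideals K R = (\<lambda>x. x <#\<^bsub>K\<^esub> R) ` (carrier K - {\<zero>\<^bsub>K\<^esub>})"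

definition Pic :: "('a, 'b) ring_scheme \<Rightarrow> 'a set \<Rightarrow> 'a set set monoid" where
  "Pic K R = units_of (fractional_ideal_monoid K R) Mod principal_fractional_ideals K R"


section \<open>Orders in real quadratic fields\<close>

definition quadratic_field :: "int \<Rightarrow> real ring" where
  "quadratic_field d =
     \<lparr>carrier = {of_rat a + of_rat b * sqrt (of_int d) | a b. True},
      monoid.mult = (*), one = 1, ring.zero = 0, add = (+)\<rparr>"

definition ring_of_integers :: "int \<Rightarrow> real set" where
  "ring_of_integers d = {x \<in> carrier (quadratic_field d). algebraic_int x}"

definition quadratic_omega :: "int \<Rightarrow> real" where
  "quadratic_omega d = (if d mod 4 = 1 then (1 + sqrt (of_int d)) / 2 else sqrt (of_int d))"

definition quadratic_order :: "int \<Rightarrow> int \<Rightarrow> real set" where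
  "quadratic_order d f = {of_int a + of_int b * (of_int f * quadratic_omega d) | a b. True}"

abbreviation quadratic_order_ring :: "int \<Rightarrow> int \<Rightarrow> real ring" where
  "quadratic_order_ring d f \<equiv> (quadratic_field d)\<lparr>carrier := quadratic_order d f\<rparr>"

definition quadratic_discriminant :: "int \<Rightarrow> int" where
  "quadratic_discriminant d = (if d mod 4 = 1 then d else 4 * d)"

definition ramified_prime :: "int \<Rightarrow> int \<Rightarrow> bool" where
  "ramified_prime d p \<longleftrightarrow> prime p \<and> kronecker (quadratic_discriminant d) p = 0"

definition split_prime :: "int \<Rightarrow> int \<Rightarrow> bool" where
  "split_prime d p \<longleftrightarrow> prime p \<and> kronecker (quadratic_discriminant d) p = 1"

end

theory Submission
  imports Defs
begin

text \<open>
  Write \<open>\<O>\<close> for the maximal order and \<open>R\<close> for the order of conductor \<open>f\<close>. Since both Picard groups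
  have order 2 and extension of ideals is surjective on classes, every element of \<open>\<O>\<close> coprime to
  \<open>f\<close> is moved into \<open>R\<close> by a unit of \<open>\<O>\<close>. Hence the nonzero elements of \<open>R\<close> factor exactly as the
  elements \<open>z \<noteq> 0\<close> of \<open>\<O>\<close> with \<open>v\<^sub>p(N z) \<noteq> 1\<close> for all ramified \<open>p\<close> dividing \<open>f\<close>.

  As \<open>\<O>\<close> has class number 2, the norm of an irreducible element of \<open>\<O>\<close> is, up to sign, either a
  prime that is itself a norm, or a product of two primes that are not norms; this is Carlitz's
  theorem in terms of norms. The Legendre symbol conditions say that no ramified \<open>p\<close> dividing \<open>f\<close> is
  a norm up to sign. Now give a prime \<open>q\<close> weight 2 if it is a norm, 3 if it is ramified and divides
  \<open>f\<close>, and 1 otherwise. The total weight of the norm of an atom of \<open>R\<close> is always 2 modulo 4, so all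
  factorization lengths of an element have the same parity. Conversely, for such a ramified \<open>p\<close> there
  are a prime \<open>q\<close> and an atom \<open>a\<close> of \<open>R\<close> with norm \<open>\<plusminus>p\<^sup>3q\<close> for which \<open>p\<close>, \<open>q\<close> and the
  conjugate of \<open>a\<close> are atoms as well, so that the norm of \<open>a\<close> has lengths 2 and 4.
\<close>

section \<open>Arithmetic preliminaries\<close>

text \<open>The Picard hypotheses enter only in this form: there is a nonprincipal class, and any
  two nonprincipal invertible ideals differ by a scalar factor. Ideals are never factored into
  primes; ideals with two generators, norms and traces carry the argument. The condition on
  \<open>v\<^sub>p(N z)\<close> arises as follows. Modulo a prime \<open>p\<close> dividing
  \<open>f\<close>, an element of \<open>R\<close> is an integer, so if \<open>p\<close> divides its
  norm then \<open>p\<close> divides the element. For inert \<open>p\<close> every element of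
  \<open>\<O>\<close> behaves in this way; for ramified \<open>p\<close> it says exactly that the
  norm is not divisible by \<open>p\<close> just once. The obstacle is the way back from
  \<open>\<O>\<close> to \<open>R\<close>: the factors of an element of \<open>R\<close> must be
  moved into \<open>R\<close> by units whose product is 1, not merely one by one. The weights are
  read modulo 4 because every atom contributes 2, so that the total determines twice the length
  modulo 4, that is, the parity of the length.\<close>

lemma square_eq_squarefree_mult:
  fixes d u v :: int
  assumes "d \<ge> 2" "squarefree d" "u\<^sup>2 = d * v\<^sup>2"
  shows "v = 0"
proof (rule ccontr)
  assume v: "v \<noteq> 0"
  from assms have u: "u \<noteq> 0" using v by auto
  obtain p where p: "prime p" "p dvd d" using assms prime_divisor_exists[of d] by fastforce
  have m: "multiplicity p d = 1"
    using p assms squarefree_factorial_semiring'[of d] by (auto simp: in_prime_factors_iff)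
  have "multiplicity p (u\<^sup>2) = 2 * multiplicity p u"
    using p u by (intro prime_elem_multiplicity_power_distrib) auto
  moreover have "multiplicity p (d * v\<^sup>2) = 1 + 2 * multiplicity p v"
    using p v assms m
    by (subst prime_elem_multiplicity_mult_distrib) (auto simp: prime_elem_multiplicity_power_distrib prime_imp_prime_elem)
  ultimately have "2 * multiplicity p u = 1 + 2 * multiplicity p v"
    using assms(3) by simp
  then show False by presburger
qed

text \<open>The multiplicity of a prime in \<open>c\<close> is fixed. If \<open>a\<close> had a
  larger multiplicity than \<open>b\<close> at some prime, the deficit would grow with
  \<open>k\<close> and exceed what \<open>c\<close> can supply.\<close>

lemma dvd_of_power_dvd_mult_power:
  fixes a b c :: int
  assumes "\<And>k. a ^ k dvd c * b ^ k" and "c \<noteq> 0" "a \<noteq> 0"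
  shows "a dvd b"
proof (cases "b = 0")
  case False
  show ?thesis
  proof (rule multiplicity_le_imp_dvd[OF \<open>a \<noteq> 0\<close>])
    fix p :: int assume p: "prime p"
    define k where "k = Suc (multiplicity p c)"
    have "multiplicity p (a ^ k) \<le> multiplicity p (c * b ^ k)"
      using assms False by (intro dvd_imp_multiplicity_le) auto
    also have "\<dots> = multiplicity p c + k * multiplicity p b"
    proof -
      have "prime_elem p" using p by auto
      then have "multiplicity p (b ^ k) = k * multiplicity p b"
        using False by (rule prime_elem_multiplicity_power_distrib)
      moreover have "multiplicity p (c * b ^ k) = multiplicity p c + multiplicity p (b ^ k)"
        using \<open>prime_elem p\<close> assms(2) False
        by (intro prime_elem_multiplicity_mult_distrib) auto
      ultimately show ?thesis by simp
    qed
    also have "multiplicity p (a ^ k) = k * multiplicity p a"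
      using p assms by (intro prime_elem_multiplicity_power_distrib) auto
    finally have *: "k * multiplicity p a \<le> multiplicity p c + k * multiplicity p b" .
    show "multiplicity p a \<le> multiplicity p b"
    proof (rule ccontr)
      assume "\<not> ?thesis"
      then have "k * Suc (multiplicity p b) \<le> k * multiplicity p a" by (intro mult_le_mono) auto
      then show False using * by (simp add: k_def)
    qed
  qed
qed simp

text \<open>An inverse \<open>w\<close> of \<open>u\<close> modulo \<open>q\<close> exhibits
  \<open>a\<close> as the square of \<open>v * w\<close>. Only the value -1 is excluded, since
  \<open>q\<close> may divide \<open>a\<close>.\<close>

lemma Legendre_neq_minus_one_if_square:
  fixes a q u v :: int
  assumes "prime q" "coprime u q" "[u\<^sup>2 * a = v\<^sup>2] (mod q)"
  shows "Legendre a q \<noteq> -1"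
proof -
  obtain w where w: "[u * w = 1] (mod q)" using cong_solve_coprime_int[OF assms(2)] by auto
  have "[(v * w)\<^sup>2 = v\<^sup>2 * w\<^sup>2] (mod q)" by (simp add: power_mult_distrib)
  also have "[v\<^sup>2 * w\<^sup>2 = (u\<^sup>2 * a) * w\<^sup>2] (mod q)"
    using assms(3) by (intro cong_mult) (auto simp: cong_sym)
  also have "(u\<^sup>2 * a) * w\<^sup>2 = (u * w)\<^sup>2 * a"
    by (simp add: power_mult_distrib algebra_simps)
  also have "[(u * w)\<^sup>2 * a = 1\<^sup>2 * a] (mod q)" using w by (intro cong_mult cong_pow) auto
  finally have "QuadRes q a" unfolding QuadRes_def by auto
  then show ?thesis by (simp add: Legendre_def)
qed

lemma squarefree_dvdI:
  fixes f m :: int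
  assumes "squarefree f" "f \<noteq> 0" "\<And>p. prime p \<Longrightarrow> p dvd f \<Longrightarrow> p dvd m"
  shows "f dvd m"
proof (cases "m = 0")
  case False
  show ?thesis
  proof (rule multiplicity_le_imp_dvd[OF assms(2)])
    fix p :: int assume p: "prime p"
    show "multiplicity p f \<le> multiplicity p m"
    proof (cases "p dvd f")
      case True
      then have "multiplicity p f = 1"
        using p assms squarefree_factorial_semiring'[of f] by (auto simp: in_prime_factors_iff)
      moreover have "0 < multiplicity p m"
        using assms(3)[OF p True] p False by (auto simp: prime_multiplicity_gt_zero_iff)
      ultimately show ?thesis by simp
    qed (simp add: not_dvd_imp_multiplicity_0)
  qed
qed simp

lemma coprime_int_if_no_prime:
  fixes a b :: int
  assumes "b \<noteq> 0" "\<And>p. prime p \<Longrightarrow> p dvd b \<Longrightarrow> \<not> p dvd a"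
  shows "coprime a b"
proof (rule ccontr)
  assume "\<not> coprime a b"
  then have "gcd a b \<noteq> 1" by (simp add: coprime_iff_gcd_eq_1)
  moreover have "gcd a b \<noteq> 0" using assms by simp
  ultimately obtain p where "prime p" "p dvd gcd a b"
    using prime_divisor_exists[of "gcd a b"] by auto
  then show False using assms by auto
qed

lemma bezout3_int:
  fixes a b c :: int assumes "gcd (gcd a b) c = 1"
  obtains u v w where "u * a + v * b + w * c = 1"
proof -
  obtain x y where 1: "x * gcd a b + y * c = 1" using assms bezout_int by metis
  obtain u v where "u * a + v * b = gcd a b" using bezout_int by metis
  then have "(x * u) * a + (x * v) * b + y * c = 1"
    using 1 by (simp add: algebra_simps flip: \<open>u * a + v * b = gcd a b\<close>)
  then show ?thesis using that by blast
qed

lemma domain_subring_real: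
  fixes S :: "real set"
  assumes "0 \<in> S" "1 \<in> S" "\<And>x y. x \<in> S \<Longrightarrow> y \<in> S \<Longrightarrow> x + y \<in> S"
    "\<And>x. x \<in> S \<Longrightarrow> - x \<in> S"
    "\<And>x y. x \<in> S \<Longrightarrow> y \<in> S \<Longrightarrow> x * y \<in> S"
  shows "domain \<lparr>carrier = S, monoid.mult = (*), one = 1, ring.zero = 0, add = (+)\<rparr>"
    (is "domain ?R")
proof -
  interpret cring ?R
  proof (intro cringI abelian_groupI comm_monoidI)
    fix x assume "x \<in> carrier ?R"
    then show "\<exists>y\<in>carrier ?R. y \<oplus>\<^bsub>?R\<^esub> x = \<zero>\<^bsub>?R\<^esub>"
      using assms by (intro bexI[of _ "- x"]) auto
  qed (use assms in \<open>auto simp: algebra_simps\<close>)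
  show ?thesis by unfold_locales auto
qed

section \<open>Coordinates, conjugation and norm\<close>

locale real_quadratic =
  fixes d :: int
  assumes d_ge_2: "d \<ge> 2" and squarefree_d: "squarefree d"
begin

text \<open>\<open>\<omega>\<close> is a root of X^2 - tX + n with t = \<open>omega_trace\<close>
  and n = \<open>omega_norm\<close>. Through these two integers all residues of \<open>d\<close>
  modulo 4 share one arithmetic.\<close>

definition omega_trace :: int where "omega_trace = (if d mod 4 = 1 then 1 else 0)"
definition omega_norm :: int where "omega_norm = (if d mod 4 = 1 then (1 - d) div 4 else - d)"
abbreviation \<omega> :: real where "\<omega> \<equiv> quadratic_omega d"
abbreviation disc :: int where "disc \<equiv> quadratic_discriminant d"
abbreviation K :: "real set" where "K \<equiv> carrier (quadratic_field d)"
abbreviation \<O> :: "real set" where "\<O> \<equiv> quadratic_order d 1"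

lemma disc_eq: "disc = omega_trace * omega_trace - 4 * omega_norm"
proof -
  have "d mod 4 = 1 \<Longrightarrow> 4 dvd (1 - d)" by presburger
  then show ?thesis by (auto simp: omega_trace_def omega_norm_def quadratic_discriminant_def)
qed

lemma omega_square: "\<omega> * \<omega> = of_int omega_trace * \<omega> - of_int omega_norm"
proof (cases "d mod 4 = 1")
  case True
  then have "4 dvd (1 - d)" by presburger
  then have "real_of_int (1 - d) = 4 * of_int ((1 - d) div 4)"
    by (metis dvd_mult_div_cancel of_int_mult of_int_numeral)
  then have "of_int d = 1 - 4 * real_of_int omega_norm" using True by (simp add: omega_norm_def)
  then have "(2 * \<omega> - 1)\<^sup>2 = 1 - 4 * real_of_int omega_norm"
    using True d_ge_2 by (simp add: quadratic_omega_def add_divide_distrib)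
  then show ?thesis using True by (simp add: omega_trace_def power2_eq_square algebra_simps)
next
  case False
  then show ?thesis using d_ge_2 by (simp add: quadratic_omega_def omega_trace_def omega_norm_def)
qed

lemma omega_indep:
  assumes "of_int a + of_int b * \<omega> = (0::real)"
  shows "a = 0 \<and> b = 0"
proof -
  have w: "\<omega> * \<omega> - of_int omega_trace * \<omega> + of_int omega_norm = 0"
    using omega_square by simp
  \<comment> \<open>Four times the norm form is a square minus \<open>disc\<close> times a square.
    The middle term vanishes by assumption, the last one by the equation of
    \<open>\<omega>\<close>.\<close>
  have "(2 * of_int a + of_int omega_trace * of_int b)^2 = of_int disc * (of_int b)^2 
    + 4 * ((of_int a + of_int b * \<omega>) * (of_int a + of_int omega_trace * of_int b - of_int b * \<omega>))
    + 4 * (of_int b)^2 * (\<omega> * \<omega> - of_int omega_trace * \<omega> + of_int omega_norm)"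
    by (simp add: disc_eq algebra_simps power2_eq_square)
  then have "(2 * of_int a + of_int omega_trace * of_int b)^2 = of_int disc * (of_int b :: real)^2"
    unfolding assms w by simp
  then have "of_int ((2 * a + omega_trace * b)\<^sup>2) = (of_int (disc * b\<^sup>2) :: real)" by simp
  then have e: "(2 * a + omega_trace * b)\<^sup>2 = disc * b\<^sup>2" by linarith
  have "b = 0"
  proof (cases "d mod 4 = 1")
    case True
    then have "(2 * a + omega_trace * b)\<^sup>2 = d * b\<^sup>2" using e
      by (auto simp: quadratic_discriminant_def)
    then show ?thesis by (rule square_eq_squarefree_mult[OF d_ge_2 squarefree_d])
  next
    case False
    then have "(2 * a + omega_trace * b)\<^sup>2 = d * (2 * b)\<^sup>2" using e
      by (auto simp: quadratic_discriminant_def)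
    then have "2 * b = 0" by (rule square_eq_squarefree_mult[OF d_ge_2 squarefree_d])
    then show ?thesis by simp
  qed
  then show ?thesis using assms by simp
qed

definition qint :: "int \<Rightarrow> int \<Rightarrow> real"
  where "qint a b = of_int a + of_int b * \<omega>"

lemma qint_inject [simp]: "qint a b = qint a' b' \<longleftrightarrow> a = a' \<and> b = b'"
proof
  assume "qint a b = qint a' b'"
  then have "of_int (a - a') + of_int (b - b') * \<omega> = 0" by (simp add: qint_def algebra_simps)
  then show "a = a' \<and> b = b'" using omega_indep[of "a - a'" "b - b'"] by simp
qed simp

text \<open>On arguments outside \<open>\<O>\<close> the coordinates, and with them conjugation, norm
  and trace, are meaningless.\<close>

definition rat_coord :: "real \<Rightarrow> int" where "rat_coord x = (THE a. \<exists>b. x = qint a b)"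
definition omega_coord :: "real \<Rightarrow> int"
  where "omega_coord x = (THE b. \<exists>a. x = qint a b)"

lemma rat_coord_qint [simp]: "rat_coord (qint a b) = a" by (auto simp: rat_coord_def)
lemma omega_coord_qint [simp]: "omega_coord (qint a b) = b" by (auto simp: omega_coord_def)

lemma order_eq: "quadratic_order d f = {qint a (f * b) | a b. True}"
  by (simp add: quadratic_order_def qint_def mult_ac)

lemma O_eq: "\<O> = {qint a b | a b. True}" by (simp add: order_eq)

lemma qint_in_O [simp, intro]: "qint a b \<in> \<O>" by (auto simp: O_eq)

lemma O_cases: assumes "x \<in> \<O>" obtains a b where "x = qint a b"
  using assms by (auto simp: O_eq)

lemma in_O_iff_qint: "x \<in> \<O> \<longleftrightarrow> x = qint (rat_coord x) (omega_coord x)"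
  by (metis O_cases rat_coord_qint qint_in_O omega_coord_qint)

lemma order_iff: "x \<in> quadratic_order d f \<longleftrightarrow> x \<in> \<O> \<and> f dvd omega_coord x"
  by (auto simp: order_eq O_eq elim!: dvdE)

definition qconj :: "real \<Rightarrow> real"
  where "qconj x = qint (rat_coord x + omega_trace * omega_coord x) (- omega_coord x)"
definition qnorm :: "real \<Rightarrow> int"
  where "qnorm x = rat_coord x * rat_coord x + omega_trace * rat_coord x * omega_coord x + omega_norm * omega_coord x * omega_coord x"
definition qtrace :: "real \<Rightarrow> int"
  where "qtrace x = 2 * rat_coord x + omega_trace * omega_coord x"

lemma qint_add: "qint a b + qint a' b' = qint (a + a') (b + b')"
  and qint_diff: "qint a b - qint a' b' = qint (a - a') (b - b')"
  and qint_minus: "- qint a b = qint (- a) (- b)"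
  and of_int_eq_qint: "of_int m = qint m 0"
  by (simp_all add: qint_def algebra_simps)

lemma qint_mult: "qint a b * qint a' b' = qint (a * a' - omega_norm * b * b') (a * b' + b * a' + omega_trace * b * b')"
proof -
  have "qint a b * qint a' b' = of_int a * of_int a' + of_int (a * b' + b * a') * \<omega> + of_int (b * b') * (\<omega> * \<omega>)"
    by (simp add: qint_def algebra_simps)
  then show ?thesis unfolding omega_square by (simp add: qint_def algebra_simps)
qed

lemma O_add [simp, intro]: "x \<in> \<O> \<Longrightarrow> y \<in> \<O> \<Longrightarrow> x + y \<in> \<O>"
  and O_diff [simp, intro]: "x \<in> \<O> \<Longrightarrow> y \<in> \<O> \<Longrightarrow> x - y \<in> \<O>"
  and O_mult [simp, intro]: "x \<in> \<O> \<Longrightarrow> y \<in> \<O> \<Longrightarrow> x * y \<in> \<O>"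
  and O_minus [simp, intro]: "x \<in> \<O> \<Longrightarrow> - x \<in> \<O>"
  by (auto elim!: O_cases simp: qint_add qint_diff qint_mult qint_minus)

lemma O_of_int [simp, intro]: "of_int m \<in> \<O>" by (simp add: of_int_eq_qint)
lemma O_0 [simp, intro]: "0 \<in> \<O>" using O_of_int[of 0] by simp
lemma O_1 [simp, intro]: "1 \<in> \<O>" using O_of_int[of 1] by simp
lemma O_power [simp, intro]: "x \<in> \<O> \<Longrightarrow> x ^ k \<in> \<O>" by (induction k) auto

lemma conj_in_O [simp, intro]: "qconj x \<in> \<O>" by (simp add: qconj_def)
lemma conj_qint: "qconj (qint a b) = qint (a + omega_trace * b) (- b)" by (simp add: qconj_def)
lemma qnorm_qint: "qnorm (qint a b) = a * a + omega_trace * a * b + omega_norm * b * b"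
  by (simp add: qnorm_def)
lemma qtrace_qint: "qtrace (qint a b) = 2 * a + omega_trace * b" by (simp add: qtrace_def)

lemma conj_of_int [simp]: "qconj (of_int m) = of_int m"
  and qnorm_of_int [simp]: "qnorm (of_int m) = m * m"
  and omega_coord_of_int [simp]: "omega_coord (of_int m) = 0"
  by (simp_all add: of_int_eq_qint conj_qint qnorm_qint qtrace_qint)

lemma qnorm_1 [simp]: "qnorm 1 = 1"
  and conj_0 [simp]: "qconj 0 = 0" and qnorm_0 [simp]: "qnorm 0 = 0"
  and omega_coord_1 [simp]: "omega_coord 1 = 0" and omega_coord_0 [simp]: "omega_coord 0 = 0"
  using qnorm_of_int[of 1] conj_of_int[of 0] qnorm_of_int[of 0]
    omega_coord_of_int[of 1] omega_coord_of_int[of 0] by simp_all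

lemma conj_conj [simp]: "x \<in> \<O> \<Longrightarrow> qconj (qconj x) = x"
  and conj_add: "x \<in> \<O> \<Longrightarrow> y \<in> \<O> \<Longrightarrow> qconj (x + y) = qconj x + qconj y"
  and conj_mult: "x \<in> \<O> \<Longrightarrow> y \<in> \<O> \<Longrightarrow> qconj (x * y) = qconj x * qconj y"
  and add_conj: "x \<in> \<O> \<Longrightarrow> x + qconj x = of_int (qtrace x)"
  and mult_conj: "x \<in> \<O> \<Longrightarrow> x * qconj x = of_int (qnorm x)"
  and qnorm_conj [simp]: "x \<in> \<O> \<Longrightarrow> qnorm (qconj x) = qnorm x"
  and omega_coord_conj [simp]: "x \<in> \<O> \<Longrightarrow> omega_coord (qconj x) = - omega_coord x"
  and omega_coord_add: "x \<in> \<O> \<Longrightarrow> y \<in> \<O> \<Longrightarrow> omega_coord (x + y) = omega_coord x + omega_coord y"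
  and omega_coord_diff: "x \<in> \<O> \<Longrightarrow> y \<in> \<O> \<Longrightarrow> omega_coord (x - y) = omega_coord x - omega_coord y"
  and omega_coord_mult: "x \<in> \<O> \<Longrightarrow> y \<in> \<O> \<Longrightarrow> omega_coord (x * y) = rat_coord x * omega_coord y + omega_coord x * rat_coord y + omega_trace * omega_coord x * omega_coord y"
  by (auto elim!: O_cases simp: conj_qint qint_add qint_diff qint_mult of_int_eq_qint qtrace_qint qnorm_qint algebra_simps)

lemma omega_coord_of_int_mult [simp]: "x \<in> \<O> \<Longrightarrow> omega_coord (of_int m * x) = m * omega_coord x"
  and qtrace_of_int_mult [simp]: "x \<in> \<O> \<Longrightarrow> qtrace (of_int m * x) = m * qtrace x"
  by (auto elim!: O_cases simp: of_int_eq_qint qint_mult qtrace_qint algebra_simps)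

lemma rat_coord_of_int_mult: "x \<in> \<O> \<Longrightarrow> rat_coord (of_int m * x) = m * rat_coord x"
  by (auto elim!: O_cases simp: of_int_eq_qint qint_mult)

lemma qnorm_mult: assumes "x \<in> \<O>" "y \<in> \<O>" shows "qnorm (x * y) = qnorm x * qnorm y"
proof -
  have "of_int (qnorm (x * y)) = (of_int (qnorm x * qnorm y) :: real)"
    using assms by (simp add: mult_conj[symmetric] conj_mult mult_ac)
  then show ?thesis by linarith
qed

lemma qnorm_add: assumes "x \<in> \<O>" "y \<in> \<O>"
  shows "qnorm (x + y) = qnorm x + qnorm y + qtrace (x * qconj y)"
proof -
  have "of_int (qnorm (x + y)) = (of_int (qnorm x + qnorm y + qtrace (x * qconj y)) :: real)"
    using assms by (simp add: mult_conj[symmetric] conj_mult conj_add add_conj[symmetric] algebra_simps)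
  then show ?thesis by linarith
qed

lemma qnorm_of_int_mult [simp]: "x \<in> \<O> \<Longrightarrow> qnorm (of_int m * x) = m * m * qnorm x"
  by (simp add: qnorm_mult)

lemma four_qnorm: "4 * qnorm x = qtrace x ^ 2 - disc * omega_coord x ^ 2"
  by (simp add: qnorm_def qtrace_def disc_eq algebra_simps power2_eq_square)

lemma qnorm_eq_0_iff [simp]: "x \<in> \<O> \<Longrightarrow> qnorm x = 0 \<longleftrightarrow> x = 0"
proof
  assume x: "x \<in> \<O>" and "qnorm x = 0"
  then have "x = 0 \<or> qconj x = 0" using mult_conj[of x] by auto
  then show "x = 0" using x conj_conj by fastforce
qed auto

lemma square_eq: "x \<in> \<O> \<Longrightarrow> x * x = of_int (qtrace x) * x - of_int (qnorm x)"
  by (simp add: add_conj[symmetric] mult_conj[symmetric] algebra_simps)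

text \<open>\<open>x / p\<close> has integral trace and norm, so this is integral closedness of
  \<open>\<O>\<close> at \<open>p\<close>. For odd \<open>p\<close> the formula for
  \<open>4 * qnorm x\<close> gives \<open>p * p dvd d * b ^ 2\<close>, and squarefreeness of
  \<open>d\<close> forces \<open>p dvd b\<close>. For \<open>p = 2\<close> and \<open>d\<close>
  congruent to 2 or 3 modulo 4, squares modulo 4 decide.\<close>

lemma O_of_prime_dvd:
  assumes x: "x \<in> \<O>" and p: "prime p" and "p dvd qtrace x" "p * p dvd qnorm x"
  obtains y where "y \<in> \<O>" "x = of_int p * y"
proof -
  obtain a b where ab: "x = qint a b" using x by (rule O_cases)
  have t: "p dvd 2 * a + omega_trace * b"
      and n: "p * p dvd a * a + omega_trace * a * b + omega_norm * b * b"
    using assms ab by (auto simp: qtrace_qint qnorm_qint)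
  have "p dvd a \<and> p dvd b"
  proof (cases "p = 2")
    case True
    show ?thesis
    proof (cases "d mod 4 = 1")
      case t1: True
      then have "even b" using t True by (auto simp: omega_trace_def)
      then obtain b' where b': "b = 2 * b'" by auto
      have "even (a * a + omega_trace * a * b + omega_norm * b * b)"
        using n True by (meson dvd_mult_left)
      then have "even a" using b' by auto
      then show ?thesis using b' True by simp
    next
      case t0: False
      have n4: "4 dvd a * a - d * b * b" using n t0 True by (auto simp: omega_trace_def omega_norm_def)
      have "\<not> 4 dvd d"
      proof
        assume "4 dvd d"
        then have "(2::int)^2 dvd d" by simp
        then show False using squarefree_d squarefreeD[of d 2] by auto
      qed
      then have "d mod 4 = 2 \<or> d mod 4 = 3" using t0 by presburger
      moreover have "a * a mod 4 = (if even a then 0 else 1)" for a :: int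
      proof -
        have "a mod 4 = 0 \<or> a mod 4 = 1 \<or> a mod 4 = 2 \<or> a mod 4 = 3" by presburger
        moreover have "a * a mod 4 = (a mod 4) * (a mod 4) mod 4" by (simp add: mod_mult_eq)
        moreover have "even a \<longleftrightarrow> even (a mod 4)" by presburger
        ultimately show ?thesis by auto
      qed
      moreover have "(a * a) mod 4 = ((d mod 4) * ((b * b) mod 4)) mod 4"
        using n4 by (metis mod_eq_dvd_iff mod_mult_eq mult.assoc)
      ultimately show ?thesis using True by (auto split: if_splits)
    qed
  next
    case False
    have "odd p" using p False by (metis prime_ge_2_int prime_odd_int order_le_less)
    have cop: "coprime p 2" using \<open>odd p\<close> by simp
    have "p * p dvd qtrace x ^ 2" using assms(3) by (simp add: power2_eq_square mult_dvd_mono)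
    moreover have "p * p dvd 4 * qnorm x" using assms(4) by auto
    ultimately have "p * p dvd disc * b ^ 2" using four_qnorm[of x] ab
      by (metis (no_types, lifting) dvd_diff diff_diff_eq2 add_diff_cancel_left' omega_coord_qint)
    then have pp: "p * p dvd d * b ^ 2"
    proof (cases "d mod 4 = 1")
      case f: False
      have "coprime (p * p) (2 ^ 2)"
        using cop by (simp only: coprime_mult_left_iff coprime_power_right_iff) simp
      then have "coprime (p * p) 4" by simp
      then show ?thesis using \<open>p * p dvd disc * b ^ 2\<close> f
        by (simp add: quadratic_discriminant_def mult.assoc coprime_dvd_mult_right_iff)
    qed (simp add: quadratic_discriminant_def)
    have "p dvd b"
    proof (rule ccontr)
      assume "\<not> p dvd b"
      then have "coprime (p * p) (b ^ 2)" using p by (simp add: prime_imp_coprime)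
      then have "p ^ 2 dvd d" using pp by (simp add: coprime_dvd_mult_left_iff power2_eq_square)
      then show False using squarefree_d p squarefreeD[of d p] by auto
    qed
    moreover have "p dvd 2 * a" using t calculation by (metis dvd_add_left_iff dvd_mult)
    then have "p dvd a" using cop by (simp add: coprime_dvd_mult_right_iff)
    ultimately show ?thesis by simp
  qed
  then obtain a' b' where "a = p * a'" "b = p * b'" by (elim conjE dvdE)
  then have "x = of_int p * qint a' b'" by (simp add: ab qint_def algebra_simps)
  then show ?thesis using that by blast
qed

lemma O_sum [simp, intro]: "(\<And>i. i \<in> A \<Longrightarrow> g i \<in> \<O>) \<Longrightarrow> sum g A \<in> \<O>"
  by (induction A rule: infinite_finite_induct) auto

lemma O_of_dvd:
  assumes "x \<in> \<O>" "m \<noteq> 0" "m dvd qtrace x" "m * m dvd qnorm x"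
  shows "\<exists>y\<in>\<O>. x = of_int m * y"
  using assms
proof (induction m arbitrary: x rule: prime_divisors_induct)
  case (unit m)
  then have "m = 1 \<or> m = -1" by (auto simp: zdvd1_eq)
  then show ?case using unit by (auto intro!: bexI[of _ "of_int m * x"])
next
  case (factor p m)
  obtain y where y: "y \<in> \<O>" "x = of_int p * y"
    using O_of_prime_dvd[of x p] factor.prems factor.hyps 
    by (metis dvd_mult_left mult.assoc mult.left_commute)
  have "m dvd qtrace y" "m * m dvd qnorm y" "m \<noteq> 0" 
  proof -
    have "qtrace x = p * qtrace y" "qnorm x = p * p * qnorm y" using y by simp_all
    then have "p * m dvd p * qtrace y" "(p * p) * (m * m) dvd (p * p) * qnorm y" "p \<noteq> 0"
      using factor.prems factor.hyps by (simp_all add: mult_ac)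
    then show "m dvd qtrace y" "m * m dvd qnorm y" "m \<noteq> 0" using factor.prems by auto
  qed
  then obtain z where "z \<in> \<O>" "y = of_int m * z" using factor.IH y by blast
  then show ?case using y by (intro bexI[of _ z]) auto
qed auto

section \<open>The field and its ring of integers\<close>

lemma sqrt_in_O: "sqrt (of_int d) \<in> \<O>"
proof (cases "d mod 4 = 1")
  case True
  then have "sqrt (of_int d) = qint (-1) 2"
    by (simp add: qint_def quadratic_omega_def add_divide_distrib)
  then show ?thesis by simp
next
  case False
  then have "sqrt (of_int d) = qint 0 1" by (simp add: qint_def quadratic_omega_def)
  then show ?thesis by simp
qed

lemma omega_in_K: "\<exists>r s. \<omega> = of_rat r + of_rat s * sqrt (of_int d)"
proof (cases "d mod 4 = 1")
  case True
  then have "\<omega> = of_rat (1/2) + of_rat (1/2) * sqrt (of_int d)"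
    by (simp add: quadratic_omega_def of_rat_divide field_simps)
  then show ?thesis by blast
next
  case False
  then have "\<omega> = of_rat 0 + of_rat 1 * sqrt (of_int d)" by (simp add: quadratic_omega_def)
  then show ?thesis by blast
qed

lemma K_iff: "x \<in> K \<longleftrightarrow> (\<exists>y\<in>\<O>. \<exists>m::int. m \<noteq> 0 \<and> x = y / of_int m)"
proof
  assume "x \<in> K"
  then obtain a b where x: "x = of_rat a + of_rat b * sqrt (of_int d)"
    by (auto simp: quadratic_field_def)
  obtain p q where a: "a = Rat.Fract p q" "q > 0" by (metis Rat_cases)
  obtain r s where b: "b = Rat.Fract r s" "s > 0" by (metis Rat_cases)
  have "x = (of_int (p * s) + of_int (r * q) * sqrt (of_int d)) / of_int (q * s)"
    using a b by (simp add: x of_rat_rat field_simps)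
  moreover have "of_int (p * s) + of_int (r * q) * sqrt (of_int d) \<in> \<O>"
    using sqrt_in_O by (intro O_add O_mult O_of_int)
  moreover have "q * s \<noteq> 0" using a b by simp
  ultimately show "\<exists>y\<in>\<O>. \<exists>m::int. m \<noteq> 0 \<and> x = y / of_int m" by blast
next
  assume "\<exists>y\<in>\<O>. \<exists>m::int. m \<noteq> 0 \<and> x = y / of_int m"
  then obtain a b m where m: "m \<noteq> 0" "x = qint a b / of_int m" by (auto simp: O_eq)
  obtain r s where w: "\<omega> = of_rat r + of_rat s * sqrt (of_int d)" using omega_in_K by blast
  have "x = of_rat ((of_int a + of_int b * r) / of_int m) + of_rat (of_int b * s / of_int m) * sqrt (of_int d)"
    by (simp add: m qint_def w of_rat_divide of_rat_add of_rat_mult algebra_simps add_divide_distrib)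
  then show "x \<in> K" by (auto simp: quadratic_field_def)
qed

lemma O_subset_K: "x \<in> \<O> \<Longrightarrow> x \<in> K"
  by (auto simp: K_iff intro!: bexI[of _ x] exI[of _ 1])

lemma K_mult [simp, intro]: "x \<in> K \<Longrightarrow> y \<in> K \<Longrightarrow> x * y \<in> K"
proof -
  assume "x \<in> K" "y \<in> K"
  then obtain a m b n
    where "a \<in> \<O>" "m \<noteq> (0::int)" "x = a / of_int m" "b \<in> \<O>" "n \<noteq> (0::int)"
      "y = b / of_int n"
    by (auto simp: K_iff)
  then show ?thesis unfolding K_iff by (intro bexI[of _ "a * b"] exI[of _ "m * n"]) auto
qed

lemma K_add [simp, intro]: "x \<in> K \<Longrightarrow> y \<in> K \<Longrightarrow> x + y \<in> K"
proof -
  assume "x \<in> K" "y \<in> K"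
  then obtain a m b n
    where "a \<in> \<O>" "m \<noteq> (0::int)" "x = a / of_int m" "b \<in> \<O>" "n \<noteq> (0::int)"
      "y = b / of_int n"
    by (auto simp: K_iff)
  then show ?thesis unfolding K_iff
    by (intro bexI[of _ "of_int n * a + of_int m * b"] exI[of _ "m * n"]) (auto simp: field_simps)
qed

lemma K_uminus [simp, intro]: "x \<in> K \<Longrightarrow> - x \<in> K"
  using K_mult[of "-1" x] O_subset_K[of "-1"] by (metis O_1 O_minus mult_minus1)

lemma K_inverse [simp, intro]: "x \<in> K \<Longrightarrow> inverse x \<in> K"
proof (cases "x = 0")
  assume "x \<in> K" "x \<noteq> 0"
  then obtain a m where a: "a \<in> \<O>" "m \<noteq> (0::int)" "x = a / of_int m" by (auto simp: K_iff)
  then have "a \<noteq> 0" using \<open>x \<noteq> 0\<close> by auto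
  then have "qnorm a \<noteq> 0" using a by simp
  moreover have "inverse x = (of_int m * qconj a) / of_int (qnorm a)"
    using a \<open>a \<noteq> 0\<close> \<open>qnorm a \<noteq> 0\<close> mult_conj[OF a(1)]
    by (simp add: frac_eq_eq mult.commute)
  ultimately show ?thesis using a unfolding K_iff by blast
qed simp

lemma K_divide [simp, intro]: "x \<in> K \<Longrightarrow> y \<in> K \<Longrightarrow> x / y \<in> K"
  by (simp add: divide_inverse)

lemma O_algebraic_int: assumes "x \<in> \<O>" shows "algebraic_int x"
proof
  let ?p = "[:of_int (qnorm x), - of_int (qtrace x), 1:] :: real poly"
  show "lead_coeff ?p = 1" by simp
  show "\<forall>i. coeff ?p i \<in> \<int>" by (auto simp: coeff_pCons split: nat.splits)
  show "poly ?p x = 0" using square_eq[OF assms] by (simp add: algebra_simps)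
qed

text \<open>The powers of an algebraic integer of \<open>K\<close> have a common denominator, which forces its norm to
  be an integer; applied to \<open>x\<close> and \<open>x + 1\<close> this also gives the trace.\<close>

lemma algebraic_int_bounded_denominators:
  assumes "x \<in> K" "algebraic_int x"
  obtains c :: int where "c \<noteq> 0" "\<And>k. of_int c * x ^ k \<in> \<O>"
proof -
  obtain y m where y: "y \<in> \<O>" "m \<noteq> (0::int)" "x = y / of_int m"
    using assms(1) by (auto simp: K_iff)
  from assms(2) obtain p where p: "lead_coeff p = 1" "\<forall>i. coeff p i \<in> \<int>" "poly p x = 0"
    by (auto simp: algebraic_int.simps)
  define n where "n = degree p"
  \<comment> \<open>\<open>m ^ n\<close> clears the denominators of all powers below the degree
    \<open>n\<close>; the monic equation reduces every higher power to smaller ones.\<close>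
  have "of_int (m ^ n) * x ^ k \<in> \<O>" for k
  proof (induction k rule: less_induct)
    case (less k)
    show ?case
    proof (cases "k < n")
      case True
      have "of_int (m ^ n) * x ^ k = of_int (m ^ (n - k)) * (of_int m * x) ^ k"
        using True by (simp add: power_mult_distrib flip: power_add mult.assoc)
      also have "of_int m * x = y" using y by simp
      finally show ?thesis using y by simp
    next
      case False
      have "(\<Sum>i\<le>n. coeff p i * x ^ i) = 0" using p(3) by (simp add: poly_altdef n_def)
      then have xn: "x ^ n = - (\<Sum>i<n. coeff p i * x ^ i)"
        using p(1) by (simp add: lessThan_Suc_atMost[symmetric] n_def)
      have "of_int (m ^ n) * x ^ k = of_int (m ^ n) * (x ^ (k - n) * x ^ n)"
        using False by (simp flip: power_add)
      also have "\<dots> = - (\<Sum>i<n. coeff p i * (of_int (m ^ n) * x ^ (k - n + i)))"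
        by (simp add: xn sum_distrib_left power_add algebra_simps)
      finally have e: "of_int (m ^ n) * x ^ k = \<dots>" .
      have "coeff p i * (of_int (m ^ n) * x ^ (k - n + i)) \<in> \<O>" if "i < n" for i
      proof -
        obtain z where "coeff p i = of_int z" using p(2) by (auto elim: Ints_cases)
        moreover have "of_int (m ^ n) * x ^ (k - n + i) \<in> \<O>" using less that False by simp
        ultimately show ?thesis by (simp only: O_mult O_of_int)
      qed
      then show ?thesis unfolding e by (intro O_minus O_sum) auto
    qed
  qed
  then show ?thesis using y(2) by (intro that[of "m ^ n"]) auto
qed

text \<open>Taking norms shows that \<open>(m * m) ^ k\<close> divides \<open>c * c\<close> times
  \<open>qnorm y ^ k\<close> for every \<open>k\<close>, and
  \<open>dvd_of_power_dvd_mult_power\<close> removes the constant factor.\<close>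

lemma bounded_denominators_qnorm:
  assumes "y \<in> \<O>" "m \<noteq> 0" "c \<noteq> 0"
    "\<And>k. of_int c * (y / of_int m) ^ k \<in> \<O>"
  shows "m * m dvd qnorm y"
proof (rule dvd_of_power_dvd_mult_power)
  fix k
  have e: "of_int (m ^ k) * (of_int c * (y / of_int m) ^ k) = of_int c * y ^ k"
    using assms(2) by (simp add: power_divide)
  have n: "qnorm (y ^ j) = qnorm y ^ j" for j using assms(1) by (induction j) (auto simp: qnorm_mult)
  have "qnorm (of_int c * y ^ k) = c * c * qnorm y ^ k" using assms by (simp add: n)
  moreover have "qnorm (of_int (m ^ k) * (of_int c * (y / of_int m) ^ k))
      = m ^ k * m ^ k * qnorm (of_int c * (y / of_int m) ^ k)"
    by (rule qnorm_of_int_mult[OF assms(4)])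
  ultimately show "(m * m) ^ k dvd (c * c) * qnorm y ^ k" 
    unfolding e by (metis dvd_triv_left power_mult_distrib)
qed (use assms in auto)

theorem ring_of_integers_eq: "ring_of_integers d = \<O>"
proof (intro equalityI subsetI)
  fix x assume "x \<in> ring_of_integers d"
  then have x: "x \<in> K" "algebraic_int x" by (auto simp: ring_of_integers_def)
  obtain y m where y: "y \<in> \<O>" "m \<noteq> (0::int)" "x = y / of_int m"
    using x by (auto simp: K_iff)
  obtain c where c: "c \<noteq> 0" "\<And>k. of_int c * x ^ k \<in> \<O>"
    using algebraic_int_bounded_denominators[OF x] by metis
  have n: "m * m dvd qnorm y" using bounded_denominators_qnorm[of y m c] y c by simp
  have "of_int c * (x + 1) ^ k \<in> \<O>" for k
  proof -
    have "of_int c * (x + 1) ^ k = (\<Sum>i\<le>k. of_int (int (k choose i)) * (of_int c * x ^ i))"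
      unfolding binomial_ring[of x 1 k] by (simp add: sum_distrib_left mult_ac)
    also have "\<dots> \<in> \<O>" by (intro O_sum O_mult[OF O_of_int] c(2))
    finally show ?thesis .
  qed
  moreover have "x + 1 = (y + of_int m) / of_int m" using y by (simp add: field_simps)
  ultimately have "m * m dvd qnorm (y + of_int m)"
    using bounded_denominators_qnorm[of "y + of_int m" m c] y c by simp
  also have "qnorm (y + of_int m) = qnorm y + m * m + m * qtrace y"
    using y by (simp add: qnorm_add mult.commute[of y])
  finally have "m * m dvd m * qtrace y"
    using n by (metis dvd_add_right_iff dvd_add_triv_right_iff dvd_add)
  then have "m dvd qtrace y" using y by simp
  then obtain z where "z \<in> \<O>" "y = of_int m * z" using O_of_dvd y n by blast
  then show "x \<in> \<O>" using y by simp
qed (auto simp: ring_of_integers_def O_subset_K O_algebraic_int)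

section \<open>Ramified, inert and split primes\<close>

lemma ramified_prime_iff: "ramified_prime d p \<longleftrightarrow> prime p \<and> p dvd disc"
  by (auto simp: ramified_prime_def kronecker_prime_eq kronecker_prime_def Legendre_def cong_0_iff split: if_splits)

text \<open>For odd \<open>p\<close>, \<open>disc\<close> is a nonresidue, so the square of the
  trace can agree with \<open>disc\<close> times the square of the
  \<open>\<omega>\<close>-coordinate modulo \<open>p\<close> only if \<open>p\<close> divides both.
  For \<open>p = 2\<close>, \<open>d\<close> is 5 modulo 8 and the norm form a^2 + ab + nb^2 has odd
  n, hence is even only when a and b are.\<close>

lemma inert_dvd:
  assumes p: "prime p" "\<not> split_prime d p" "\<not> p dvd disc" and x: "x \<in> \<O>"
    "p dvd qnorm x"
  shows "\<exists>y\<in>\<O>. x = of_int p * y"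
proof (cases "p = 2")
  case True
  have d4: "d mod 4 = 1" using p True by (auto simp: quadratic_discriminant_def split: if_splits)
  have "d mod 8 \<noteq> 1"
    using p True d4
    by (auto simp: split_prime_def kronecker_prime_eq kronecker_prime_def quadratic_discriminant_def)
  then have "d mod 8 = 5" using d4 by presburger
  then have "odd ((1 - d) div 4)" by presburger
  then have omega_norm: "odd omega_norm" "omega_trace = 1"
    using d4 by (auto simp: omega_norm_def omega_trace_def)
  obtain a b where ab: "x = qint a b" using x O_cases by blast
  have "even (a * a + a * b + omega_norm * b * b)" using x ab omega_norm True by (simp add: qnorm_qint)
  then have "even a" "even b" using omega_norm by auto
  then obtain a' b' where "a = 2 * a'" "b = 2 * b'" by (elim evenE)
  then have "x = of_int p * qint a' b'" by (simp add: ab qint_def algebra_simps True)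
  then show ?thesis by blast
next
  case False
  have odd: "odd p" using p False by (metis prime_ge_2_int prime_odd_int order_le_less)
  then have cop: "coprime p 4"
    by (metis coprime_commute coprime_left_2_iff_odd coprime_mult_left_iff mult_2 numeral_Bit0)
  have "Legendre disc p = -1"
    using p False
    by (auto simp: split_prime_def kronecker_prime_eq kronecker_prime_def Legendre_def cong_0_iff split: if_splits)
  moreover have "p dvd 4 * qnorm x" using x by simp
  then have *: "p dvd qtrace x ^ 2 - disc * omega_coord x ^ 2" by (simp add: four_qnorm)
  then have "[(omega_coord x)\<^sup>2 * disc = (qtrace x)\<^sup>2] (mod p)"
    by (simp add: cong_iff_dvd_diff dvd_diff_commute mult.commute)
  ultimately have "\<not> coprime (omega_coord x) p" using Legendre_neq_minus_one_if_square p by blast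
  then have s: "p dvd omega_coord x"
    using p prime_imp_coprime[of p "omega_coord x"] by (auto simp: coprime_commute)
  then have "p dvd qtrace x ^ 2"
    using *
    by (metis dvd_diff_right_iff dvd_mult power2_eq_square dvd_diffD1 dvd_add_right_iff diff_add_cancel dvd_diff)
  then have t: "p dvd qtrace x" using p prime_dvd_power by blast
  have "p * p dvd 4 * qnorm x" unfolding four_qnorm using s t
    by (intro dvd_diff dvd_mult) (auto simp: power2_eq_square mult_dvd_mono)
  then have "p * p dvd qnorm x" using cop by (simp add: coprime_dvd_mult_right_iff)
  then show ?thesis using O_of_dvd[of x p] x t p by auto
qed

lemma nonsplit_dvd_qtrace:
  assumes "prime p" "\<not> split_prime d p" "x \<in> \<O>" "p dvd qnorm x"
  shows "p dvd qtrace x"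
proof (cases "p dvd disc")
  case True
  have "p dvd 4 * qnorm x" using assms by simp
  moreover have "p dvd disc * omega_coord x ^ 2" using True by simp
  ultimately have "p dvd qtrace x ^ 2" unfolding four_qnorm by (metis diff_add_cancel dvd_add)
  then show ?thesis using assms prime_dvd_power by blast
next
  case False
  then show ?thesis using inert_dvd[of p x] assms by auto
qed

text \<open>For nonsplit \<open>p\<close> the elements with norm divisible by \<open>p\<close> form
  the only prime ideal above \<open>p\<close>. Closure under sums holds because the mixed term is
  the trace of an element whose norm is again divisible by \<open>p\<close>.\<close>

lemma nonsplit_dvd_qnorm_add:
  assumes "prime p" "\<not> split_prime d p" "x \<in> \<O>" "p dvd qnorm x" "y \<in> \<O>"
    "p dvd qnorm y"
  shows "p dvd qnorm (x + y)"
  using assms nonsplit_dvd_qtrace[of p "x * qconj y"] by (simp add: qnorm_add qnorm_mult)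

lemma unit_iff:
  assumes "x \<in> \<O>"
  shows "\<bar>qnorm x\<bar> = 1 \<longleftrightarrow> (\<exists>y\<in>\<O>. x * y = 1)"
proof
  assume "\<bar>qnorm x\<bar> = 1"
  then have "of_int (qnorm x) * of_int (qnorm x) = (1::real)" by (auto simp: abs_if split: if_splits)
  then have "x * (of_int (qnorm x) * qconj x) = 1" using mult_conj[OF assms]
    by (metis mult.left_commute)
  then show "\<exists>y\<in>\<O>. x * y = 1" by blast
next
  assume "\<exists>y\<in>\<O>. x * y = 1"
  then obtain y where "y \<in> \<O>" "x * y = 1" by blast
  then have "qnorm x * qnorm y = 1" using assms qnorm_mult[of x y] by simp
  then show "\<bar>qnorm x\<bar> = 1" by (metis abs_mult abs_1 zmult_eq_1_iff abs_minus_cancel)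
qed

section \<open>Invertible ideals and the Picard group\<close>

abbreviation KR :: "real ring" where "KR \<equiv> quadratic_field d"

lemma KR_simps [simp]: "monoid.mult KR = (*)" "one KR = 1" "ring.zero KR = 0" "add KR = (+)"
  by (simp_all add: quadratic_field_def)

lemma domain_KR: "domain KR"
proof -
  have "domain \<lparr>carrier = K, monoid.mult = (*), one = 1, ring.zero = 0, add = (+)\<rparr>"
    by (rule domain_subring_real) (auto simp: O_subset_K)
  then show ?thesis by (simp add: quadratic_field_def)
qed

lemma a_inv_KR: "x \<in> K \<Longrightarrow> inv\<^bsub>add_monoid KR\<^esub> x = - x"
proof -
  assume x: "x \<in> K"
  interpret domain KR by (rule domain_KR)
  have "\<ominus>\<^bsub>KR\<^esub> x = - x" using x by (intro minus_equality) auto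
  then show ?thesis by (simp add: a_inv_def)
qed

end

locale real_quadratic_order = real_quadratic +
  fixes f :: int
  assumes f_pos: "f > 0"
begin

abbreviation R :: "real set" where "R \<equiv> quadratic_order d f"

lemma R_iff: "x \<in> R \<longleftrightarrow> x \<in> \<O> \<and> f dvd omega_coord x"
  by (rule order_iff)

lemma R_in_O: "x \<in> R \<Longrightarrow> x \<in> \<O>" using R_iff by blast
lemma R_in_K: "x \<in> R \<Longrightarrow> x \<in> K" using R_in_O O_subset_K by blast

lemma R_closed [simp, intro]:
  shows R_add: "x \<in> R \<Longrightarrow> y \<in> R \<Longrightarrow> x + y \<in> R"
  and R_diff: "x \<in> R \<Longrightarrow> y \<in> R \<Longrightarrow> x - y \<in> R"
  and R_mult: "x \<in> R \<Longrightarrow> y \<in> R \<Longrightarrow> x * y \<in> R"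
  and R_conj: "x \<in> R \<Longrightarrow> qconj x \<in> R"
  and R_of_int: "of_int m \<in> R"
  and R_0: "0 \<in> R" and R_1: "1 \<in> R"
  unfolding R_iff by (auto simp: omega_coord_add omega_coord_diff omega_coord_mult)

lemma R_f_mult [simp, intro]: "x \<in> \<O> \<Longrightarrow> of_int f * x \<in> R"
  by (simp add: R_iff)

lemma R_uminus [simp, intro]: "x \<in> R \<Longrightarrow> - x \<in> R"
  using R_diff[of 0 x] by simp

definition is_ideal :: "real set \<Rightarrow> bool" where
  "is_ideal I \<longleftrightarrow> I \<subseteq> R \<and> 0 \<in> I \<and> (\<forall>x\<in>I. \<forall>y\<in>I. x + y \<in> I) \<and> (\<forall>r\<in>R. \<forall>x\<in>I. r * x \<in> I)"

abbreviation FM :: "real set monoid" where "FM \<equiv> fractional_ideal_monoid KR R"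

abbreviation iprod :: "real set \<Rightarrow> real set \<Rightarrow> real set"
  where "iprod \<equiv> ideal_prod KR"

lemma iprod_mult: "i \<in> I \<Longrightarrow> j \<in> J \<Longrightarrow> i * j \<in> iprod I J"
  using ideal_prod.prod[of i I j J KR] by simp

lemma iprod_add: "x \<in> iprod I J \<Longrightarrow> y \<in> iprod I J \<Longrightarrow> x + y \<in> iprod I J"
  using ideal_prod.sum[of x KR I J y] by simp

lemma iprod_induct [consumes 1, case_names prod sum]:
  assumes "x \<in> iprod I J" "\<And>i j. i \<in> I \<Longrightarrow> j \<in> J \<Longrightarrow> P (i * j)"
    "\<And>x y. P x \<Longrightarrow> P y \<Longrightarrow> P (x + y)"
  shows "P x"
  using assms(1) by (induction rule: ideal_prod.induct) (auto intro: assms)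

lemma iprod_commute: "iprod I J = iprod J I"
proof -
  have "iprod I J \<subseteq> iprod J I" for I J
  proof
    fix x assume "x \<in> iprod I J"
    then show "x \<in> iprod J I"
      by (induction rule: iprod_induct) (auto intro: iprod_add, metis iprod_mult mult.commute)
  qed
  then show ?thesis by blast
qed

lemma fractional_idealI:
  assumes "I \<subseteq> K" "0 \<in> I" "\<And>x y. x \<in> I \<Longrightarrow> y \<in> I \<Longrightarrow> x + y \<in> I"
    "\<And>r x. r \<in> R \<Longrightarrow> x \<in> I \<Longrightarrow> r * x \<in> I" "c \<in> R"
      "c \<noteq> 0" "\<And>x. x \<in> I \<Longrightarrow> c * x \<in> R"
  shows "fractional_ideal KR R I"
  unfolding fractional_ideal_def
proof (intro conjI)
  have "- x \<in> I" if "x \<in> I" for x using assms(4)[of "-1" x] that R_uminus[OF R_1] by simp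
  then show "subgroup I (add_monoid KR)"
    using assms(1-3) a_inv_KR by (intro subgroup.intro) (auto simp: subset_iff)
  show "\<exists>r\<in>R - {\<zero>\<^bsub>KR\<^esub>}. \<forall>x\<in>I. r \<otimes>\<^bsub>KR\<^esub> x \<in> R"
    using assms by (intro bexI[of _ c]) auto
qed (use assms in auto)

lemma fractional_idealD:
  assumes "fractional_ideal KR R I"
  shows "I \<subseteq> K" "0 \<in> I" "\<And>x y. x \<in> I \<Longrightarrow> y \<in> I \<Longrightarrow> x + y \<in> I"
    "\<And>r x. r \<in> R \<Longrightarrow> x \<in> I \<Longrightarrow> r * x \<in> I"
proof -
  have I: "subgroup I (add_monoid KR)" using assms by (simp add: fractional_ideal_def)
  show "I \<subseteq> K" "0 \<in> I" "\<And>x y. x \<in> I \<Longrightarrow> y \<in> I \<Longrightarrow> x + y \<in> I"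
    using subgroup.subset[OF I] subgroup.one_closed[OF I] subgroup.m_closed[OF I] by simp_all
  show "\<And>r x. r \<in> R \<Longrightarrow> x \<in> I \<Longrightarrow> r * x \<in> I"
    using assms by (simp add: fractional_ideal_def)
qed

text \<open>The two conditions on products say that \<open>I\<close> times \<open>J\<close> is the
  principal ideal generated by \<open>c\<close>, so \<open>J\<close> divided by \<open>c\<close> is
  the inverse. In this form only ideals inside \<open>R\<close> occur.\<close>

definition invertible :: "real set \<Rightarrow> bool" where
  "invertible I \<longleftrightarrow> is_ideal I \<and> (\<exists>J c. is_ideal J \<and> c \<in> R \<and> c \<noteq> 0 \<and>
     (\<forall>i\<in>I. \<forall>j\<in>J. \<exists>r\<in>R. i * j = c * r) \<and> c \<in> iprod I J)"

definition principal :: "real set \<Rightarrow> bool" where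
  "principal I \<longleftrightarrow> (\<exists>x\<in>K. x \<noteq> 0 \<and> I = (*) x ` R)"

lemma is_idealD:
  assumes "is_ideal I"
  shows "I \<subseteq> R" "0 \<in> I" "\<And>x y. x \<in> I \<Longrightarrow> y \<in> I \<Longrightarrow> x + y \<in> I" "\<And>r x. r \<in> R \<Longrightarrow> x \<in> I \<Longrightarrow> r * x \<in> I"
  using assms by (auto simp: is_ideal_def)

lemma is_ideal_fractional: "is_ideal I \<Longrightarrow> fractional_ideal KR R I"
  by (rule fractional_idealI[of I 1]) (auto simp: is_ideal_def dest: R_in_K subsetD)

lemma iprod_R_closed:
  assumes "\<And>r x. r \<in> R \<Longrightarrow> x \<in> I \<Longrightarrow> r * x \<in> I"
    "r \<in> R" "x \<in> iprod I J"
  shows "r * x \<in> iprod I J"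
  using assms(3)
proof (induction rule: iprod_induct)
  case (prod i j)
  then show ?case using iprod_mult[of "r * i" I j J] assms by (simp add: mult.assoc)
next
  case (sum x y)
  then show ?case by (simp add: distrib_left iprod_add)
qed

lemma invertible_Units:
  assumes "invertible I" shows "I \<in> Units FM"
proof -
  obtain J c where J: "is_ideal I" "is_ideal J" "c \<in> R" "c \<noteq> 0" 
    and prd: "\<And>i j. i \<in> I \<Longrightarrow> j \<in> J \<Longrightarrow> \<exists>r\<in>R. i * j = c * r" and c: "c \<in> iprod I J"
    using assms by (auto simp: invertible_def)
  define J' where "J' = (\<lambda>x. x / c) ` J"
  note JD = is_idealD[OF J(2)]
  have J': "fractional_ideal KR R J'"
  proof (rule fractional_idealI[of _ c])
    show "J' \<subseteq> K" using JD(1) J(3) by (auto simp: J'_def dest!: subsetD R_in_K)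
    show "0 \<in> J'" using JD(2) by (force simp: J'_def)
    show "x + y \<in> J'" if "x \<in> J'" "y \<in> J'" for x y
      using that JD(3) by (auto simp: J'_def simp flip: add_divide_distrib)
    show "r * x \<in> J'" if "r \<in> R" "x \<in> J'" for r x
      using that JD(4) by (force simp: J'_def)
    show "c * x \<in> R" if "x \<in> J'" for x using that JD(1) J(4) by (auto simp: J'_def)
  qed (use J in auto)
  have "iprod I J' = R"
  proof (intro equalityI subsetI)
    fix x assume "x \<in> iprod I J'"
    then show "x \<in> R"
    proof (induction rule: iprod_induct)
      case (prod i j)
      then obtain j' where j': "j' \<in> J" "j = j' / c" by (auto simp: J'_def)
      obtain r where "r \<in> R" "i * j' = c * r" using prd prod(1) j' by blast
      then show ?case using j' J(4) by simp
    qed auto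
  next
    fix r assume r: "r \<in> R"
    have "s / c \<in> iprod I J'" if "s \<in> iprod I J" for s
      using that
    proof (induction rule: iprod_induct)
      case (prod i j)
      then show ?case using iprod_mult[of i I "j / c" J'] by (auto simp: J'_def)
    next
      case (sum x y)
      then show ?case by (simp add: add_divide_distrib iprod_add)
    qed
    then have "1 \<in> iprod I J'" using c J(4) by fastforce
    then show "r \<in> iprod I J'"
      using iprod_R_closed[of I r 1 J'] is_idealD[OF J(1)] r by simp
  qed
  moreover have "iprod J' I = iprod I J'" by (rule iprod_commute)
  ultimately show ?thesis using J' is_ideal_fractional[OF J(1)]
    by (auto simp: Units_def fractional_ideal_monoid_def)
qed

lemma principal_eq: "principal_fractional_ideals KR R = (\<lambda>x. (*) x ` R) ` (K - {0})"
  by (auto simp: principal_fractional_ideals_def l_coset_def image_def)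

lemma iprod_principal:
  assumes "fractional_ideal KR R J"
  shows "iprod ((*) x ` R) J = (*) x ` J"
proof (intro equalityI subsetI)
  note J = fractional_idealD[OF assms]
  fix y assume "y \<in> iprod ((*) x ` R) J"
  then show "y \<in> (*) x ` J"
  proof (induction rule: iprod_induct)
    case (prod i j)
    then show ?case using J(4) by (auto simp: mult.assoc)
  next
    case (sum y z)
    then show ?case using J(3) by (auto simp flip: distrib_left)
  qed
next
  fix y assume "y \<in> (*) x ` J"
  then obtain z where "z \<in> J" "y = x * z" by auto
  moreover have "x \<in> (*) x ` R" using imageI[OF R_1, of "(*) x"] by simp
  ultimately show "y \<in> iprod ((*) x ` R) J" by (simp add: iprod_mult)
qed

definition pcoset :: "real set \<Rightarrow> real set set" where
  "pcoset I = principal_fractional_ideals KR R #>\<^bsub>units_of FM\<^esub> I"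

lemma pcoset_eq: "fractional_ideal KR R I \<Longrightarrow> pcoset I = {(*) x ` I | x. x \<in> K \<and> x \<noteq> 0}"
  by (auto simp: pcoset_def r_coset_def units_of_def fractional_ideal_monoid_def principal_eq iprod_principal)

lemma Units_fractional: "I \<in> Units FM \<Longrightarrow> fractional_ideal KR R I"
  by (simp add: Units_def fractional_ideal_monoid_def)

lemma pcoset_self: "fractional_ideal KR R I \<Longrightarrow> I \<in> pcoset I"
  using O_subset_K[of 1] by (force simp: pcoset_eq)

lemma carrier_Pic: "carrier (Pic KR R) = pcoset ` Units FM"
  by (simp add: Pic_def carrier_FactGroup pcoset_def units_of_def image_def)

lemma is_ideal_R: "is_ideal R" by (auto simp: is_ideal_def)

lemma invertible_R: "invertible R"
  unfolding invertible_def using is_ideal_R iprod_mult[of 1 R 1 R]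
  by (intro conjI exI[of _ R] exI[of _ 1]) auto

text \<open>Otherwise the classes of \<open>I\<close>, \<open>J\<close> and \<open>R\<close> would
  be three distinct elements of a group of order 2.\<close>

lemma nonprincipal_equivalent:
  assumes card: "order (Pic KR R) = 2"
    and "invertible I" "\<not> principal I" "invertible J" "\<not> principal J"
  shows "\<exists>x\<in>K. x \<noteq> 0 \<and> I = (*) x ` J"
proof -
  have U: "I \<in> Units FM" "J \<in> Units FM" "R \<in> Units FM"
    using assms invertible_Units invertible_R by auto
  note F = U[THEN Units_fractional]
  have np: "pcoset H \<noteq> pcoset R" if "fractional_ideal KR R H" "\<not> principal H" for H
    using pcoset_self[OF that(1)] that(2) by (auto simp: pcoset_eq[OF F(3)] principal_def)
  have c2: "card (pcoset ` Units FM) = 2" using card by (simp add: Coset.order_def carrier_Pic)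
  \<comment> \<open>\<open>card\<close> is 0 on infinite sets, so the value 2 implies
    finiteness.\<close>
  then have fin: "finite (pcoset ` Units FM)" by (metis card.infinite zero_neq_numeral)
  have "pcoset I = pcoset J"
  proof (rule ccontr)
    assume "pcoset I \<noteq> pcoset J"
    then have "card {pcoset I, pcoset J, pcoset R} = 3" using np F assms by auto
    moreover have "card {pcoset I, pcoset J, pcoset R} \<le> card (pcoset ` Units FM)"
      using U fin by (intro card_mono) auto
    ultimately show False using c2 by simp
  qed
  then show ?thesis using pcoset_self[OF F(1)] by (auto simp: pcoset_eq[OF F(2)])
qed

text \<open>If all invertible ideals were principal, there would be a single class. The inverse
  \<open>J\<close> is returned as well, since multipliers for \<open>I\<close> will be chosen from
  it.\<close>

lemma exists_nonprincipal:
  assumes card: "order (Pic KR R) = 2"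
  obtains I J
    where "fractional_ideal KR R I" "fractional_ideal KR R J" "iprod I J = R" "\<not> principal I"
proof -
  have "\<exists>I\<in>Units FM. \<not> principal I"
  proof (rule ccontr)
    assume "\<not> ?thesis"
    then have p: "principal I" if "I \<in> Units FM" for I using that by blast
    have RF: "R \<in> Units FM" using invertible_Units invertible_R by auto
    have "pcoset I = pcoset R" if I: "I \<in> Units FM" for I
    proof -
      obtain x where x: "x \<in> K" "x \<noteq> 0" "I = (*) x ` R"
        using p[OF I] by (auto simp: principal_def)
      have "{(*) y ` I | y. y \<in> K \<and> y \<noteq> 0} = {(*) y ` R | y. y \<in> K \<and> y \<noteq> 0}"
      proof (intro equalityI subsetI)
        fix S assume "S \<in> {(*) y ` I | y. y \<in> K \<and> y \<noteq> 0}"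
        then obtain y where "y \<in> K" "y \<noteq> 0" "S = (*) y ` I" by blast
        then have "S = (*) (y * x) ` R" "y * x \<in> K" "y * x \<noteq> 0"
          using x by (auto simp: image_image mult.assoc)
        then show "S \<in> {(*) y ` R | y. y \<in> K \<and> y \<noteq> 0}" by blast
      next
        fix S assume "S \<in> {(*) y ` R | y. y \<in> K \<and> y \<noteq> 0}"
        then obtain y where "y \<in> K" "y \<noteq> 0" "S = (*) y ` R" by blast
        then have "S = (*) (y / x) ` I" "y / x \<in> K" "y / x \<noteq> 0"
          using x by (auto simp: image_image)
        then show "S \<in> {(*) y ` I | y. y \<in> K \<and> y \<noteq> 0}" by blast
      qed
      then show ?thesis using I RF by (simp add: pcoset_eq Units_fractional)
    qed
    then have "pcoset ` Units FM = (\<lambda>_. pcoset R) ` Units FM" by (rule image_cong[OF refl])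
    then have "pcoset ` Units FM = {pcoset R}" using RF by auto
    then show False using card by (simp add: Coset.order_def carrier_Pic)
  qed
  then obtain I where I: "I \<in> Units FM" "\<not> principal I" by blast
  then obtain J where "fractional_ideal KR R J" "iprod I J = R"
    by (auto simp: Units_def fractional_ideal_monoid_def)
  then show ?thesis using that I Units_fractional by blast
qed

section \<open>Ideals with two generators\<close>

definition gen2 :: "real \<Rightarrow> real \<Rightarrow> real set" where
  "gen2 x y = {x * r + y * s | r s. r \<in> R \<and> s \<in> R}"

lemma gen2I: "r \<in> R \<Longrightarrow> s \<in> R \<Longrightarrow> x * r + y * s \<in> gen2 x y"
  by (auto simp: gen2_def)

lemma gen2_left: "x \<in> gen2 x y" and gen2_right: "y \<in> gen2 x y"
  using gen2I[of 1 0 x y] gen2I[of 0 1 x y] by simp_all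

lemma is_ideal_gen2: assumes "x \<in> R" "y \<in> R" shows "is_ideal (gen2 x y)"
  unfolding is_ideal_def
proof (intro conjI ballI)
  show "gen2 x y \<subseteq> R" using assms by (auto simp: gen2_def)
  show "0 \<in> gen2 x y" using gen2I[of 0 0 x y] by simp
  fix u v assume "u \<in> gen2 x y" "v \<in> gen2 x y"
  then obtain r s r' s'
    where "r \<in> R" "s \<in> R" "u = x * r + y * s" "r' \<in> R" "s' \<in> R" "v = x * r' + y * s'"
    by (auto simp: gen2_def)
  then show "u + v \<in> gen2 x y" using gen2I[of "r + r'" "s + s'" x y] by (simp add: algebra_simps)
next
  fix t u assume t: "t \<in> R" and "u \<in> gen2 x y"
  then obtain r s where "r \<in> R" "s \<in> R" "u = x * r + y * s" by (auto simp: gen2_def)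
  then show "t * u \<in> gen2 x y" using gen2I[of "t * r" "t * s" x y] t by (simp add: algebra_simps)
qed

lemma gen2_conj_mult:
  assumes "m \<noteq> 0" "a \<in> R" "m dvd qnorm a" "i \<in> gen2 (of_int m) a"
    "j \<in> gen2 (of_int m) (qconj a)"
  shows "\<exists>r\<in>R. i * j = of_int m * r"
proof -
  obtain k where k: "qnorm a = m * k" using assms by auto
  obtain r s r' s' where *: "r \<in> R" "s \<in> R" "i = of_int m * r + a * s" "r' \<in> R"
    "s' \<in> R" "j = of_int m * r' + qconj a * s'"
    using assms(4,5) by (auto simp: gen2_def)
  have "i * j = of_int m * (of_int m * r * r' + r * qconj a * s' + a * s * r') + (a * qconj a) * (s * s')"
    by (simp add: * algebra_simps)
  also have "a * qconj a = of_int m * of_int k" using mult_conj[OF R_in_O[OF assms(2)]] k by simp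
  finally have "i * j = of_int m * (of_int m * r * r' + r * qconj a * s' + a * s * r' + of_int k * (s * s'))"
    by (simp add: algebra_simps)
  then show ?thesis using * assms by blast
qed

text \<open>The product of \<open>(m, a)\<close> with its conjugate is \<open>m\<close> times the
  ideal generated by \<open>m\<close>, \<open>a\<close>, \<open>qconj a\<close> and
  \<open>k\<close>. That ideal contains \<open>m\<close>, \<open>qtrace a\<close> and
  \<open>k\<close>, so it is the unit ideal.\<close>

lemma invertible_gen2:
  assumes "m \<noteq> 0" "a \<in> R" "qnorm a = m * k" "gcd (gcd m (qtrace a)) k = 1"
  shows "invertible (gen2 (of_int m) a)"
  unfolding invertible_def
proof (intro conjI exI[of _ "gen2 (of_int m) (qconj a)"] exI[of _ "of_int m"] ballI)
  let ?I = "gen2 (of_int m) a" and ?J = "gen2 (of_int m) (qconj a)"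
  show "is_ideal ?I" "is_ideal ?J" using assms by (auto intro: is_ideal_gen2)
  show "\<exists>r\<in>R. i * j = of_int m * r" if "i \<in> ?I" "j \<in> ?J" for i j
    using gen2_conj_mult[of m a i j] that assms by simp
  obtain u v w where uvw: "u * m + v * qtrace a + w * k = 1" using bezout3_int[OF assms(4)] .
  have c: "a + qconj a = of_int (qtrace a)" "a * qconj a = of_int m * of_int k"
    using assms R_in_O by (auto simp: add_conj mult_conj)
  have "of_int m * (of_int u * of_int m + of_int v * (a + qconj a) + of_int w * of_int k) = real_of_int (m * (u * m + v * qtrace a + w * k))"
    by (simp add: c)
  then have "of_int m = of_int m * (of_int u * of_int m + of_int v * (a + qconj a) + of_int w * of_int k)"
    by (simp add: uvw)
  also have "\<dots> = (of_int m * of_int u + a * 0) * of_int m + (of_int m * of_int v + a * 0) * qconj a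
     + (of_int m * 0 + a * of_int v) * of_int m + (of_int m * 0 + a * of_int w) * qconj a"
    using c(2) by (simp add: algebra_simps)
  also have "\<dots> \<in> iprod ?I ?J"
    by (intro iprod_add iprod_mult gen2I gen2_left gen2_right R_of_int R_0)
  finally show "of_int m \<in> iprod ?I ?J" .
qed (use assms in auto)

end

section \<open>Norms of irreducible elements of the maximal order\<close>

context real_quadratic
begin

sublocale maximal: real_quadratic_order d 1
  by unfold_locales simp

definition dvdO :: "real \<Rightarrow> real \<Rightarrow> bool" where
  "dvdO x y \<longleftrightarrow> (\<exists>z\<in>\<O>. y = x * z)"

lemma dvdOI: "z \<in> \<O> \<Longrightarrow> y = x * z \<Longrightarrow> dvdO x y"
  by (auto simp: dvdO_def)

lemma dvdO_add: "dvdO x y \<Longrightarrow> dvdO x z \<Longrightarrow> dvdO x (y + z)"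
  by (auto simp: dvdO_def simp flip: distrib_left)

lemma dvdO_mult: "dvdO x y \<Longrightarrow> z \<in> \<O> \<Longrightarrow> dvdO x (z * y)"
  by (auto simp: dvdO_def mult.left_commute)

lemma dvdO_qnorm: "dvdO x y \<Longrightarrow> x \<in> \<O> \<Longrightarrow> qnorm x dvd qnorm y"
  by (auto simp: dvdO_def qnorm_mult)

lemma dvdO_conj_iff: "x \<in> \<O> \<Longrightarrow> dvdO (of_int m) (qconj x) \<longleftrightarrow> dvdO (of_int m) x"
proof -
  have "dvdO (of_int m) (qconj x)" if "dvdO (of_int m) x" for x
    using that by (auto simp: dvdO_def conj_mult)
  from this[of x] this[of "qconj x"] show "x \<in> \<O> \<Longrightarrow> ?thesis" by auto
qed

lemma dvdO_of_int: "x \<in> \<O> \<Longrightarrow> m \<noteq> 0 \<Longrightarrow> m dvd qtrace x \<Longrightarrow> m * m dvd qnorm x \<Longrightarrow> dvdO (of_int m) x"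
  using O_of_dvd by (auto simp: dvdO_def)

lemma dvdO_of_intD:
  assumes "dvdO (of_int m) x" shows "m dvd qtrace x" "m * m dvd qnorm x"
  using assms by (auto simp: dvdO_def)

definition max_irreducible :: "real \<Rightarrow> bool" where
  "max_irreducible x \<longleftrightarrow> x \<in> \<O> \<and> x \<noteq> 0 \<and> \<bar>qnorm x\<bar> \<noteq> 1 \<and>
     (\<forall>y\<in>\<O>. \<forall>z\<in>\<O>. x = y * z \<longrightarrow> \<bar>qnorm y\<bar> = 1 \<or> \<bar>qnorm z\<bar> = 1)"

lemma max_irreducibleD: "max_irreducible x \<Longrightarrow> x \<in> \<O>"
  "max_irreducible x \<Longrightarrow> x \<noteq> 0"
    "max_irreducible x \<Longrightarrow> \<bar>qnorm x\<bar> \<noteq> 1"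
  by (auto simp: max_irreducible_def)

lemma max_irreducible_qnorm_eq:
  assumes "max_irreducible a" "dvdO x a" "x \<in> \<O>" "\<bar>qnorm x\<bar> \<noteq> 1"
  shows "\<bar>qnorm a\<bar> = \<bar>qnorm x\<bar>"
proof -
  obtain y where "y \<in> \<O>" "a = x * y" using assms by (auto simp: dvdO_def)
  moreover from this have "\<bar>qnorm y\<bar> = 1" using assms by (auto simp: max_irreducible_def)
  ultimately show ?thesis using assms by (simp add: qnorm_mult abs_mult)
qed

definition is_norm :: "int \<Rightarrow> bool"
  where "is_norm q \<longleftrightarrow> (\<exists>x\<in>\<O>. \<bar>qnorm x\<bar> = q)"

text \<open>In terms of ideals: \<open>x\<close> and \<open>qconj x\<close> generate the primes
  above \<open>q\<close>, and one of these contains \<open>a\<close>.\<close>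

lemma prime_norm_dvdO:
  assumes q: "prime q" and x: "x \<in> \<O>" "\<bar>qnorm x\<bar> = q" and a: "a \<in> \<O>"
    "q dvd qnorm a"
  shows "dvdO x a \<or> dvdO (qconj x) a"
proof -
  \<comment> \<open>One of \<open>a * x\<close>, \<open>a * qconj x\<close> is divisible by \<open>q\<close>: \<open>q\<^sup>2\<close> divides both norms, and \<open>q\<close> divides the
    product of the two traces.\<close>
  have key: "dvdO (qconj y) a" if y: "y \<in> \<O>" "\<bar>qnorm y\<bar> = q"
      and t: "q dvd qtrace (a * y)" for y
  proof -
    have "q * q dvd qnorm (a * y)" using a y by (auto simp: qnorm_mult intro!: mult_dvd_mono)
    then have "dvdO (of_int q) (a * y)" using a y t q by (intro dvdO_of_int) auto
    then obtain z where z: "z \<in> \<O>" "a * y = of_int q * z" by (auto simp: dvdO_def)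
    define \<epsilon> where "\<epsilon> = sgn (qnorm y)"
    have e: "qnorm y = \<epsilon> * q" "\<epsilon> * \<epsilon> = 1"
      using y prime_gt_0_int[OF q] unfolding \<epsilon>_def
      by (auto simp: sgn_if)
    have "a * of_int (qnorm y) = (a * y) * qconj y" using y by (simp add: mult_conj[symmetric])
    also have "\<dots> = of_int q * (z * qconj y)" by (simp add: z)
    finally have "of_int q * (a * of_int \<epsilon>) = of_int q * (z * qconj y)"
      by (simp add: e mult_ac)
    then have ae: "a * of_int \<epsilon> = z * qconj y" using q by simp
    have "a = a * of_int (\<epsilon> * \<epsilon>)" by (simp add: e)
    also have "\<dots> = (a * of_int \<epsilon>) * of_int \<epsilon>" by simp
    also have "\<dots> = qconj y * (of_int \<epsilon> * z)" unfolding ae by simp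
    finally show ?thesis using z by (intro dvdOI[of "of_int \<epsilon> * z"]) auto
  qed
  have c: "qconj a * a = of_int (qnorm a)" "qconj x * x = of_int (qnorm x)"
    using a x by (auto simp: mult_conj mult.commute[of "qconj _"])
  have "of_int (qtrace (a * qconj x) * qtrace (a * x)) = (a * qconj x + qconj a * x) * (a * x + qconj a * qconj x)"
    using a x by (simp add: add_conj[symmetric] conj_mult)
  also have "\<dots> = (x * qconj x) * (a * a + qconj a * qconj a) + (a * qconj a) * (x * x + qconj x * qconj x)"
    by (simp add: algebra_simps)
  also have "\<dots> = of_int (qnorm x * qtrace (a * a) + qnorm a * qtrace (x * x))"
    using a x by (simp add: add_conj[symmetric] mult_conj[symmetric] conj_mult)
  finally have "qtrace (a * qconj x) * qtrace (a * x) = qnorm x * qtrace (a * a) + qnorm a * qtrace (x * x)" 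
    by (simp only: of_int_eq_iff)
  moreover have "q dvd qnorm x" using x by (metis dvd_abs_iff dvd_refl)
  ultimately have "q dvd qtrace (a * qconj x) * qtrace (a * x)" using a by simp
  then have "q dvd qtrace (a * qconj x) \<or> q dvd qtrace (a * x)" using q prime_dvd_mult_iff by blast
  then show ?thesis using key[of "qconj x"] key[of x] x by auto
qed

lemma max_irreducible_qnorm_is_norm:
  assumes "max_irreducible a" "prime q" "q dvd qnorm a" "is_norm q"
  shows "\<bar>qnorm a\<bar> = q"
proof -
  obtain x where x: "x \<in> \<O>" "\<bar>qnorm x\<bar> = q" using assms by (auto simp: is_norm_def)
  then have "dvdO x a \<or> dvdO (qconj x) a" using prime_norm_dvdO assms max_irreducibleD by blast
  moreover have "q \<noteq> 1" using assms by auto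
  ultimately show ?thesis
    using x assms max_irreducible_qnorm_eq[of a x] max_irreducible_qnorm_eq[of a "qconj x"] by auto
qed

lemma gen2_qnorm:
  assumes "a \<in> \<O>" "m dvd qnorm a" "z \<in> maximal.gen2 (of_int m) a"
  shows "z \<in> \<O>" "m dvd qnorm z"
proof -
  obtain r s where *: "r \<in> \<O>" "s \<in> \<O>" "z = of_int m * r + a * s"
    using assms by (auto simp: maximal.gen2_def)
  then show "z \<in> \<O>" using assms by auto
  have "qnorm z = m * m * qnorm r + qnorm a * qnorm s + m * qtrace (r * qconj (a * s))"
    using * assms by (simp add: qnorm_add qnorm_mult mult.assoc)
  then show "m dvd qnorm z" using assms by simp
qed

text \<open>If \<open>q\<close> divided both the trace and \<open>k\<close>, integral closedness
  would give that \<open>q\<close> divides \<open>a\<close>. A generator of \<open>(q, a)\<close>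
  has a norm divisible by \<open>q\<close> and dividing \<open>q * q\<close>: norm \<open>q\<close>
  up to sign would make \<open>q\<close> a norm, and norm \<open>q * q\<close> up to sign would make
  the generator an associate of \<open>q\<close>, which would then divide \<open>a\<close>.\<close>

lemma prime_gen2:
  assumes q: "prime q" and a: "a \<in> \<O>" "q dvd qnorm a" "\<not> dvdO (of_int q) a"
  shows prime_gen2_coprime: "qnorm a = q * k \<Longrightarrow> gcd (gcd q (qtrace a)) k = 1"
    and prime_gen2_invertible: "maximal.invertible (maximal.gen2 (of_int q) a)"
    and prime_gen2_nonprincipal: "\<not> is_norm q \<Longrightarrow> \<not> maximal.principal (maximal.gen2 (of_int q) a)"
proof -
  show g: "gcd (gcd q (qtrace a)) k = 1" if k: "qnorm a = q * k" for k
  proof (rule ccontr)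
    assume ne: "gcd (gcd q (qtrace a)) k \<noteq> 1"
    have "gcd (gcd q (qtrace a)) k dvd q" by (meson dvd_trans gcd_dvd1)
    then have "gcd (gcd q (qtrace a)) k = q" using q ne
      by (metis gcd_pos_int gcd_eq_0_iff not_prime_0 prime_int_iff order_less_imp_le)
    then have "q dvd qtrace a" "q dvd k" by (metis dvd_trans gcd_dvd1 gcd_dvd2)+
    then have "q dvd qtrace a" "q * q dvd qnorm a" using k by auto
    then show False using dvdO_of_int[of a q] a q by auto
  qed
  show "maximal.invertible (maximal.gen2 (of_int q) a)"
    using a q g by (auto elim!: dvdE intro!: maximal.invertible_gen2)
  assume nn: "\<not> is_norm q"
  show "\<not> maximal.principal (maximal.gen2 (of_int q) a)"
  proof
    assume "maximal.principal (maximal.gen2 (of_int q) a)"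
    then obtain x where x: "maximal.gen2 (of_int q) a = (*) x ` \<O>"
      by (auto simp: maximal.principal_def)
    have "x \<in> maximal.gen2 (of_int q) a" unfolding x using imageI[OF O_1, of "(*) x"] by simp
    then have xO: "x \<in> \<O>" "q dvd qnorm x" using gen2_qnorm[OF a(1,2)] by blast+
    have "of_int q \<in> (*) x ` \<O>" "a \<in> (*) x ` \<O>"
      using maximal.gen2_left[of "of_int q" a] maximal.gen2_right[of a "of_int q"] unfolding x .
    then obtain u v where u: "u \<in> \<O>" "of_int q = x * u" and v: "v \<in> \<O>" "a = x * v"
      by blast
    obtain k where k: "qnorm x = q * k" using xO by auto
    have "q * q = qnorm x * qnorm u" using u xO by (metis qnorm_mult qnorm_of_int)
    then have qk: "q = k * qnorm u" using k q by auto
    then have "\<bar>k\<bar> = 1 \<or> \<bar>k\<bar> = q"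
      using q by (metis abs_dvd_iff abs_ge_zero dvd_triv_left prime_int_iff)
    then show False
    proof
      assume "\<bar>k\<bar> = 1"
      then have "\<bar>qnorm x\<bar> = q" using k prime_gt_0_int[OF q] by (simp add: abs_mult)
      then show False using nn xO by (auto simp: is_norm_def)
    next
      assume "\<bar>k\<bar> = q"
      then have "\<bar>q\<bar> * 1 = \<bar>q\<bar> * \<bar>qnorm u\<bar>"
        using qk prime_gt_0_int[OF q] by (metis abs_mult abs_abs mult.right_neutral)
      then have "\<bar>qnorm u\<bar> = 1" using q by simp
      then obtain w where w: "w \<in> \<O>" "u * w = 1" using unit_iff u by blast
      have "a = x * (u * w) * v" using v w by simp
      also have "\<dots> = of_int q * (w * v)" using u by (simp add: mult_ac)
      finally show False using a(3) w v dvdOI by blast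
    qed
  qed
qed

text \<open>The ideals \<open>(q, a)\<close> and \<open>(q', qconj a)\<close> are nonprincipal,
  hence in the same class. Since \<open>(q', qconj a)\<close> is inverse to \<open>(q', a)\<close>
  up to the factor \<open>q'\<close>, the product of \<open>(q, a)\<close> and
  \<open>(q', a)\<close> is principal. Its generator divides \<open>a\<close> and has norm
  \<open>q * q'\<close> up to sign, so irreducibility of \<open>a\<close> determines the norm of
  \<open>a\<close>.\<close>

lemma max_irreducible_qnorm_two_primes:
  assumes card: "order (Pic KR \<O>) = 2" and a: "max_irreducible a"
    and q: "prime q" "prime q'" "q * q' dvd qnorm a" "\<not> is_norm q" "\<not> is_norm q'"
    and nd: "\<not> dvdO (of_int q) a" "\<not> dvdO (of_int q') a"
  shows "\<bar>qnorm a\<bar> = q * q'"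
proof -
  have aO: "a \<in> \<O>" using a max_irreducibleD by blast
  have qd: "q dvd qnorm a" "q' dvd qnorm a" "q' dvd qnorm (qconj a)" "\<not> dvdO (of_int q') (qconj a)"
    using q(3) aO nd dvdO_conj_iff by (auto dest: dvd_mult_left dvd_mult_right)
  obtain k where k: "qnorm a = q * q' * k" using q(3) by auto
  \<comment> \<open>Under these conditions \<open>r * r\<close> divides the norm and
    \<open>r\<close> the trace of \<open>a\<close>, so \<open>r\<close> would divide
    \<open>a\<close>.\<close>
  have npr: False if "prime r" "r = q \<or> r = q'" "r dvd qtrace a" "r dvd k \<or> q = q'" for r
  proof -
    have "r * r dvd qnorm a" using that k by auto
    then have "dvdO (of_int r) a" using that aO by (intro dvdO_of_int) auto
    then show False using that nd by auto
  qed
  define I where "I = maximal.gen2 (of_int q) a"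
  define J where "J = maximal.gen2 (of_int q') (qconj a)"
  obtain c where c: "I = (*) c ` J"
    using maximal.nonprincipal_equivalent[OF card, of I J] q qd aO nd prime_gen2
    unfolding I_def J_def by (metis conj_in_O)
  have J: "\<exists>r\<in>\<O>. j * y = of_int q' * r" if "j \<in> J"
    "y = of_int q' \<or> y = a" for j y
    using maximal.gen2_conj_mult[of q' "qconj a" j y] that aO qd q maximal.gen2_left maximal.gen2_right
    by (auto simp: J_def)
  \<comment> \<open>\<open>z\<close> generates the product of the ideals \<open>(q, a)\<close> and \<open>(q', a)\<close>.\<close>
  define z where "z = c * of_int q'"
  have zd: "dvdO z (i * y)" if i: "i \<in> I" "y = of_int q' \<or> y = a" for i y
  proof -
    obtain j where j: "j \<in> J" "i = c * j" using i c by auto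
    obtain r where "r \<in> \<O>" "j * y = of_int q' * r" using J[OF j(1) i(2)] by auto
    then show ?thesis using j by (intro dvdOI[of r]) (auto simp: z_def)
  qed
  have inI: "of_int q \<in> I" "a \<in> I"
    unfolding I_def by (rule maximal.gen2_left maximal.gen2_right)+
  have "z \<in> I" "c * qconj a \<in> I"
    unfolding z_def c J_def by (intro imageI maximal.gen2_left maximal.gen2_right)+
  note inI = inI this
  have IO: "i \<in> \<O>" if "i \<in> I" for i using gen2_qnorm that qd aO unfolding I_def by blast
  have zO: "z \<in> \<O>" using IO inI by blast
  have z_qq: "dvdO z (of_int (q * q'))" using zd[of "of_int q" "of_int q'"] inI by simp
  have z_a: "dvdO z a"
  proof -
    have "gcd (gcd q q') (qtrace a) = 1"
    proof (rule ccontr)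
      assume ne: "gcd (gcd q q') (qtrace a) \<noteq> 1"
      have "gcd (gcd q q') (qtrace a) \<noteq> 0" using q by auto
      then obtain r where r: "prime r" "r dvd gcd (gcd q q') (qtrace a)" using ne prime_divisor_exists
        by (metis abs_gcd_int is_unit_gcd_iff zdvd1_eq)
      then have "r dvd q" "r dvd q'" "r dvd qtrace a" by auto
      then have "r = q" "r = q'" using r q by (auto simp: primes_dvd_imp_eq)
      then show False using npr r \<open>r dvd qtrace a\<close> by blast
    qed
    then obtain u v w where uvw: "u * q + v * q' + w * qtrace a = 1" by (rule bezout3_int)
    \<comment> \<open>\<open>z\<close> divides \<open>a * a\<close> and \<open>q * q'\<close>, hence
      also \<open>qnorm a\<close>, and therefore \<open>qtrace a\<close> times \<open>a\<close>.
      Together with the multiples by \<open>q\<close> and \<open>q'\<close>, coprimality then yields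
      \<open>a\<close> itself.\<close>
    have "a * a + of_int (qnorm a) = of_int (qtrace a) * a" using square_eq[OF aO] by simp
    moreover have "of_int (qnorm a) = of_int k * real_of_int (q * q')" by (simp add: k mult_ac)
    ultimately have ta: "dvdO z (of_int (qtrace a) * a)"
      using dvdO_add[OF zd[OF inI(2), of a] dvdO_mult[OF z_qq O_of_int[of k]]] by simp
    have "dvdO z (of_int u * (of_int q * a) + of_int v * (a * of_int q') + of_int w * (of_int (qtrace a) * a))"
      using dvdO_mult[OF zd[OF inI(1), of a] O_of_int] dvdO_mult[OF zd[OF inI(2), of
      "of_int q'"] O_of_int]
        dvdO_mult[OF ta O_of_int] by (intro dvdO_add) auto
    also have "of_int u * (of_int q * a) + of_int v * (a * of_int q') + of_int w * (of_int (qtrace a) * a)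
      = of_int (u * q + v * q' + w * qtrace a) * a" by (simp add: algebra_simps)
    finally show ?thesis by (simp add: uvw)
  qed
  have "q * q' dvd qnorm z"
  proof -
    have gI: "i * y \<in> maximal.gen2 (of_int (q * q')) a" if i: "i \<in> I"
      and y: "y = of_int q' \<or> y = a" for i y
    proof (cases "y = a")
      case True
      then show ?thesis using maximal.gen2I[of 0 i "of_int (q * q')" a] IO i by (simp add: mult.commute)
    next
      case False
      obtain r s where "r \<in> \<O>" "s \<in> \<O>" "i = of_int q * r + a * s"
        using i by (auto simp: I_def maximal.gen2_def)
      then show ?thesis using False y maximal.gen2I[of r "s * of_int q'" "of_int (q * q')" a]
        by (simp add: algebra_simps)
    qed
    note ideal = maximal.is_idealD[OF maximal.is_ideal_gen2[OF O_of_int[of "q * q'"] aO]]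
    have "gcd (gcd q' (qtrace a)) (q * k) = 1"
      using prime_gen2_coprime[of q' a "q * k"] q qd aO nd k by simp
    then obtain u v w where uvw: "u * q' + v * qtrace a + w * (q * k) = 1" by (rule bezout3_int)
    \<comment> \<open>This exhibits \<open>z\<close> in the ideal generated by \<open>q * q'\<close>
      and \<open>a\<close>, all of whose elements have norm divisible by
      \<open>q * q'\<close>.\<close>
    have "z = z * of_int (u * q' + v * qtrace a + w * (q * k))" by (simp add: uvw)
    also have "\<dots> = of_int u * (z * of_int q') + of_int v * (z * of_int (qtrace a)) + of_int w * (c * of_int (qnorm a))"
      by (simp add: z_def k algebra_simps)
    also have "\<dots> = of_int u * (z * of_int q') + of_int v * (z * a + (c * qconj a) * of_int q') + of_int w * ((c * qconj a) * a)"
      unfolding add_conj[OF aO, symmetric] mult_conj[OF aO, symmetric]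
        by (simp add: z_def algebra_simps)
    also have "\<dots> \<in> maximal.gen2 (of_int (q * q')) a"
      by (intro ideal(3) ideal(4)[OF O_of_int] gI inI) auto
    finally show ?thesis using gen2_qnorm q(3) aO by blast
  qed
  then obtain g where g: "qnorm z = q * q' * g" by auto
  have qq0: "q * q' \<noteq> 0" using q by auto
  have "q * q' * g dvd q * q' * k" using dvdO_qnorm[OF z_a zO] k g by simp
  then have gk: "g dvd k" using qq0 by (simp add: mult.assoc)
  have "q * q' * g dvd (q * q') * (q * q')" using dvdO_qnorm[OF z_qq zO] g by (simp only: qnorm_of_int)
  then have gqq: "g dvd q * q'" using qq0 by simp
  \<comment> \<open>For \<open>a = z * y\<close> and \<open>q * q' = z * w\<close>, the element
    \<open>q * q' * a\<close> is \<open>qnorm z\<close> times \<open>qconj w * y\<close>; the factor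
    \<open>q * q'\<close> cancels on comparing traces. A prime factor of \<open>g\<close> would then
    contradict \<open>npr\<close>.\<close>
  have gt: "g dvd qtrace a"
  proof -
    obtain y w where y: "y \<in> \<O>" "a = z * y" and w: "w \<in> \<O>" "of_int (q * q') = z * w"
      using z_a z_qq by (auto simp: dvdO_def)
    have "of_int (q * q') * a = qconj (of_int (q * q')) * a" by (simp only: conj_of_int)
    also have "\<dots> = (z * qconj z) * (qconj w * y)"
      unfolding w(2) using y zO w(1) by (simp add: conj_mult)
    also have "\<dots> = of_int (q * q' * g) * (qconj w * y)" using zO g by (simp add: mult_conj)
    finally have "qtrace (of_int (q * q') * a) = qtrace (of_int (q * q' * g) * (qconj w * y))"
      by (rule arg_cong)
    then have "(q * q') * qtrace a = (q * q') * (g * qtrace (qconj w * y))"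
      using qtrace_of_int_mult[OF aO, of "q * q'"] qtrace_of_int_mult[OF O_mult[OF conj_in_O[of w] y(1)], of "q * q' * g"]
      by (simp only: mult.assoc)
    then show ?thesis using qq0 by simp
  qed
  have "\<bar>g\<bar> = 1"
  proof (rule ccontr)
    assume ne: "\<bar>g\<bar> \<noteq> 1"
    have "g \<noteq> 0" using gqq qq0 by auto
    then obtain r where r: "prime r" "r dvd g" using ne prime_divisor_exists[of g] by auto
    then have "r dvd q \<or> r dvd q'" using gqq by (meson dvd_trans prime_dvd_mult_iff)
    then have "r = q \<or> r = q'" using r q by (auto simp: primes_dvd_imp_eq)
    moreover have "r dvd k" "r dvd qtrace a" using dvd_trans[OF r(2)] gk gt by auto
    ultimately show False using npr[OF r(1)] by blast
  qed
  then have nz: "\<bar>qnorm z\<bar> = q * q'"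
    using g prime_gt_0_int[OF q(1)] prime_gt_0_int[OF q(2)] by (simp add: abs_mult)
  moreover have "q * q' \<noteq> 1" using q by (metis not_prime_unit dvd_triv_left)
  ultimately show ?thesis using max_irreducible_qnorm_eq[OF a z_a zO] by simp
qed

theorem max_irreducible_qnorm_cases:
  assumes card: "order (Pic KR \<O>) = 2" and a: "max_irreducible a"
  obtains (prime) q where "prime q" "is_norm q" "\<bar>qnorm a\<bar> = q"
  | (two) q q'
    where "prime q" "prime q'" "\<not> is_norm q" "\<not> is_norm q'" "\<bar>qnorm a\<bar> = q * q'"
proof (cases "\<exists>q. prime q \<and> q dvd qnorm a \<and> is_norm q")
  case True
  then show ?thesis using max_irreducible_qnorm_is_norm[OF a] prime by blast
next
  case False
  note aD = max_irreducibleD[OF a]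
  obtain q where q: "prime q" "q dvd qnorm a" using aD prime_divisor_exists[of "qnorm a"] by auto
  then obtain k where k: "qnorm a = q * k" by auto
  have "k \<noteq> 0" using k aD by auto
  have "\<bar>k\<bar> \<noteq> 1"
  proof
    assume "\<bar>k\<bar> = 1"
    then have "\<bar>qnorm a\<bar> = q" using k prime_gt_0_int[OF q(1)] by (simp add: abs_mult)
    then show False using False q aD by (auto simp: is_norm_def)
  qed
  then obtain q' where q': "prime q'" "q' dvd k"
    using \<open>k \<noteq> 0\<close> prime_divisor_exists[of k] by auto
  \<comment> \<open>An irreducible element divisible by a rational prime is associated to it; this
    produces the case of two equal primes.\<close>
  have dv: "\<bar>qnorm a\<bar> = r * r" if "prime r" "dvdO (of_int r) a" for r
    using max_irreducible_qnorm_eq[OF a that(2)] prime_gt_1_int[OF that(1)]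
    by (auto simp: zmult_eq_1_iff)
  have nn: "\<not> is_norm q" "\<not> is_norm q'" using False q q' k by auto
  show ?thesis
  proof (cases "dvdO (of_int q) a \<or> dvdO (of_int q') a")
    case True
    then show ?thesis using dv q q' nn two by blast
  next
    case False
    then show ?thesis
      using max_irreducible_qnorm_two_primes[OF card a q(1) q'(1)] k q' nn two[OF q(1) q'(1)] by auto
  qed
qed

section \<open>Elements whose norms have prescribed prime divisors\<close>

lemma dvd_qnorm_add_mult_iff:
  assumes "x \<in> \<O>" "y \<in> \<O>" "p dvd m"
  shows "p dvd qnorm (x + of_int m * y) \<longleftrightarrow> p dvd qnorm x"
proof -
  have "qnorm (x + of_int m * y) = qnorm x + m * (m * qnorm y + qtrace (x * qconj y))"
    using assms qtrace_of_int_mult[of "x * qconj y" m]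
    by (simp add: qnorm_add conj_mult distrib_left mult_ac qnorm_mult)
  then show ?thesis using assms(3) by (simp add: dvd_add_left_iff)
qed

lemma qnorm_of_int_add_sqrt: "qnorm (of_int m + sqrt (of_int d)) = m * m - d"
proof (cases "d mod 4 = 1")
  case True
  then have "4 dvd (1 - d)" by presburger
  then have omega_norm: "4 * omega_norm = 1 - d" using True by (simp add: omega_norm_def)
  have "of_int m + sqrt (of_int d) = qint (m - 1) 2"
    using True by (simp add: qint_def quadratic_omega_def add_divide_distrib)
  then have "qnorm (of_int m + sqrt (of_int d)) = (m - 1) * (m - 1) + (m - 1) * 2 + 4 * omega_norm"
    using True by (simp add: qnorm_qint omega_trace_def)
  then show ?thesis unfolding omega_norm by (simp add: algebra_simps)
next
  case False
  then have "of_int m + sqrt (of_int d) = qint m 1" by (simp add: qint_def quadratic_omega_def)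
  then show ?thesis using False by (simp add: qnorm_qint omega_trace_def omega_norm_def)
qed

text \<open>The element is \<open>m + sqrt d\<close> with norm \<open>m * m - d\<close>. For
  \<open>p\<close> dividing \<open>d\<close>, squarefreeness of \<open>d\<close> makes
  \<open>p\<close> divide this norm exactly once if \<open>p\<close> divides \<open>m\<close>; for
  \<open>p = 2\<close> and odd \<open>d\<close>, which is then 3 modulo 4, \<open>m = 1\<close>
  works.\<close>

lemma exists_qnorm_ramified:
  assumes p: "prime p" "p dvd disc"
  obtains u where "u \<in> \<O>" "p dvd qnorm u" "\<not> p * p dvd qnorm u"
    "\<And>q. prime q \<Longrightarrow> q dvd disc \<Longrightarrow> q dvd qnorm u \<Longrightarrow> q = p"
proof -
  have disc: "q dvd d \<or> (q = 2 \<and> d mod 4 \<noteq> 1)" if "prime q" "q dvd disc" for q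
  proof (cases "d mod 4 = 1")
    case False
    then have "q dvd 2 * 2 * d" using that by (simp add: quadratic_discriminant_def)
    then have "q dvd 2 \<or> q dvd d" using that by (simp only: prime_dvd_mult_iff) blast
    then show ?thesis using primes_dvd_imp_eq[OF that(1), of 2] False by auto
  qed (use that in \<open>auto simp: quadratic_discriminant_def\<close>)
  have sq: "\<not> r * r dvd d" if "prime r" for r
    using squarefreeD[OF squarefree_d, of r] that by (auto simp: power2_eq_square)
  have O: "of_int m + sqrt (of_int d) \<in> \<O>" for m using sqrt_in_O by auto
  show ?thesis
  proof (cases "p dvd d")
    case True
    \<comment> \<open>Evenness of \<open>m\<close> for odd \<open>d\<close> keeps the norm odd,
      since 2 may be ramified without dividing \<open>d\<close>. Hence \<open>2 * p\<close> for odd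
      \<open>d\<close> and \<open>p\<close> for even \<open>d\<close>.\<close>
    obtain m where m: "p dvd m" "odd d \<Longrightarrow> even m"
      "\<And>q. prime q \<Longrightarrow> q dvd d \<Longrightarrow> q dvd m \<Longrightarrow> q = p"
    proof (cases "even d")
      case True
      then show ?thesis using that[of p] primes_dvd_imp_eq[OF _ p(1)] by auto
    next
      case False
      show ?thesis
      proof (rule that[of "2 * p"])
        fix q assume q: "prime q" "q dvd d" "q dvd 2 * p"
        then have "\<not> q dvd 2" using False primes_dvd_imp_eq[OF q(1), of 2] by auto
        then have "q dvd p" using q prime_dvd_mult_iff by blast
        then show "q = p" using q p primes_dvd_imp_eq by blast
      qed auto
    qed
    show ?thesis
    proof (rule that[OF O[of m]], unfold qnorm_of_int_add_sqrt)
      show "p dvd m * m - d" using m True by simp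
      show "\<not> p * p dvd m * m - d"
        using m(1) sq[OF p(1)]
        by (metis dvd_diff_right_iff mult_dvd_mono diff_diff_eq2 add_diff_cancel_left' dvd_diff)
      fix q assume q: "prime q" "q dvd disc" "q dvd m * m - d"
      show "q = p"
      proof (cases "q dvd d")
        case True
        then have "q dvd m * m" using q(3) by (metis diff_add_cancel dvd_add)
        then show ?thesis using m(3) q True prime_dvd_mult_iff by blast
      next
        case False
        then have "q = 2" "odd d" using disc[OF q(1,2)] by auto
        then show ?thesis using m(2) q(3) by auto
      qed
    qed
  next
    case False
    then have 2: "p = 2" "d mod 4 \<noteq> 1" "odd d" using disc[OF p] by auto
    then have d4: "d mod 4 = 3" by presburger
    show ?thesis
    proof (rule that[OF O[of 1]], unfold qnorm_of_int_add_sqrt 2(1))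
      show "2 dvd 1 * 1 - d" using 2 by simp
      show "\<not> 2 * 2 dvd 1 * 1 - d" using d4 by simp presburger
      fix q assume q: "prime q" "q dvd disc" "q dvd 1 * 1 - d"
      show "q = 2"
      proof (rule ccontr)
        assume "q \<noteq> 2"
        then have "q dvd d" using disc q by blast
        then have "q dvd 1" using q(3) by (metis diff_add_cancel dvd_add mult_1)
        then show False using q(1) by auto
      qed
    qed
  qed
qed

text \<open>Among the divisors of \<open>u\<close> whose norm is divisible by \<open>p\<close>, one
  of least absolute norm is irreducible: in a factorization \<open>p\<close> divides the norm of one
  factor, and by minimality the other factor is a unit.\<close>

lemma max_irreducible_divisor:
  assumes "u \<in> \<O>" "u \<noteq> 0" "prime p" "p dvd qnorm u"
  obtains v where "max_irreducible v" "dvdO v u" "p dvd qnorm v"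
proof -
  define P where "P v \<longleftrightarrow> v \<in> \<O> \<and> dvdO v u \<and> p dvd qnorm v" for v
  have "P u" using assms by (auto simp: P_def dvdO_def intro: bexI[of _ 1])
  then obtain v where v: "P v" "\<And>w. P w \<Longrightarrow> nat \<bar>qnorm v\<bar> \<le> nat \<bar>qnorm w\<bar>"
    using ex_has_least_nat[of P u "\<lambda>w. nat \<bar>qnorm w\<bar>"] by blast
  have v': "v \<in> \<O>" "dvdO v u" "p dvd qnorm v" using v by (auto simp: P_def)
  have v0: "v \<noteq> 0" using v' assms by (auto simp: dvdO_def)
  have "p \<noteq> 1" "\<not> p dvd 1" using assms by auto
  have key: "\<bar>qnorm z\<bar> = 1" if yz: "y \<in> \<O>" "z \<in> \<O>" "v = y * z"
    "p dvd qnorm y" for y z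
  proof -
    have "dvdO y u" using v'(2) yz by (auto simp: dvdO_def mult.assoc)
    then have "nat \<bar>qnorm v\<bar> \<le> nat \<bar>qnorm y\<bar>"
      using v(2)[of y] yz by (simp add: P_def)
    then have "\<bar>qnorm y\<bar> * \<bar>qnorm z\<bar> \<le> \<bar>qnorm y\<bar> * 1"
      using yz by (simp add: qnorm_mult abs_mult)
    moreover have "\<bar>qnorm y\<bar> > 0" "\<bar>qnorm z\<bar> > 0" using v0 yz by auto
    ultimately show ?thesis
      using mult_le_cancel_left_pos[of "\<bar>qnorm y\<bar>" "\<bar>qnorm z\<bar>" 1] by linarith
  qed
  have "max_irreducible v" unfolding max_irreducible_def
  proof (intro conjI ballI impI)
    show "\<bar>qnorm v\<bar> \<noteq> 1"
      using v'(3) \<open>\<not> p dvd 1\<close> by (metis dvd_abs_iff)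
    fix y z assume yz: "y \<in> \<O>" "z \<in> \<O>" "v = y * z"
    then have "p dvd qnorm y \<or> p dvd qnorm z"
      using v'(3) assms(3) by (simp add: qnorm_mult prime_dvd_mult_iff)
    then show "\<bar>qnorm y\<bar> = 1 \<or> \<bar>qnorm z\<bar> = 1"
      using key[of y z] key[of z y] yz by (auto simp: mult.commute)
  qed (use v' v0 in auto)
  then show ?thesis using that v' by blast
qed

text \<open>For a single nonsplit \<open>p\<close>, not all products can have norm divisible by
  \<open>p\<close>: this property passes to sums, and 1 is a sum of products. Finitely many primes
  are handled by a Chinese remainder argument. The result makes it possible to scale an ideal class
  so that it becomes coprime to \<open>f\<close>.\<close>

lemma exists_prod_qnorm_not_dvd:
  assumes I: "fractional_ideal KR \<O> I" "fractional_ideal KR \<O> J" "ideal_prod KR I J = \<O>"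
    and S: "finite S" "\<And>p. p \<in> S \<Longrightarrow> prime p \<and> \<not> split_prime d p"
  shows "\<exists>b\<in>I. \<exists>b'\<in>J. \<forall>p\<in>S. \<not> p dvd qnorm (b * b')"
  using S
proof (induction S rule: finite_induct)
  case empty
  then show ?case using maximal.fractional_idealD(2) I by blast
next
  case (insert p S)
  have IJ: "i * j \<in> \<O>" if "i \<in> I" "j \<in> J" for i j
    using maximal.iprod_mult[OF that] I by simp
  note ID = maximal.fractional_idealD[OF I(1)] and JD = maximal.fractional_idealD[OF I(2)]
  obtain b b' where b: "b \<in> I" "b' \<in> J" "\<forall>p\<in>S. \<not> p dvd qnorm (b * b')"
    using insert by auto
  have p: "prime p" "\<not> split_prime d p" using insert.prems by auto
  have "\<exists>c\<in>I. \<exists>c'\<in>J. \<not> p dvd qnorm (c * c')"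
  proof (rule ccontr)
    assume *: "\<not> ?thesis"
    have "x \<in> \<O> \<and> p dvd qnorm x" if "x \<in> ideal_prod KR I J" for x
      using that by (induction rule: maximal.iprod_induct) (use * IJ p nonsplit_dvd_qnorm_add in auto)
    from this[of 1] show False using I p by auto
  qed
  then obtain c c' where c: "c \<in> I" "c' \<in> J" "\<not> p dvd qnorm (c * c')" by blast
  define F where "F = \<Prod>S"
  have pF: "\<not> p dvd F"
  proof
    assume "p dvd F"
    then obtain r where "r \<in> S" "p dvd r" using p insert.hyps unfolding F_def
      by (auto simp: prime_dvd_prod_iff)
    moreover have "p = r" using calculation p(1) insert.prems primes_dvd_imp_eq by blast
    ultimately show False using insert.hyps by blast
  qed
  \<comment> \<open>Modulo \<open>p\<close> only the part with \<open>c\<close> survives, modulo the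
    primes in \<open>S\<close> only the part with \<open>b\<close>.\<close>
  define e where "e = of_int p * b + of_int F * c"
  define e' where "e' = of_int p * b' + of_int F * c'"
  have "e \<in> I" unfolding e_def using ID(3,4) b c by simp
  moreover have "e' \<in> J" unfolding e'_def using JD(3,4) b c by simp
  moreover have "\<not> r dvd qnorm (e * e')" if "r \<in> insert p S" for r
  proof (cases "r = p")
    case True
    have "e * e' = of_int (F * F) * (c * c') + of_int p * (of_int p * (b * b') + of_int F * (b * c') + of_int F * (c * b'))"
      by (simp add: e_def e'_def algebra_simps)
    then have "r dvd qnorm (e * e') \<longleftrightarrow> p dvd qnorm (of_int (F * F) * (c * c'))"
      using True b c IJ dvd_qnorm_add_mult_iff[of "of_int (F * F) * (c * c')" _ p p] by auto
    also have "\<dots> \<longleftrightarrow> p dvd (F * F) * (F * F) * qnorm (c * c')"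
      using qnorm_of_int_mult[OF IJ[OF c(1,2)], of "F * F"] by simp
    finally show ?thesis using pF c(3) p by (simp add: prime_dvd_mult_iff)
  next
    case False
    then have r: "r \<in> S" "prime r" using that insert.prems by auto
    then have rF: "r dvd F"
      using dvd_prodI[OF insert.hyps(1) r(1), of "\<lambda>x. x"] by (simp add: F_def)
    have rp: "\<not> r dvd p" using r(2) p(1) False by (auto dest: primes_dvd_imp_eq)
    have "e * e' = of_int (p * p) * (b * b') + of_int F * (of_int F * (c * c') + of_int p * (b * c') + of_int p * (c * b'))"
      by (simp add: e_def e'_def algebra_simps)
    then have "r dvd qnorm (e * e') \<longleftrightarrow> r dvd qnorm (of_int (p * p) * (b * b'))"
      using b c IJ dvd_qnorm_add_mult_iff[of "of_int (p * p) * (b * b')" _ r F] rF by auto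
    also have "\<dots> \<longleftrightarrow> r dvd (p * p) * (p * p) * qnorm (b * b')"
      using qnorm_of_int_mult[OF IJ[OF b(1,2)], of "p * p"] by simp
    finally show ?thesis using rp b(3) r by (simp add: prime_dvd_mult_iff)
  qed
  ultimately show ?case by blast
qed

end

section \<open>Units of the maximal order and the conductor\<close>

context real_quadratic_order
begin

lemma mem_R_if_prime_dvd:
  assumes "squarefree f" "x \<in> \<O>" "\<And>p. prime p \<Longrightarrow> p dvd f \<Longrightarrow> p dvd omega_coord x"
  shows "x \<in> R"
  using assms squarefree_dvdI[of f "omega_coord x"] f_pos by (simp add: R_iff)

text \<open>If \<open>A\<close> is an ideal of \<open>\<O>\<close> that contains an integer \<open>n\<close> coprime to \<open>f\<close>, then \<open>lift n A\<close> is an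
  ideal of \<open>R\<close> whose extension to \<open>\<O>\<close> is \<open>A\<close>.\<close>

definition lift :: "int \<Rightarrow> real set \<Rightarrow> real set" where
  "lift n A = {of_int n * r + of_int f * y | r y. r \<in> R \<and> y \<in> A}"

lemma liftI: "r \<in> R \<Longrightarrow> y \<in> A \<Longrightarrow> of_int n * r + of_int f * y \<in> lift n A"
  by (auto simp: lift_def)

lemma is_ideal_lift:
  assumes A: "A \<subseteq> \<O>" "0 \<in> A" "\<And>x y. x \<in> A \<Longrightarrow> y \<in> A \<Longrightarrow> x + y \<in> A"
    "\<And>r x. r \<in> \<O> \<Longrightarrow> x \<in> A \<Longrightarrow> r * x \<in> A"
  shows "is_ideal (lift n A)"
  unfolding is_ideal_def
proof (intro conjI ballI)
  show "lift n A \<subseteq> R" using A(1) by (auto simp: lift_def)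
  show "0 \<in> lift n A" using liftI[of 0 0 A n] A(2) by simp
  fix u v assume "u \<in> lift n A" "v \<in> lift n A"
  then obtain r y r' y' where "r \<in> R" "y \<in> A" "u = of_int n * r + of_int f * y"
      "r' \<in> R" "y' \<in> A" "v = of_int n * r' + of_int f * y'"
    by (auto simp: lift_def)
  then show "u + v \<in> lift n A"
    using liftI[of "r + r'" "y + y'" A n] A(3) by (simp add: algebra_simps)
next
  fix t u assume t: "t \<in> R" and "u \<in> lift n A"
  then obtain r y
    where "r \<in> R" "y \<in> A" "u = of_int n * r + of_int f * y" by (auto simp: lift_def)
  then show "t * u \<in> lift n A"
    using liftI[of "t * r" "t * y" A n] t A(4) R_in_O by (simp add: algebra_simps)
qed

text \<open>The inverse up to the factor \<open>n\<close> is the lift of \<open>g\<close> times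
  \<open>J\<close>, where \<open>b' * g = n\<close>. The product of the lifts contains
  \<open>n * n\<close> and \<open>f * f * n\<close>, hence \<open>n\<close>, because
  \<open>n\<close> is coprime to \<open>f\<close>.\<close>

lemma invertible_lift:
  assumes I: "fractional_ideal KR \<O> I" "fractional_ideal KR \<O> J" "iprod I J = \<O>"
    and b: "b \<in> I" "b' \<in> J" "n = qnorm (b * b')" "n \<noteq> 0" "coprime n f"
  shows "invertible (lift n ((*) b' ` I))"
proof -
  note ID = maximal.fractional_idealD[OF I(1)] and JD = maximal.fractional_idealD[OF I(2)]
  have IJ: "i * j \<in> \<O>" if "i \<in> I" "j \<in> J" for i j using iprod_mult[OF that] I by simp
  have b0: "b' \<noteq> 0" using b by auto
  define g where "g = b * qconj (b * b')"
  have ng: "of_int n = b' * g"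
    using mult_conj[OF IJ[OF b(1,2)]] by (simp add: b(3) g_def mult_ac)
  let ?A = "(*) b' ` I" and ?B = "(*) g ` J"
  have A: "is_ideal (lift n ?A)"
  proof (rule is_ideal_lift)
    show "?A \<subseteq> \<O>" using IJ[OF _ b(2)] by (auto simp: mult.commute)
  qed (use ID in \<open>auto simp: mult.left_commute simp flip: distrib_left\<close>)
  have B: "is_ideal (lift n ?B)"
  proof (rule is_ideal_lift)
    show "?B \<subseteq> \<O>"
    proof
      fix x assume "x \<in> ?B"
      then obtain j where j: "j \<in> J" "x = g * j" by auto
      then have "x = (b * j) * qconj (b * b')" by (simp add: g_def)
      then show "x \<in> \<O>" using IJ[OF b(1) j(1)] by simp
    qed
  qed (use JD in \<open>auto simp: mult.left_commute simp flip: distrib_left\<close>)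
  have fn: "of_int (f * f * n) * s \<in> iprod (lift n ?A) (lift n ?B)" if "s \<in> iprod I J" for s
    using that
  proof (induction rule: iprod_induct)
    case (prod i j)
    have "of_int (f * f * n) * (i * j) = (of_int n * 0 + of_int f * (b' * i)) * (of_int n * 0 + of_int f * (g * j))"
      by (simp add: ng)
    also have "\<dots> \<in> iprod (lift n ?A) (lift n ?B)" using prod by (intro iprod_mult liftI) auto
    finally show ?case .
  next
    case (sum x y)
    then show ?case by (simp add: distrib_left iprod_add)
  qed
  have "coprime n (f * f)" using b by simp
  then obtain u v where uv: "u * n + v * (f * f) = 1" by (metis bezout_int coprime_iff_gcd_eq_1)
  have "real_of_int n = of_int (n * (u * n + v * (f * f)))" by (simp add: uv)
  also have "\<dots> = (of_int n * of_int u + of_int f * 0) * (of_int n * 1 + of_int f * 0) + of_int (f * f * n) * of_int v"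
    by (simp add: algebra_simps)
  also have "\<dots> \<in> iprod (lift n ?A) (lift n ?B)"
    using imageI[OF ID(2), of "(*) b'"] imageI[OF JD(2), of "(*) g"]
    by (intro iprod_add iprod_mult liftI fn R_of_int R_1) (simp_all add: I(3))
  finally have n: "of_int n \<in> iprod (lift n ?A) (lift n ?B)" .
  have "\<exists>r\<in>R. x * y = of_int n * r" if x: "x \<in> lift n ?A"
      and y: "y \<in> lift n ?B" for x y
  proof -
    obtain r i where r: "r \<in> R" "i \<in> I" "x = of_int n * r + of_int f * (b' * i)"
      using x by (auto simp: lift_def)
    obtain s j where s: "s \<in> R" "j \<in> J" "y = of_int n * s + of_int f * (g * j)"
      using y by (auto simp: lift_def)
    have bi: "b' * i \<in> \<O>" "g * j \<in> \<O>" 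
      using IJ[OF r(2) b(2)] IJ[OF b(1) s(2)] O_mult[OF IJ[OF b(1) s(2)] conj_in_O[of "b * b'"]] 
      by (simp_all add: g_def mult_ac)
    have "x * y = of_int n * (of_int n * (r * s)) + of_int n * (r * (of_int f * (g * j))) +
        of_int n * ((of_int f * (b' * i)) * s) + (b' * g) * (of_int f * (of_int f * (i * j)))"
      by (simp add: r s algebra_simps)
    also have "\<dots> = of_int n * (of_int n * (r * s) + r * (of_int f * (g * j)) +
        (of_int f * (b' * i)) * s + of_int f * (of_int f * (i * j)))"
      by (simp add: ng[symmetric] algebra_simps)
    finally show ?thesis using r s bi IJ by blast
  qed
  then show ?thesis unfolding invertible_def using A B n b(4)
    by (intro conjI exI[of _ "lift n ?B"] exI[of _ "of_int n"] ballI) auto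
qed

text \<open>The last two groups of assumptions say that \<open>G\<close> extends to the ideal of
  \<open>\<O>\<close> generated by \<open>\<alpha>\<close>. The lift extends to \<open>b'\<close>
  times \<open>I\<close>, so \<open>c * b'\<close> times \<open>I\<close> is generated by
  \<open>\<alpha>\<close>.\<close>

lemma principal_if_lift_equivalent:
  assumes I: "fractional_ideal KR \<O> I" "b \<in> I" "b' \<noteq> 0" "b' \<in> K"
    "\<And>i. i \<in> I \<Longrightarrow> b' * i \<in> \<O>"
    and n: "n = qnorm (b' * b)" "coprime n f"
    and c: "c \<in> K" "c \<noteq> 0"
    and G: "G = (*) c ` lift n ((*) b' ` I)" 
    and \<alpha>: "\<alpha> \<in> \<O>" "\<alpha> \<noteq> 0"
      "\<And>g. g \<in> G \<Longrightarrow> dvdO \<alpha> g"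
    and g: "g1 \<in> G" "g2 \<in> G" "w1 \<in> \<O>" "w2 \<in> \<O>" "\<alpha> = g1 * w1 + g2 * w2"
  shows "maximal.principal I"
proof -
  note ID = maximal.fractional_idealD[OF I(1)]
  define x where "x = \<alpha> / (c * b')"
  have "x \<in> K" "x \<noteq> 0" using \<alpha> c I O_subset_K by (auto simp: x_def)
  moreover have "I = (*) x ` \<O>"
  proof (intro equalityI subsetI)
    fix i assume i: "i \<in> I"
    obtain u v where uv: "u * n + v * f = 1" using n(2) by (metis bezout_int coprime_iff_gcd_eq_1)
    have "of_int n * 1 + of_int f * 0 \<in> lift n ((*) b' ` I)"
      using imageI[OF ID(2), of "(*) b'"] by (intro liftI) auto
    then have 1: "dvdO \<alpha> (c * of_int n)" using \<alpha>(3) G by auto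
    have "of_int n * 0 + of_int f * (b' * i) \<in> lift n ((*) b' ` I)" using i by (intro liftI) auto
    then have 2: "dvdO \<alpha> (c * (of_int f * (b' * i)))" using \<alpha>(3) G by auto
    have "dvdO \<alpha> ((of_int u * (b' * i)) * (c * of_int n) + of_int v * (c * (of_int f * (b' * i))))"
      using I(5)[OF i] by (intro dvdO_add dvdO_mult 1 2) auto
    also have "(of_int u * (b' * i)) * (c * of_int n) + of_int v * (c * (of_int f * (b' * i))) = of_int (u * n + v * f) * (c * b' * i)"
      by (simp add: algebra_simps)
    finally have "dvdO \<alpha> (c * b' * i)" by (simp add: uv)
    then obtain w where w: "w \<in> \<O>" "c * b' * i = \<alpha> * w" by (auto simp: dvdO_def)
    then have "i = x * w" using c I(3) by (simp add: x_def field_simps)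
    then show "i \<in> (*) x ` \<O>" using w by blast
  next
    fix y assume "y \<in> (*) x ` \<O>"
    then obtain w where w: "w \<in> \<O>" "y = x * w" by auto
    have L: "\<exists>i\<in>I. h = c * b' * i" if h: "h \<in> G" for h
    proof -
      obtain r i where r: "r \<in> R" "i \<in> I" "h = c * (of_int n * r + of_int f * (b' * i))"
        using h G by (auto simp: lift_def)
      have "of_int n = (b' * b) * qconj (b' * b)" using mult_conj[of "b' * b"] I n by simp
      then have "h = c * b' * ((qconj (b' * b) * r) * b + of_int f * i)" by (simp add: r algebra_simps)
      moreover have "(qconj (b' * b) * r) * b + of_int f * i \<in> I" using ID(3,4) r I R_in_O by auto
      ultimately show ?thesis by blast
    qed
    obtain i1 i2 where i: "i1 \<in> I" "g1 = c * b' * i1" "i2 \<in> I" "g2 = c * b' * i2"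
      using L g by meson
    have "y = w * (w1 * i1 + w2 * i2)"
      using c I(3) by (simp add: w x_def g(5) i field_simps)
    also have "\<dots> \<in> I" by (intro ID(3,4) w i g)
    finally show "y \<in> I" .
  qed
  ultimately show ?thesis by (auto simp: maximal.principal_def)
qed

end

locale unusual_order = real_quadratic_order +
  assumes squarefree_f: "squarefree f"
    and nonsplit: "\<And>p. prime p \<Longrightarrow> p dvd f \<Longrightarrow> \<not> split_prime d p"
    and card_Pic: "order (Pic KR R) = 2" and card_Pic_O: "order (Pic KR \<O>) = 2"
begin

text \<open>The ideal \<open>B\<close> of \<open>R\<close> below extends to a nonprincipal ideal of \<open>\<O>\<close>, whereas \<open>G\<close> extends to the
  principal ideal generated by \<open>\<alpha>\<close>. So \<open>G\<close> is not in the class of \<open>B\<close>, which is the only nontrivial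
  class, and a generator of \<open>G\<close> differs from \<open>\<alpha>\<close> by a unit of \<open>\<O>\<close>.\<close>

lemma unit_adjust:
  assumes \<alpha>: "\<alpha> \<in> \<O>" "coprime (qnorm \<alpha>) f"
  obtains \<epsilon>
    where "\<epsilon> \<in> \<O>" "\<bar>qnorm \<epsilon>\<bar> = 1" "\<alpha> * \<epsilon> \<in> R"
proof (cases "f = 1")
  case True
  then show ?thesis using that[of 1] \<alpha> by simp
next
  case False
  obtain p where p: "prime p" "p dvd f" using False f_pos prime_divisor_exists[of f] by auto
  have \<alpha>0: "\<alpha> \<noteq> 0" using \<alpha> False f_pos by auto
  obtain I J where I: "fractional_ideal KR \<O> I" "fractional_ideal KR \<O> J" "iprod I J = \<O>"
    "\<not> maximal.principal I"
    using maximal.exists_nonprincipal[OF card_Pic_O] by blast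
  have IJ: "i * j \<in> \<O>" if "i \<in> I" "j \<in> J" for i j using iprod_mult[OF that] I by simp
  have "\<exists>b\<in>I. \<exists>b'\<in>J. \<forall>p\<in>prime_factors f. \<not> p dvd qnorm (b * b')"
    using nonsplit by (intro exists_prod_qnorm_not_dvd[OF I(1-3)]) auto
  then obtain b b' where b: "b \<in> I" "b' \<in> J"
    "\<And>p. prime p \<Longrightarrow> p dvd f \<Longrightarrow> \<not> p dvd qnorm (b * b')"
    using f_pos by (auto simp: in_prime_factors_iff)
  define n where "n = qnorm (b * b')"
  have n: "coprime n f" "n \<noteq> 0"
    using b p f_pos coprime_int_if_no_prime[of f n] by (auto simp: n_def)
  have b0: "b' \<noteq> 0" "b' \<in> K" "n = qnorm (b' * b)"
    using n b maximal.fractional_idealD(1)[OF I(2)] by (auto simp: n_def mult.commute)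
  have bi: "b' * i \<in> \<O>" if "i \<in> I" for i using IJ[OF that b(2)] by (simp add: mult.commute)
  define B where "B = lift n ((*) b' ` I)"
  have B: "invertible B" unfolding B_def using invertible_lift[OF I(1-3) b(1,2) n_def n(2,1)] .
  note PL = principal_if_lift_equivalent[OF I(1) b(1) b0(1,2) bi b0(3) n(1), folded B_def]
  have Bnp: "\<not> principal B"
  proof
    assume "principal B"
    then obtain x where x: "x \<in> K" "x \<noteq> 0" "B = (*) x ` R" by (auto simp: principal_def)
    then have "R = (*) (inverse x) ` B" by (simp add: image_image flip: mult.assoc)
    \<comment> \<open>Here \<open>R\<close> itself takes the place of \<open>G\<close>; it extends
      to \<open>\<O>\<close>, which is generated by 1.\<close>
    then have "maximal.principal I"
      using x by (intro PL[of "inverse x" R 1 1 1 1 0]) (auto intro: dvdOI R_in_O)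
    then show False using I by blast
  qed
  define m where "m = qnorm \<alpha>"
  have m: "m \<noteq> 0" "coprime m f" using \<alpha> \<alpha>0 by (auto simp: m_def)
  obtain u v where uv: "u * m + v * f = 1" using m(2) by (metis bezout_int coprime_iff_gcd_eq_1)
  \<comment> \<open>Over \<open>\<O>\<close> both generators are multiples of
    \<open>\<alpha>\<close>, with cofactors \<open>qconj \<alpha>\<close> and \<open>f\<close>.
    These generate the unit ideal, as \<open>qnorm \<alpha>\<close> is coprime to \<open>f\<close>.
    The factor \<open>f\<close> puts the second generator into \<open>R\<close>.\<close>
  define G where "G = gen2 (of_int m) (of_int f * \<alpha>)"
  have "coprime (gcd m (qtrace (of_int f * \<alpha>))) (f * f)"
    using m(2) by (meson coprime_mult_right_iff coprime_divisors dvd_refl gcd_dvd1)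
  then have "gcd (gcd m (qtrace (of_int f * \<alpha>))) (f * f) = 1"
    by (simp only: coprime_iff_gcd_eq_1)
  moreover have "qnorm (of_int f * \<alpha>) = m * (f * f)" using \<alpha> by (simp add: m_def)
  ultimately have G: "invertible G"
    unfolding G_def using m R_f_mult[OF \<alpha>(1)] by (intro invertible_gen2)
  have mm: "of_int m = \<alpha> * qconj \<alpha>" using \<alpha> by (simp add: mult_conj m_def)
  have dG: "dvdO \<alpha> g" if g: "g \<in> G" for g
  proof -
    obtain r s
      where "r \<in> R" "s \<in> R" "g = of_int m * r + of_int f * \<alpha> * s"
        using g by (auto simp: G_def gen2_def)
    then show ?thesis
      using R_in_O \<alpha>
      by (intro dvdOI[of "qconj \<alpha> * r + of_int f * s"]) (auto simp: mm algebra_simps)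
  qed
  have Ggen: "of_int m \<in> G" "of_int f * \<alpha> \<in> G"
    unfolding G_def by (rule gen2_left gen2_right)+
  have "of_int m * (of_int u * \<alpha>) + (of_int f * \<alpha>) * of_int v = of_int (u * m + v * f) * \<alpha>"
    by (simp add: algebra_simps)
  then have \<alpha>eq: "\<alpha> = of_int m * (of_int u * \<alpha>) + (of_int f * \<alpha>) * of_int v" by (simp add: uv)
  have "principal G"
  proof (rule ccontr)
    assume "\<not> principal G"
    then obtain c where c: "c \<in> K" "c \<noteq> 0" "G = (*) c ` B"
      using nonprincipal_equivalent[OF card_Pic G _ B Bnp] by blast
    have "maximal.principal I"
      using \<alpha> by (intro PL[OF _ c \<alpha>(1) \<alpha>0 dG Ggen _ _ \<alpha>eq]) auto
    then show False using I by blast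
  qed
  then obtain \<gamma> where \<gamma>: "G = (*) \<gamma> ` R" by (auto simp: principal_def)
  have \<gamma>G: "\<gamma> \<in> G" unfolding \<gamma> using imageI[OF R_1, of "(*) \<gamma>"] by simp
  then obtain \<epsilon> where \<epsilon>: "\<epsilon> \<in> \<O>" "\<gamma> = \<alpha> * \<epsilon>"
    using dG by (auto simp: dvdO_def)
  obtain r1 r2 where r: "r1 \<in> R" "of_int m = \<gamma> * r1" "r2 \<in> R"
    "of_int f * \<alpha> = \<gamma> * r2" using Ggen unfolding \<gamma> by blast
  have "\<alpha> * 1 = \<alpha> * (\<epsilon> * (r1 * (of_int u * \<alpha>) + r2 * of_int v))"
    using \<alpha>eq unfolding r by (simp add: \<epsilon> algebra_simps)
  then have "\<epsilon> * (r1 * (of_int u * \<alpha>) + r2 * of_int v) = 1" using \<alpha>0 by simp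
  moreover have "r1 * (of_int u * \<alpha>) + r2 * of_int v \<in> \<O>" using r \<alpha> R_in_O by auto
  ultimately have "\<bar>qnorm \<epsilon>\<bar> = 1" using unit_iff \<epsilon> by blast
  moreover have "\<alpha> * \<epsilon> \<in> R"
    using \<gamma>G \<epsilon> G is_idealD(1) by (auto simp: invertible_def)
  ultimately show ?thesis using that \<epsilon> by blast
qed

text \<open>Up to units of \<open>\<O>\<close> these are the nonzero elements of \<open>R\<close>:
  see \<open>adjustable_R\<close> and \<open>adjustable_adjust\<close>.\<close>

definition adjustable :: "real \<Rightarrow> bool" where
  "adjustable z \<longleftrightarrow> z \<in> \<O> \<and> z \<noteq> 0 \<and> (\<forall>p. prime p \<and> p dvd f \<and> p dvd qnorm z \<longrightarrow> dvdO (of_int p) z)"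

lemma adjustable_D:
  assumes "adjustable z"
  shows "z \<in> \<O>" "z \<noteq> 0" "\<And>p. prime p \<Longrightarrow> p dvd f \<Longrightarrow> p dvd qnorm z \<Longrightarrow> dvdO (of_int p) z"
  using assms by (auto simp: adjustable_def)

lemma adjustable_conj: "adjustable z \<Longrightarrow> adjustable (qconj z)"
  unfolding adjustable_def by (metis conj_conj conj_in_O conj_0 qnorm_conj dvdO_conj_iff)

text \<open>Modulo \<open>p\<close> such an \<open>x\<close> is the integer
  \<open>rat_coord x\<close>, and its norm is the square of that integer.\<close>

lemma dvd_qnorm_if_dvd_omega_coord:
  assumes "x \<in> \<O>" "prime p" "p dvd omega_coord x" "p dvd qnorm x"
  shows "dvdO (of_int p) x"
proof -
  have "p dvd rat_coord x * rat_coord x"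
    using assms(3,4) unfolding qnorm_def
    by (metis dvd_add_left_iff dvd_mult dvd_mult2 mult.assoc)
  then have "p dvd rat_coord x" using assms(2) prime_dvd_mult_iff by blast
  then obtain a b where ab: "rat_coord x = p * a" "omega_coord x = p * b" using assms(3) by (elim dvdE)
  have "x = qint (rat_coord x) (omega_coord x)" using assms(1) in_O_iff_qint by blast
  also have "\<dots> = of_int p * qint a b" unfolding ab by (simp add: qint_def algebra_simps)
  finally show ?thesis by (intro dvdOI[of "qint a b"]) auto
qed

lemma adjustable_R: "z \<in> R \<Longrightarrow> z \<noteq> 0 \<Longrightarrow> adjustable z"
  unfolding adjustable_def using dvd_qnorm_if_dvd_omega_coord R_iff dvd_trans by blast

lemma dvd_omega_coord_mult: "x \<in> \<O> \<Longrightarrow> y \<in> \<O> \<Longrightarrow> p dvd omega_coord x \<Longrightarrow> p dvd omega_coord y \<Longrightarrow> p dvd omega_coord (x * y)"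
  by (simp add: omega_coord_mult)

lemma dvd_omega_coord_if_dvdO: "dvdO (of_int p) x \<Longrightarrow> p dvd omega_coord x"
  by (auto simp: dvdO_def)

lemma transfer:
  assumes b: "adjustable b" and c: "adjustable c" and bc: "b * c \<in> R"
  obtains \<epsilon> \<delta>
    where "\<epsilon> \<in> \<O>" "\<delta> \<in> \<O>" "\<epsilon> * \<delta> = 1"
      "b * \<epsilon> \<in> R" "c * \<delta> \<in> R"
proof -
  note bD = adjustable_D[OF b] and cD = adjustable_D[OF c]
  \<comment> \<open>This splits the primes of \<open>f\<close>: those of \<open>f1\<close> do not
    divide \<open>qnorm b\<close>, those of \<open>f2\<close> divide \<open>qnorm b\<close> but not
    \<open>qnorm c\<close>, those of \<open>f3\<close> divide both.\<close>
  define g where "g = gcd f (qnorm b)"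
  define f3 where "f3 = gcd g (qnorm c)"
  obtain f1 where f1: "f = g * f1" using gcd_dvd1[of f "qnorm b"] unfolding g_def by (elim dvdE)
  obtain f2 where f2: "g = f3 * f2" using gcd_dvd1[of g "qnorm c"] unfolding f3_def by (elim dvdE)
  have ff: "f = f1 * f2 * f3" using f1 f2 by simp
  have sq: False if "prime p" "p * p dvd f" for p
    using squarefreeD[OF squarefree_f, of p] that by (auto simp: power2_eq_square)
  have cases: "(p dvd f1 \<and> \<not> p dvd f2 \<and> \<not> p dvd f3 \<and> \<not> p dvd qnorm b) \<or>
      (p dvd f2 \<and> \<not> p dvd f1 \<and> \<not> p dvd f3 \<and> p dvd qnorm b \<and> \<not> p dvd qnorm c) \<or>
      (p dvd f3 \<and> \<not> p dvd f1 \<and> \<not> p dvd f2 \<and> p dvd qnorm b \<and> p dvd qnorm c)"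
    if p: "prime p" "p dvd f" for p
  proof -
    have n12: "\<not> (p dvd f1 \<and> p dvd f2)" using sq[OF p(1)] by (auto simp: ff mult_dvd_mono)
    have n13: "\<not> (p dvd f1 \<and> p dvd f3)"
      using sq[OF p(1)] by (auto simp: ff mult_dvd_mono mult.assoc mult.left_commute[of f1])
    have n23: "\<not> (p dvd f2 \<and> p dvd f3)"
      using sq[OF p(1)] by (auto simp: ff mult_dvd_mono mult.assoc)
    have g: "p dvd g \<longleftrightarrow> p dvd qnorm b" using p by (simp add: g_def)
    then have g': "p dvd qnorm b \<longleftrightarrow> p dvd f3 \<or> p dvd f2"
      using p(1) by (simp add: f2 prime_dvd_mult_iff)
    have f3: "p dvd f3 \<longleftrightarrow> p dvd qnorm b \<and> p dvd qnorm c"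
      using g by (simp add: f3_def)
    have "p dvd f1 \<or> p dvd f2 \<or> p dvd f3" using p by (simp add: ff prime_dvd_mult_iff)
    then show ?thesis using n12 n13 n23 g' f3 by blast
  qed
  \<comment> \<open>Up to integers prime to \<open>p\<close>, \<open>x\<close> is congruent modulo \<open>p\<close> to \<open>qconj b\<close>, \<open>c\<close> or \<open>1\<close>, according to
    which of \<open>f1\<close>, \<open>f2\<close>, \<open>f3\<close> the prime \<open>p\<close> divides.\<close>
  define x where "x = of_int (f2 * f3) * qconj b + of_int (f1 * f3) * c + of_int (f1 * f2)"
  have xO: "x \<in> \<O>" using cD by (simp add: x_def)
  have nx: "\<not> p dvd qnorm x" if p: "prime p" "p dvd f" for p
    using cases[OF p]
  proof (elim disjE conjE)
    assume 1: "p dvd f1" "\<not> p dvd f2" "\<not> p dvd f3" "\<not> p dvd qnorm b"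
    have "x = of_int (f2 * f3) * qconj b + of_int f1 * (of_int f3 * c + of_int f2)"
      by (simp add: x_def algebra_simps)
    then have "p dvd qnorm x \<longleftrightarrow> p dvd qnorm (of_int (f2 * f3) * qconj b)"
      using dvd_qnorm_add_mult_iff[of "of_int (f2 * f3) * qconj b"
      "of_int f3 * c + of_int f2" p f1] cD 1 by simp
    also have "\<dots> \<longleftrightarrow> p dvd (f2 * f3) * (f2 * f3) * qnorm b"
      using qnorm_of_int_mult[of "qconj b" "f2 * f3"] bD by simp
    finally show ?thesis using 1 p by (simp add: prime_dvd_mult_iff)
  next
    assume 2: "p dvd f2" "\<not> p dvd f1" "\<not> p dvd f3" "\<not> p dvd qnorm c"
    have "x = of_int (f1 * f3) * c + of_int f2 * (of_int f3 * qconj b + of_int f1)"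
      by (simp add: x_def algebra_simps)
    then have "p dvd qnorm x \<longleftrightarrow> p dvd qnorm (of_int (f1 * f3) * c)"
      using dvd_qnorm_add_mult_iff[of "of_int (f1 * f3) * c"
      "of_int f3 * qconj b + of_int f1" p f2] cD 2 by simp
    also have "\<dots> \<longleftrightarrow> p dvd (f1 * f3) * (f1 * f3) * qnorm c"
      using qnorm_of_int_mult[of c "f1 * f3"] cD by simp
    finally show ?thesis using 2 p by (simp add: prime_dvd_mult_iff)
  next
    assume 3: "p dvd f3" "\<not> p dvd f1" "\<not> p dvd f2"
    have "x = of_int (f1 * f2) + of_int f3 * (of_int f2 * qconj b + of_int f1 * c)"
      by (simp add: x_def algebra_simps)
    then have "p dvd qnorm x \<longleftrightarrow> p dvd qnorm (of_int (f1 * f2))"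
      using dvd_qnorm_add_mult_iff[of "of_int (f1 * f2)"
      "of_int f2 * qconj b + of_int f1 * c" p f3] cD 3 by simp
    also have "\<dots> \<longleftrightarrow> p dvd (f1 * f2) * (f1 * f2)" by (simp only: qnorm_of_int)
    finally show ?thesis using 3 p by (simp add: prime_dvd_mult_iff)
  qed
  then have "coprime (qnorm (qconj x)) f" using f_pos xO by (intro coprime_int_if_no_prime) auto
  then obtain \<epsilon> where \<epsilon>: "\<epsilon> \<in> \<O>" "\<bar>qnorm \<epsilon>\<bar> = 1"
    "qconj x * \<epsilon> \<in> R"
    using unit_adjust[of "qconj x"] by blast
  define w where "w = qconj x * \<epsilon>"
  define \<delta> where "\<delta> = of_int (qnorm \<epsilon>) * qconj \<epsilon>"
  have w: "w \<in> \<O>" "f dvd omega_coord w" using \<epsilon>(3) R_iff by (auto simp: w_def)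
  have "qnorm \<epsilon> * qnorm \<epsilon> = 1"
    using \<epsilon>(2) by (auto simp: abs_if split: if_splits)
  moreover have "\<epsilon> * \<delta> = of_int (qnorm \<epsilon> * qnorm \<epsilon>)"
    using mult_conj[OF \<epsilon>(1)] by (simp add: \<delta>_def mult.left_commute)
  ultimately have \<epsilon>\<delta>: "\<epsilon> * \<delta> = 1" by simp
  have \<delta>O: "\<delta> \<in> \<O>" by (simp add: \<delta>_def)
  have "p dvd omega_coord (b * \<epsilon>) \<and> p dvd omega_coord (c * \<delta>)" if p: "prime p"
    "p dvd f" for p
  proof -
    have pw: "p dvd omega_coord w" "p dvd omega_coord (qconj w)" using w p dvd_trans by auto
    have bx: "b * x = of_int (f2 * f3 * qnorm b) + of_int f1 * (of_int f3 * (b * c) + of_int f2 * b)"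
      using mult_conj[OF bD(1)] by (simp add: x_def algebra_simps)
    have cx: "c * qconj x = of_int (f2 * f3) * (b * c) + of_int (f1 * f3 * qnorm c) + of_int (f1 * f2) * c"
      using mult_conj[OF cD(1)] bD cD by (simp add: x_def conj_add conj_mult algebra_simps)
    have pbc: "p dvd omega_coord (b * c)" using bc p R_iff dvd_trans by blast
    have s: "p dvd omega_coord (b * x) \<and> p dvd omega_coord (c * qconj x)" using cases[OF p]
    proof (elim disjE conjE)
      assume "p dvd f1"
      then show ?thesis unfolding bx cx using bD cD pbc by (simp add: omega_coord_add del: of_int_mult)
    next
      assume "p dvd f2" "p dvd qnorm b"
      then have "dvdO (of_int p) b" using bD(3) p by blast
      then have "dvdO (of_int p) (x * b)" using xO by (rule dvdO_mult)
      then have "p dvd omega_coord (b * x)" using dvd_omega_coord_if_dvdO by (simp add: mult.commute)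
      moreover have "p dvd omega_coord (c * qconj x)"
        unfolding cx using \<open>p dvd f2\<close> bD cD by (simp add: omega_coord_add del: of_int_mult)
      ultimately show ?thesis ..
    next
      assume "p dvd qnorm b" "p dvd qnorm c"
      then have "dvdO (of_int p) b" "dvdO (of_int p) c" using bD(3) cD(3) p by blast+
      then have "dvdO (of_int p) (x * b)" "dvdO (of_int p) (qconj x * c)"
        using xO by (auto intro: dvdO_mult)
      then show ?thesis using dvd_omega_coord_if_dvdO by (simp add: mult.commute)
    qed
    have e: "of_int (qnorm x) * (b * \<epsilon>) = (b * x) * w"
      using mult_conj[OF xO] by (simp add: w_def mult_ac flip: mult.assoc[of x])
    have "qnorm x * omega_coord (b * \<epsilon>) = omega_coord ((b * x) * w)"
      using omega_coord_of_int_mult[OF O_mult[OF bD(1) \<epsilon>(1)], of "qnorm x"]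
      unfolding e by (rule sym)
    moreover have "p dvd omega_coord ((b * x) * w)"
      using s pw by (intro dvd_omega_coord_mult[OF O_mult[OF bD(1) xO] w(1)]) auto
    ultimately have 1: "p dvd omega_coord (b * \<epsilon>)"
      using nx[OF p] p(1) by (metis prime_dvd_mult_iff)
    have "qconj w = x * qconj \<epsilon>" using xO \<epsilon> by (simp add: w_def conj_mult)
    then have e: "of_int (qnorm x) * (c * \<delta>) = of_int (qnorm \<epsilon>) * ((c * qconj x) * qconj w)"
      unfolding mult_conj[OF xO, symmetric] \<delta>_def by (simp only: mult_ac)
    have "qnorm x * omega_coord (c * \<delta>) = qnorm \<epsilon> * omega_coord ((c * qconj x) * qconj w)"
      using omega_coord_of_int_mult[OF O_mult[OF cD(1) \<delta>O], of "qnorm x"]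
        omega_coord_of_int_mult[OF O_mult[OF O_mult[OF cD(1) conj_in_O] conj_in_O], of
          "qnorm \<epsilon>" x w]
      unfolding e by simp
    moreover have "p dvd omega_coord ((c * qconj x) * qconj w)"
      using s pw by (intro dvd_omega_coord_mult[OF O_mult[OF cD(1) conj_in_O] conj_in_O]) auto
    ultimately have 2: "p dvd omega_coord (c * \<delta>)"
      using nx[OF p] p(1) by (metis prime_dvd_mult_iff dvd_mult)
    show ?thesis using 1 2 ..
  qed
  then have "b * \<epsilon> \<in> R" "c * \<delta> \<in> R"
    using mem_R_if_prime_dvd[OF squarefree_f] bD cD \<epsilon> \<delta>O by auto
  then show ?thesis using that \<epsilon>(1) \<delta>O \<epsilon>\<delta> by blast
qed

text \<open>This is \<open>transfer\<close> for \<open>z\<close> and its conjugate, whose product is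
  an integer.\<close>

lemma adjustable_adjust:
  assumes "adjustable z"
  obtains \<epsilon>
    where "\<epsilon> \<in> \<O>" "\<bar>qnorm \<epsilon>\<bar> = 1" "z * \<epsilon> \<in> R"
proof -
  have "z * qconj z \<in> R" using mult_conj adjustable_D(1)[OF assms] by simp
  then obtain \<epsilon> \<delta>
    where "\<epsilon> \<in> \<O>" "\<delta> \<in> \<O>" "\<epsilon> * \<delta> = 1"
      "z * \<epsilon> \<in> R"
    using transfer[OF assms adjustable_conj[OF assms]] by metis
  then show ?thesis using that unit_iff by blast
qed

text \<open>An element of norm \<open>p\<close> up to sign becomes adjustable after multiplication
  by \<open>p\<close>. Having \<open>p * y\<close> in \<open>R\<close> gives information modulo
  every prime divisor of \<open>f\<close>, not only modulo those of \<open>d\<close>.\<close>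

lemma ramified_norm_in_order:
  assumes p: "prime p" "p dvd f" "is_norm p"
  obtains y \<sigma>
    where "y \<in> \<O>" "\<sigma> = 1 \<or> \<sigma> = -1" "qnorm y = \<sigma> * p"
      "of_int p * y \<in> R"
proof -
  obtain x where x: "x \<in> \<O>" "\<bar>qnorm x\<bar> = p" using p by (auto simp: is_norm_def)
  have x0: "x \<noteq> 0" using x p by auto
  have "adjustable (of_int p * x)"
    unfolding adjustable_def
  proof (intro conjI allI impI)
    fix q assume q: "prime q \<and> q dvd f \<and> q dvd qnorm (of_int p * x)"
    then have "q dvd p \<or> q dvd \<bar>qnorm x\<bar>" using x by (auto simp: prime_dvd_mult_iff)
    then have "q dvd p" using x by simp
    then have "q = p" using q p by (simp add: primes_dvd_imp_eq)
    then show "dvdO (of_int q) (of_int p * x)" using x by (intro dvdOI[of x]) auto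
  qed (use x x0 p in auto)
  then obtain \<epsilon> where \<epsilon>: "\<epsilon> \<in> \<O>" "\<bar>qnorm \<epsilon>\<bar> = 1"
    "of_int p * x * \<epsilon> \<in> R" using adjustable_adjust by blast
  have "\<bar>qnorm (x * \<epsilon>)\<bar> = p" using x \<epsilon> by (simp add: qnorm_mult abs_mult)
  then have "qnorm (x * \<epsilon>) = 1 * p \<or> qnorm (x * \<epsilon>) = -1 * p"
    by (simp add: abs_if split: if_splits)
  then obtain \<sigma>
    where "\<sigma> = 1 \<or> \<sigma> = -1" "qnorm (x * \<epsilon>) = \<sigma> * p" by blast
  then show ?thesis using that[of "x * \<epsilon>" \<sigma>] x(1) \<epsilon> by (simp add: mult.assoc)
qed

text \<open>If \<open>\<sigma> * p\<close> is a norm with sign \<open>\<sigma>\<close>, the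
  hypothesis is applied to \<open>- \<sigma>\<close>. In
  \<open>4 * \<sigma> * p = t^2 - disc * s^2\<close>, division by \<open>p\<close> shows that
  \<open>- \<sigma> * (d div p)\<close> is a square modulo odd \<open>p\<close>, while reduction
  modulo an odd \<open>q\<close> dividing \<open>d\<close> shows that \<open>\<sigma> * p\<close> is
  a square modulo \<open>q\<close>.\<close>

lemma ramified_not_norm:
  assumes p: "prime p" "p dvd f" "p dvd disc"
    and H: "\<And>\<alpha>. \<alpha> \<in> {-1, 1} \<Longrightarrow> (odd p \<and> kronecker (\<alpha> * (d div p)) p = -1) \<or>
           (\<exists>q. prime q \<and> odd q \<and> q dvd d * f \<and> kronecker (- \<alpha> * p) q = -1)"
  shows "\<not> is_norm p"
proof
  assume "is_norm p"
  then obtain y \<sigma> where y: "y \<in> \<O>" "\<sigma> = 1 \<or> \<sigma> = -1"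
    "qnorm y = \<sigma> * p" "of_int p * y \<in> R"
    using ramified_norm_in_order p by blast
  have f4: "4 * (\<sigma> * p) = qtrace y ^ 2 - disc * omega_coord y ^ 2"
    using four_qnorm[of y] y by simp
  have "- \<sigma> \<in> {-1, 1}" using y by auto
  from H[OF this] show False
  proof (elim disjE exE conjE)
    assume o: "odd p" and k: "kronecker (- \<sigma> * (d div p)) p = -1"
    have p2: "p \<noteq> 2" using o by auto
    obtain k where k2: "disc = k * k * d" "k = 1 \<or> k = 2" 
      by (cases "d mod 4 = 1") (auto simp: quadratic_discriminant_def intro: that[of 1] that[of 2])
    have "\<not> p dvd 2" using primes_dvd_imp_eq[OF p(1), of 2] p2 by auto
    then have pk: "\<not> p dvd k" using k2 p(1) by auto
    then have "p dvd d" using p k2 by (simp add: prime_dvd_mult_iff)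
    then obtain d' where d': "d = p * d'" by auto
    have p0: "p \<noteq> 0" using p by auto
    have "k * k * d = p * (k * k * d')" by (subst d') simp
    with k2(1) have D: "disc = p * (k * k * d')" by (rule trans)
    have "p dvd qtrace y ^ 2"
      using f4 p(3) by (metis diff_add_cancel dvd_add dvd_mult dvd_mult2 dvd_triv_right mult.commute)
    then obtain t where t: "qtrace y = p * t" using p(1) prime_dvd_power by blast
    have "p * (4 * \<sigma>) = p * (p * t\<^sup>2 - k * k * d' * (omega_coord y)\<^sup>2)"
      using f4 by (simp add: t D power2_eq_square algebra_simps)
    then have e: "4 * \<sigma> = p * t\<^sup>2 - k * k * d' * (omega_coord y)\<^sup>2" using p0 by simp
    define u where "u = k * omega_coord y"
    have "\<sigma> * (4 * \<sigma>) = 4" using y(2) by auto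
    then have "4 = \<sigma> * (p * t\<^sup>2 - k * k * d' * (omega_coord y)\<^sup>2)"
      unfolding e by simp
    then have e2: "u\<^sup>2 * (- \<sigma> * d') - 2\<^sup>2 = p * (- \<sigma> * t\<^sup>2)"
      by (simp add: u_def power2_eq_square algebra_simps)
    then have cong: "[u\<^sup>2 * (- \<sigma> * d') = 2\<^sup>2] (mod p)"
      by (metis cong_iff_dvd_diff dvd_triv_left)
    have "coprime u p"
    proof -
      have "\<not> p dvd u"
      proof
        assume "p dvd u"
        then have "p dvd u\<^sup>2 * (- \<sigma> * d')" by (simp add: power2_eq_square)
        then have "p dvd 2\<^sup>2" using e2 by (metis cong cong_dvd_iff)
        then show False using \<open>\<not> p dvd 2\<close> p(1) prime_dvd_power by blast
      qed
      then show ?thesis using p(1) prime_imp_coprime coprime_commute by blast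
    qed
    then have "Legendre (- \<sigma> * d') p \<noteq> -1"
      using Legendre_neq_minus_one_if_square p(1) cong by blast
    moreover have "d div p = d'" using d' p0 by simp
    ultimately show False using k p(1) p2 by (simp add: kronecker_prime_eq kronecker_prime_def)
  next
    fix q assume q: "prime q" "odd q" "q dvd d * f" and k: "kronecker (- (- \<sigma>) * p) q = -1"
    have "q \<noteq> 2" using q by auto
    then have q2: "q \<noteq> 2" "\<not> q dvd 2" using primes_dvd_imp_eq[OF q(1), of 2] by auto
    have L: "Legendre (\<sigma> * p) q = -1"
      using k q(1) q2 by (simp add: kronecker_prime_eq kronecker_prime_def)
    then have "\<not> q dvd \<sigma> * p" by (auto simp: Legendre_def cong_0_iff split: if_splits)
    then have qp: "\<not> q dvd p" by auto
    show False
    proof (cases "q dvd d")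
      case True
      then have "q dvd disc" by (auto simp: quadratic_discriminant_def)
      moreover have "2\<^sup>2 * (\<sigma> * p) - (qtrace y)\<^sup>2 = disc * (- (omega_coord y)\<^sup>2)" using f4 by simp
      ultimately have "[2\<^sup>2 * (\<sigma> * p) = (qtrace y)\<^sup>2] (mod q)"
        by (simp add: cong_iff_dvd_diff)
      moreover have "coprime 2 q" using q2(2) q(1) prime_imp_coprime coprime_commute by blast
      ultimately show False using Legendre_neq_minus_one_if_square q(1) L by blast
    next
      case False
      then have "q dvd f" using q by (simp add: prime_dvd_mult_iff)
      \<comment> \<open>As \<open>z\<close> lies in \<open>R\<close>, its
        \<open>\<omega>\<close>-coordinate vanishes modulo \<open>q\<close>, so four times its norm
        is a square modulo \<open>q\<close>; that norm is \<open>\<sigma> * p\<close> times a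
        square.\<close>
      define z where "z = of_int p * y"
      have qz: "q dvd omega_coord z"
        using y(4) \<open>q dvd f\<close> R_iff dvd_trans by (auto simp: z_def)
      have "4 * qnorm z = qtrace z ^ 2 - disc * omega_coord z ^ 2" by (rule four_qnorm)
      moreover have "qnorm z = p * p * (\<sigma> * p)" using y by (simp add: z_def)
      ultimately have "(2 * p)\<^sup>2 * (\<sigma> * p) - (qtrace z)\<^sup>2 = - (disc * omega_coord z ^ 2)"
        by (simp add: power2_eq_square)
      moreover have "q dvd disc * omega_coord z ^ 2" using qz by (simp add: power2_eq_square)
      ultimately have "[(2 * p)\<^sup>2 * (\<sigma> * p) = (qtrace z)\<^sup>2] (mod q)"
        by (simp add: cong_iff_dvd_diff)
      moreover have "coprime q (2 * p)"
        using q2(2) qp q(1) by (intro prime_imp_coprime) (auto simp: prime_dvd_mult_iff)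
      then have "coprime (2 * p) q" by (simp add: coprime_commute)
      ultimately show False using Legendre_neq_minus_one_if_square q(1) L by blast
    qed
  qed
qed

end

section \<open>Parity of the lengths of factorizations\<close>

locale unusual_order_ramified = unusual_order +
  assumes ramified_not_is_norm: "\<And>p. prime p \<Longrightarrow> p dvd f \<Longrightarrow> p dvd disc \<Longrightarrow> \<not> is_norm p"
    and ramified_exists: "\<exists>p. prime p \<and> p dvd f \<and> p dvd disc"
begin

definition ramified_divisor :: "int \<Rightarrow> bool"
  where "ramified_divisor p \<longleftrightarrow> prime p \<and> p dvd f \<and> p dvd disc"

lemma ramified_divisorD: "ramified_divisor p \<Longrightarrow> prime p"
  "ramified_divisor p \<Longrightarrow> p dvd f" "ramified_divisor p \<Longrightarrow> p dvd disc"
    "ramified_divisor p \<Longrightarrow> \<not> is_norm p"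
  using ramified_not_is_norm by (auto simp: ramified_divisor_def)

text \<open>Inert primes impose no condition by \<open>inert_dvd\<close>. For ramified
  \<open>p\<close> the trace is divisible by \<open>p\<close> as soon as the norm is, so
  divisibility of the norm by \<open>p * p\<close> suffices.\<close>

lemma adjustable_iff: "adjustable z \<longleftrightarrow> z \<in> \<O> \<and> z \<noteq> 0 \<and> (\<forall>p. ramified_divisor p \<and> p dvd qnorm z \<longrightarrow> p * p dvd qnorm z)"
proof
  assume z: "adjustable z"
  show "z \<in> \<O> \<and> z \<noteq> 0 \<and> (\<forall>p. ramified_divisor p \<and> p dvd qnorm z \<longrightarrow> p * p dvd qnorm z)"
  proof (intro conjI allI impI)
    fix p assume "ramified_divisor p \<and> p dvd qnorm z"
    then have "dvdO (of_int p) z" using adjustable_D(3)[OF z, of p] ramified_divisorD by simp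
    then show "p * p dvd qnorm z" by (rule dvdO_of_intD)
  qed (use adjustable_D[OF z] in auto)
next
  assume z: "z \<in> \<O> \<and> z \<noteq> 0 \<and> (\<forall>p. ramified_divisor p \<and> p dvd qnorm z \<longrightarrow> p * p dvd qnorm z)"
  show "adjustable z" unfolding adjustable_def
  proof (intro conjI allI impI)
    fix p assume p: "prime p \<and> p dvd f \<and> p dvd qnorm z"
    show "dvdO (of_int p) z"
    proof (cases "p dvd disc")
      case True
      then have "p * p dvd qnorm z" using z p by (auto simp: ramified_divisor_def)
      moreover have "p dvd qtrace z" using nonsplit_dvd_qtrace[of p z] nonsplit p z by blast
      moreover have "p \<noteq> 0" using p by auto
      ultimately show ?thesis using z by (intro dvdO_of_int) auto
    next
      case False
      then show ?thesis using inert_dvd[of p z] nonsplit p z by (auto simp: dvdO_def)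
    qed
  qed (use z in auto)
qed

definition order_atom :: "real \<Rightarrow> bool" where
  "order_atom x \<longleftrightarrow> x \<in> R \<and> x \<noteq> 0 \<and> \<bar>qnorm x\<bar> \<noteq> 1 \<and>
     (\<forall>y\<in>R. \<forall>z\<in>R. x = y * z \<longrightarrow> \<bar>qnorm y\<bar> = 1 \<or> \<bar>qnorm z\<bar> = 1)"

text \<open>By \<open>transfer\<close>, a factorization of an element of \<open>R\<close> into
  adjustable elements of \<open>\<O>\<close> becomes one inside \<open>R\<close> with associated
  factors.\<close>

lemma order_atom_adjustable:
  assumes a: "order_atom a" and bc: "adjustable b" "adjustable c" "a = b * c"
  shows "\<bar>qnorm b\<bar> = 1 \<or> \<bar>qnorm c\<bar> = 1"
proof -
  have "b * c \<in> R" using a bc by (simp add: order_atom_def)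
  then obtain \<epsilon> \<delta> where e: "\<epsilon> \<in> \<O>" "\<delta> \<in> \<O>"
    "\<epsilon> * \<delta> = 1" "b * \<epsilon> \<in> R" "c * \<delta> \<in> R"
    using transfer[OF bc(1,2)] by metis
  have "a = a * (\<epsilon> * \<delta>)" using e by simp
  also have "\<dots> = (b * \<epsilon>) * (c * \<delta>)" by (simp add: bc)
  finally have "\<bar>qnorm (b * \<epsilon>)\<bar> = 1 \<or> \<bar>qnorm (c * \<delta>)\<bar> = 1"
    using a e by (auto simp: order_atom_def)
  moreover have "\<bar>qnorm \<epsilon>\<bar> = 1" "\<bar>qnorm \<delta>\<bar> = 1"
    using e unit_iff by (metis mult.commute)+
  ultimately show ?thesis using e adjustable_D(1) bc by (simp add: qnorm_mult abs_mult)
qed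

text \<open>The 3 is forced modulo 4. Norms of primes weigh 2 and other primes 1, so that
  irreducible elements of \<open>\<O>\<close> without ramified divisors of \<open>f\<close> in their
  norm weigh 2. An atom of norm \<open>p * p * p * q\<close>, with \<open>q\<close> of weight 1,
  then requires 3w + 1 to be 2 modulo 4 for the weight w of \<open>p\<close>.\<close>

definition weight :: "int \<Rightarrow> nat" where
  "weight q = (if is_norm q then 2 else if ramified_divisor q then 3 else 1)"

definition len_weight :: "int \<Rightarrow> nat"
  where "len_weight n = (\<Sum>q\<in>#prime_factorization n. weight q)"

lemma len_weight_mult: "m \<noteq> 0 \<Longrightarrow> n \<noteq> 0 \<Longrightarrow> len_weight (m * n) = len_weight m + len_weight n"
  by (simp add: len_weight_def prime_factorization_mult)

lemma len_weight_prime: "prime q \<Longrightarrow> len_weight q = weight q"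
  by (simp add: len_weight_def prime_factorization_prime)

lemma len_weight_1 [simp]: "len_weight 1 = 0" by (simp add: len_weight_def)

lemma len_weight_abs: "len_weight \<bar>n\<bar> = len_weight n"
  using prime_factorization_normalize[of n] by (simp add: len_weight_def)

text \<open>Either \<open>a\<close> is associated to a ramified \<open>p\<close>, of weight 3 + 3,
  or \<open>a\<close> is \<open>h\<close> times an irreducible element of \<open>\<O>\<close>, where
  \<open>h\<close> collects the ramified divisors of \<open>f\<close> in the norm of
  \<open>a\<close>; the norms of irreducible elements are known.\<close>

lemma len_weight_order_atom:
  assumes a: "order_atom a" shows "len_weight (qnorm a) mod 4 = 2"
proof -
  have aR: "a \<in> R" "a \<noteq> 0" "\<bar>qnorm a\<bar> \<noteq> 1"
    using a by (auto simp: order_atom_def)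
  have aO: "a \<in> \<O>" using aR R_in_O by blast
  have aM: "adjustable a" using adjustable_R aR by blast
  show ?thesis
  \<comment> \<open>The question is whether some \<open>p\<close> can be split off from
    \<open>a\<close> so that the quotient is still adjustable.\<close>
  proof (cases "\<exists>p a'. ramified_divisor p \<and> a' \<in> \<O> \<and> a = of_int p * a' \<and> (p dvd qnorm a' \<longrightarrow> p * p dvd qnorm a')")
    case True
    then obtain p a' where p: "ramified_divisor p" "a' \<in> \<O>" "a = of_int p * a'"
      "p dvd qnorm a' \<longrightarrow> p * p dvd qnorm a'" by blast
    note pD = ramified_divisorD[OF p(1)]
    have na: "qnorm a = p * p * qnorm a'" using p by simp
    have "adjustable a'" unfolding adjustable_iff
    proof (intro conjI allI impI)
      fix q assume q: "ramified_divisor q \<and> q dvd qnorm a'"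
      show "q * q dvd qnorm a'"
      proof (cases "q = p")
        case False
        then have "coprime q p" using q pD ramified_divisorD by (meson primes_coprime)
        then have "coprime (q * q) (p * p)" by simp
        moreover have "q dvd qnorm a" using q na by simp
        then have "q * q dvd qnorm a" using aM q by (auto simp: adjustable_iff)
        ultimately show ?thesis unfolding na by (simp add: coprime_dvd_mult_right_iff)
      qed (use q p in auto)
    qed (use p aR in auto)
    moreover have "adjustable (of_int p)" using pD by (intro adjustable_R) auto
    ultimately have "\<bar>qnorm (of_int p)\<bar> = 1 \<or> \<bar>qnorm a'\<bar> = 1"
      using order_atom_adjustable[OF a _ _ p(3)] by blast
    then have "\<bar>qnorm a'\<bar> = 1" using prime_gt_1_int[OF pD(1)] by (auto simp: zmult_eq_1_iff)
    then have "\<bar>qnorm a\<bar> = p * p" unfolding na by (simp add: abs_mult)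
    then have "len_weight (qnorm a) = 3 + 3" using len_weight_abs[of "qnorm a"] pD p(1)
      by (simp add: len_weight_mult len_weight_prime weight_def)
    then show ?thesis by simp
  next
    case False
    then have F: "p dvd qnorm a' \<and> \<not> p * p dvd qnorm a'" if "ramified_divisor p"
      "a' \<in> \<O>" "a = of_int p * a'" for p a'
      using that by blast
    \<comment> \<open>Each prime divisor of \<open>h\<close> divides \<open>qnorm a\<close> exactly three times, and \<open>a / h\<close> will turn out
      to be irreducible in \<open>\<O>\<close>.\<close>
    define h where "h = gcd (gcd f disc) (qnorm a)"
    have ramified_divisor_h: "ramified_divisor p \<and> p dvd qnorm a \<longleftrightarrow> prime p \<and> p dvd h" for p by (auto simp: h_def ramified_divisor_def)
    have hf: "h dvd f" by (simp add: h_def dvd_trans[OF gcd_dvd1])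
    have h0: "h > 0" using f_pos by (simp add: h_def)
    have sqh: "squarefree h" using squarefree_f hf squarefree_mono by blast
    have "p dvd rat_coord a \<and> p dvd omega_coord a" if "prime p" "p dvd h" for p
    proof -
      have "dvdO (of_int p) a"
        using adjustable_D(3)[OF aM, of p] ramified_divisor_h[of p] that ramified_divisorD[of p] by simp
      then show ?thesis by (auto simp: dvdO_def rat_coord_of_int_mult)
    qed
    then have "h dvd rat_coord a" "h dvd omega_coord a"
      using h0 by (auto intro!: squarefree_dvdI[OF sqh])
    then obtain k l where kl: "rat_coord a = h * k" "omega_coord a = h * l" by (elim dvdE)
    define b where "b = qint k l"
    have "a = qint (h * k) (h * l)" using aO kl in_O_iff_qint[of a] by simp
    then have "a = of_int h * b" by (simp add: b_def qint_def algebra_simps)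
    moreover have "b \<in> \<O>" by (simp add: b_def)
    ultimately have b: "b \<in> \<O>" "a = of_int h * b" by auto
    have na: "qnorm a = h * h * qnorm b" using b by simp
    have b0: "b \<noteq> 0" "qnorm b \<noteq> 0" using aR b by auto
    have hb: "p dvd qnorm b \<and> \<not> p * p dvd qnorm b" if p: "prime p" "p dvd h" for p
    proof -
      obtain h' where h': "h = p * h'" using p by auto
      have "\<not> p * p dvd h" using squarefreeD[OF sqh, of p] p(1) by (auto simp: power2_eq_square)
      then have "\<not> p dvd h'" using h' by auto
      moreover have "p dvd qnorm (of_int h' * b) \<and> \<not> p * p dvd qnorm (of_int h' * b)"
        using ramified_divisor_h[of p] p b by (intro F) (auto simp: h')
      ultimately show ?thesis using p(1) b by (auto simp: prime_dvd_mult_iff)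
    qed
    have bh: "p dvd h" if "ramified_divisor p" "p dvd qnorm b" for p
      using ramified_divisor_h[of p] that na by simp
    have "max_irreducible b" unfolding max_irreducible_def
    proof (intro conjI ballI impI)
      show "\<bar>qnorm b\<bar> \<noteq> 1"
      proof
        assume 1: "\<bar>qnorm b\<bar> = 1"
        have "h = 1"
        proof (rule ccontr)
          assume "h \<noteq> 1"
          then obtain p where "prime p" "p dvd h" using prime_divisor_exists[of h] h0 by auto
          then show False using hb[of p] 1 by (metis dvd_abs_iff not_prime_unit)
        qed
        then show False using na aR 1 by simp
      qed
      fix x y assume xy: "x \<in> \<O>" "y \<in> \<O>" "b = x * y"
      have nb: "qnorm b = qnorm x * qnorm y" using xy by (simp add: qnorm_mult)
      have xy0: "x \<noteq> 0" "y \<noteq> 0" using b0 xy by auto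
      \<comment> \<open>A prime of \<open>h\<close> divides \<open>qnorm b\<close> exactly once,
        hence the norm of only one of \<open>x\<close> and \<open>y\<close>. Giving it to that
        factor makes both factors adjustable.\<close>
      define hx where "hx = gcd h (qnorm x)"
      obtain hy where hy: "h = hx * hy" using gcd_dvd1[of h "qnorm x"] unfolding hx_def by (elim dvdE)
      have h0': "hx \<noteq> 0" "hy \<noteq> 0" using h0 hy by auto
      have "adjustable (of_int hx * x)" unfolding adjustable_iff
      proof (intro conjI allI impI)
        fix p assume p: "ramified_divisor p \<and> p dvd qnorm (of_int hx * x)"
        have "p dvd hx"
        proof (rule ccontr)
          assume "\<not> p dvd hx"
          then have "p dvd qnorm x"
            using p xy ramified_divisorD(1)[of p] by (auto simp: prime_dvd_mult_iff)
          then show False using bh[of p] p nb \<open>\<not> p dvd hx\<close> by (auto simp: hx_def)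
        qed
        then show "p * p dvd qnorm (of_int hx * x)" using xy by (simp add: mult_dvd_mono dvd_mult2)
      qed (use xy xy0 h0' in auto)
      moreover have "adjustable (of_int hy * y)" unfolding adjustable_iff
      proof (intro conjI allI impI)
        fix p assume p: "ramified_divisor p \<and> p dvd qnorm (of_int hy * y)"
        have "p dvd hy"
        proof (rule ccontr)
          assume n: "\<not> p dvd hy"
          then have y: "p dvd qnorm y"
            using p xy ramified_divisorD(1)[of p] by (auto simp: prime_dvd_mult_iff)
          then have "p dvd h" using bh[of p] p nb by auto
          then have "p dvd hx"
            using n p ramified_divisorD(1)[of p] by (auto simp: hy prime_dvd_mult_iff)
          then have "p * p dvd qnorm b" unfolding nb using y by (auto simp: hx_def intro: mult_dvd_mono)
          then show False using hb[of p] \<open>p dvd h\<close> p ramified_divisorD(1) by blast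
        qed
        then show "p * p dvd qnorm (of_int hy * y)" using xy by (simp add: mult_dvd_mono dvd_mult2)
      qed (use xy xy0 h0' in auto)
      moreover have "a = (of_int hx * x) * (of_int hy * y)" by (simp add: b xy hy)
      ultimately have "\<bar>qnorm (of_int hx * x)\<bar> = 1 \<or> \<bar>qnorm (of_int hy * y)\<bar> = 1" using order_atom_adjustable[OF a] by blast
      then show "\<bar>qnorm x\<bar> = 1 \<or> \<bar>qnorm y\<bar> = 1"
        using xy by (auto simp: abs_mult zmult_eq_1_iff)
    qed (use b b0 in auto)
    have hI: "h = k" if "k > 0" "squarefree k"
      "\<And>p. prime p \<Longrightarrow> p dvd h \<longleftrightarrow> p dvd k" for k
      using that h0 squarefree_dvdI[OF sqh, of k] squarefree_dvdI[of k h]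
      by (intro zdvd_antisym_nonneg) auto
    have Wa: "len_weight (qnorm a) = 2 * len_weight h + len_weight \<bar>qnorm b\<bar>"
      using h0 b0 by (simp add: na len_weight_mult len_weight_abs)
    from card_Pic_O \<open>max_irreducible b\<close> show ?thesis
    proof (cases rule: max_irreducible_qnorm_cases)
      case (prime q)
      have "h = 1"
      proof (rule hI)
        fix p :: int assume p: "prime p"
        have "\<not> p dvd h"
        proof
          assume "p dvd h"
          then have "p dvd q" "ramified_divisor p"
            using hb[OF p] prime(3) ramified_divisor_h p by (metis dvd_abs_iff, blast)
          then show False using primes_dvd_imp_eq[OF p prime(1)] prime(2) ramified_divisorD(4) by blast
        qed
        then show "p dvd h \<longleftrightarrow> p dvd 1" using p by auto
      qed auto
      then show ?thesis using Wa prime by (simp add: len_weight_prime weight_def)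
    next
      case (two q q')
      have q0: "q > 0" "q' > 0" using two prime_gt_0_int by auto
      have Wb: "len_weight \<bar>qnorm b\<bar> = weight q + weight q'"
        using two q0 by (simp add: len_weight_mult len_weight_prime)
      have hp: "p dvd h \<longleftrightarrow> ramified_divisor p \<and> (p = q \<or> p = q')" if p:
        "prime p" for p
      proof
        assume "p dvd h"
        then have "p dvd q * q'" "ramified_divisor p"
          using hb[OF p] two ramified_divisor_h p by (metis dvd_abs_iff, blast)
        then show "ramified_divisor p \<and> (p = q \<or> p = q')"
          using p two by (auto simp: prime_dvd_mult_iff primes_dvd_imp_eq)
      next
        assume "ramified_divisor p \<and> (p = q \<or> p = q')"
        then have "p dvd q * q'" "ramified_divisor p" by auto
        then have "p dvd qnorm b" using two by (metis dvd_abs_iff)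
        then show "p dvd h" using bh \<open>ramified_divisor p\<close> by blast
      qed
      have ne: "q \<noteq> q'" if "ramified_divisor q"
      proof
        assume "q = q'"
        then have "q * q dvd qnorm b" using two by (metis dvd_abs_iff dvd_refl)
        then show False using hb[of q] hp[of q] two that by blast
      qed
      have peq: "p dvd r \<longleftrightarrow> p = r" if "prime p" "prime r" for p r :: int
        using that primes_dvd_imp_eq by auto
      have sqf: "squarefree r" if "prime r" for r :: int using that by (auto intro: squarefree_prime)
      \<comment> \<open>The total weights in the four cases are 2, 10, 10 and 18.\<close>
      consider "\<not> ramified_divisor q" "\<not> ramified_divisor q'" | "ramified_divisor q"
        "\<not> ramified_divisor q'" | "\<not> ramified_divisor q" "ramified_divisor q'" |
          "ramified_divisor q" "ramified_divisor q'" by blast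
      then show ?thesis
      proof cases
        case 1
        then have "h = 1" using hp by (intro hI) auto
        then show ?thesis using Wa Wb 1 two by (simp add: weight_def)
      next
        case 2
        then have "h = q" using hp two q0 by (intro hI) (auto simp: peq sqf)
        then show ?thesis using Wa Wb 2 two by (simp add: weight_def len_weight_prime)
      next
        case 3
        then have "h = q'" using hp two q0 by (intro hI) (auto simp: peq sqf)
        then show ?thesis using Wa Wb 3 two by (simp add: weight_def len_weight_prime)
      next
        case 4
        have "squarefree (q * q')"
          using two ne 4 sqf by (intro squarefree_mult_coprime) (auto simp: primes_coprime)
        then have "h = q * q'" using hp two q0 4 by (intro hI) (auto simp: peq prime_dvd_mult_iff)
        then show ?thesis
          using Wa Wb 4 two q0 by (simp add: weight_def len_weight_prime len_weight_mult)
      qed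
    qed
  qed
qed

lemma len_weight_prod_list:
  assumes "\<forall>u\<in>set us. order_atom u"
  shows "prod_list us \<in> R \<and> qnorm (prod_list us) \<noteq> 0 \<and> len_weight (qnorm (prod_list us)) mod 4 = (2 * length us) mod 4"
  using assms
proof (induction us)
  case (Cons u us)
  have u: "u \<in> R" "qnorm u \<noteq> 0" using Cons.prems R_in_O by (auto simp: order_atom_def)
  have "len_weight (qnorm u) mod 4 = 2" using len_weight_order_atom Cons.prems by simp
  moreover have "len_weight (qnorm (u * prod_list us)) = len_weight (qnorm u) + len_weight (qnorm (prod_list us))"
    using Cons u R_in_O by (simp add: qnorm_mult len_weight_mult)
  ultimately have "len_weight (qnorm (u * prod_list us)) mod 4 = (2 + 2 * length us) mod 4"
    using Cons by (metis list.set_intros(2) mod_add_cong mod_mod_trivial)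
  then show ?case using Cons u R_in_O by (simp add: qnorm_mult)
qed auto

section \<open>Units, atoms and length sets of the order as a ring\<close>

abbreviation RR :: "real ring" where "RR \<equiv> quadratic_order_ring d f"

lemma RR_eq: "RR = \<lparr>carrier = R, monoid.mult = (*), one = 1, ring.zero = 0, add = (+)\<rparr>"
  by (simp add: quadratic_field_def)

lemma domain_RR: "domain RR"
  unfolding RR_eq by (rule domain_subring_real) auto

lemma Units_RR: "Units RR = {x \<in> R. \<bar>qnorm x\<bar> = 1}"
proof (intro equalityI subsetI)
  fix x assume "x \<in> Units RR"
  then obtain y where "x \<in> R" "y \<in> R" "x * y = 1" by (auto simp: Units_def RR_eq)
  then show "x \<in> {x \<in> R. \<bar>qnorm x\<bar> = 1}" using unit_iff[of x] R_in_O by auto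
next
  fix x assume x: "x \<in> {x \<in> R. \<bar>qnorm x\<bar> = 1}"
  define y where "y = of_int (qnorm x) * qconj x"
  have "qnorm x * qnorm x = 1" using x by (auto simp: abs_if split: if_splits)
  moreover have "x * y = of_int (qnorm x * qnorm x)"
    using mult_conj[of x] x R_in_O by (simp add: y_def mult.left_commute)
  ultimately have "x * y = 1" by simp
  moreover have "y \<in> R" using x by (auto simp: y_def)
  ultimately show "x \<in> Units RR"
    using x by (auto simp: Units_def RR_eq mult.commute intro!: bexI[of _ y])
qed

lemma ring_irreducible_RR:
  assumes "x \<in> R"
  shows "ring_irreducible\<^bsub>RR\<^esub> x \<longleftrightarrow> order_atom x"
proof -
  have "ring_irreducible\<^bsub>RR\<^esub> x \<longleftrightarrow> x \<noteq> \<zero>\<^bsub>RR\<^esub> \<and> x \<notin> Units RR \<and>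
    \<not> (\<exists>b\<in>carrier RR - Units RR. \<exists>c\<in>carrier RR - Units RR. x = b \<otimes>\<^bsub>RR\<^esub> c)"
    using assms by (intro domain.ring_irreducible_iff_atom[OF domain_RR]) (simp add: RR_eq)
  also have "\<dots> \<longleftrightarrow> order_atom x"
    unfolding Units_RR using assms by (auto simp: order_atom_def RR_eq)
  finally show ?thesis .
qed

lemma length_set_RR:
  "length_set RR a = {length us | us. \<exists>\<eta>\<in>R. \<bar>qnorm \<eta>\<bar> = 1 \<and> (\<forall>u\<in>set us. order_atom u) \<and> a = \<eta> * prod_list us}"
proof -
  have "foldr (\<otimes>\<^bsub>RR\<^esub>) us \<one>\<^bsub>RR\<^esub> = prod_list us" for us
    by (induction us) (auto simp: RR_eq)
  moreover have "(\<forall>u\<in>set us. u \<in> carrier RR \<and> ring_irreducible\<^bsub>RR\<^esub> u) \<longleftrightarrow> (\<forall>u\<in>set us. order_atom u)" for us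
    using ring_irreducible_RR by (auto simp: RR_eq order_atom_def)
  moreover have "\<eta> \<otimes>\<^bsub>RR\<^esub> x = \<eta> * x" for \<eta> x by (simp add: RR_eq)
  ultimately show ?thesis unfolding length_set_def Units_RR by auto
qed

lemma length_set_parity:
  assumes "k \<in> length_set RR a" "l \<in> length_set RR a"
  shows "even k \<longleftrightarrow> even l"
proof -
  have w: "len_weight (qnorm a) mod 4 = (2 * k) mod 4" if k: "k \<in> length_set RR a" for k
  proof -
    obtain us \<eta> where us: "k = length us" "\<eta> \<in> R" "\<bar>qnorm \<eta>\<bar> = 1"
      "\<forall>u\<in>set us. order_atom u" "a = \<eta> * prod_list us"
      using k by (auto simp: length_set_RR)
    have "qnorm a = qnorm \<eta> * qnorm (prod_list us)"
      using us len_weight_prod_list R_in_O by (simp add: qnorm_mult)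
    moreover have "len_weight (qnorm \<eta>) = 0" using us len_weight_abs[of "qnorm \<eta>"] by simp
    moreover have "qnorm \<eta> \<noteq> 0" using us(3) by auto
    ultimately have "len_weight (qnorm a) = len_weight (qnorm (prod_list us))"
      using len_weight_prod_list[OF us(4)] by (simp add: len_weight_mult)
    then show ?thesis using len_weight_prod_list[OF us(4)] us(1) by simp
  qed
  have "(2 * k) mod 4 = (2 * l) mod 4" using w assms by metis
  then show ?thesis by presburger
qed

text \<open>The norm is \<open>r * r\<close>, so a proper factor would have norm \<open>r\<close> up
  to sign.\<close>

lemma order_atom_of_prime:
  assumes r: "prime r" "\<not> is_norm r"
  shows "order_atom (of_int r)"
  unfolding order_atom_def
proof (intro conjI ballI impI)
  show "\<bar>qnorm (of_int r)\<bar> \<noteq> 1"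
    using prime_gt_1_int[OF r(1)] by (auto simp: zmult_eq_1_iff)
  fix y z assume yz: "y \<in> R" "z \<in> R" "of_int r = y * z"
  then have "qnorm (of_int r) = qnorm y * qnorm z" using R_in_O by (simp add: qnorm_mult)
  then have rr: "r * r = \<bar>qnorm y\<bar> * \<bar>qnorm z\<bar>"
    by (metis abs_mult abs_mult_self_eq qnorm_of_int)
  have nr: "\<bar>qnorm y\<bar> \<noteq> r" "\<bar>qnorm z\<bar> \<noteq> r"
    using r yz R_in_O by (auto simp: is_norm_def)
  have *: "\<bar>qnorm x'\<bar> = 1" if x: "r * r = \<bar>qnorm x\<bar> * \<bar>qnorm x'\<bar>"
    "r dvd \<bar>qnorm x\<bar>" "\<bar>qnorm x\<bar> \<noteq> r" for x x'
  proof -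
    obtain k where k: "\<bar>qnorm x\<bar> = r * k" using x(2) by (elim dvdE)
    have r0: "r > 0" using r(1) by (rule prime_gt_0_int)
    have m: "r = k * \<bar>qnorm x'\<bar>" using x(1) r0 by (simp add: k)
    have "0 \<le> r * k" using k by (metis abs_ge_zero)
    then have "k \<ge> 0" using r0 by (simp add: zero_le_mult_iff)
    moreover have "k dvd r" by (subst m) simp
    moreover have "k \<noteq> 1" using k x(3) by auto
    ultimately have "k = r" using r(1) unfolding prime_int_iff by blast
    then have "r * 1 = r * \<bar>qnorm x'\<bar>" using m by (metis mult.right_neutral)
    then show ?thesis using r0 by simp
  qed
  have "r dvd \<bar>qnorm y\<bar> * \<bar>qnorm z\<bar>" using rr by (metis dvd_triv_left)
  then have "r dvd \<bar>qnorm y\<bar> \<or> r dvd \<bar>qnorm z\<bar>"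
    using r(1) prime_dvd_mult_iff by blast
  then show "\<bar>qnorm y\<bar> = 1 \<or> \<bar>qnorm z\<bar> = 1"
  proof
    assume "r dvd \<bar>qnorm y\<bar>"
    from *[OF rr this nr(1)] show ?thesis ..
  next
    assume "r dvd \<bar>qnorm z\<bar>"
    from *[OF rr[unfolded mult.commute[of "\<bar>qnorm y\<bar>"]] this nr(2)] show ?thesis ..
  qed
qed (use r in auto)

text \<open>If \<open>p\<close> divides the norms of both factors, it divides each of them twice,
  which is one factor \<open>p\<close> too many. Otherwise the norm of one factor divides
  \<open>q\<close>, and \<open>q\<close> is not a norm.\<close>

lemma order_atom_of_qnorm:
  assumes p: "ramified_divisor p" and q: "prime q" "\<not> is_norm q" "q \<noteq> p"
    and x: "x \<in> R" "\<bar>qnorm x\<bar> = p * p * p * q"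
  shows "order_atom x"
  unfolding order_atom_def
proof (intro conjI ballI impI)
  note pD = ramified_divisorD[OF p]
  have gt: "p > 1" "q > 1" using pD q prime_gt_1_int by auto
  show "x \<noteq> 0" using x gt by auto
  have "p dvd \<bar>qnorm x\<bar>" by (simp add: x)
  then show "\<bar>qnorm x\<bar> \<noteq> 1"
    using gt by (metis zdvd1_eq abs_of_pos less_trans zero_less_one less_irrefl)
  fix y z assume yz: "y \<in> R" "z \<in> R" "x = y * z"
  have nx: "\<bar>qnorm y\<bar> * \<bar>qnorm z\<bar> = p * p * p * q"
    using x yz R_in_O by (simp add: qnorm_mult abs_mult)
  have "y \<noteq> 0" "z \<noteq> 0" using \<open>x \<noteq> 0\<close> yz by auto
  then have M: "adjustable y" "adjustable z" using yz adjustable_R by auto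
  have nd: "\<not> p dvd q" using q pD primes_dvd_imp_eq by blast
  have *: "\<bar>qnorm w\<bar> = 1" if w: "w \<in> R" "\<not> p dvd qnorm w"
    "\<bar>qnorm w\<bar> dvd p * p * p * q" for w
  proof -
    have "coprime p \<bar>qnorm w\<bar>" using w(2) pD(1) prime_imp_coprime[of p "qnorm w"] by simp
    then have "\<bar>qnorm w\<bar> dvd q" using w(3)
      by (metis coprime_commute coprime_dvd_mult_right_iff mult.assoc)
    then have "\<bar>qnorm w\<bar> = 1 \<or> \<bar>qnorm w\<bar> = q"
      using q(1) by (simp add: prime_int_iff)
    moreover have "\<bar>qnorm w\<bar> \<noteq> q" using q(2) w(1) R_in_O by (auto simp: is_norm_def)
    ultimately show ?thesis by simp
  qed
  show "\<bar>qnorm y\<bar> = 1 \<or> \<bar>qnorm z\<bar> = 1"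
  proof (cases "p dvd qnorm y \<and> p dvd qnorm z")
    case True
    then have "p * p dvd \<bar>qnorm y\<bar>" "p * p dvd \<bar>qnorm z\<bar>"
      using M p by (auto simp: adjustable_iff)
    then have "(p * p) * (p * p) dvd p * p * p * q" unfolding nx[symmetric] by (rule mult_dvd_mono)
    then have "(p * p * p) * p dvd (p * p * p) * q" by (simp only: mult.assoc)
    then have "p dvd q" using gt by simp
    then show ?thesis using nd by blast
  next
    case False
    then show ?thesis using *[of y] *[of z] yz nx by (metis dvd_triv_left dvd_triv_right)
  qed
qed (use x in auto)

section \<open>An element with lengths 2 and 4\<close>

lemma exists_lengths_2_4: "\<exists>a\<in>R - {0}. 2 \<in> length_set RR a \<and> 4 \<in> length_set RR a"
proof -
  obtain p where p: "ramified_divisor p" using ramified_exists by (auto simp: ramified_divisor_def)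
  note pD = ramified_divisorD[OF p]
  \<comment> \<open>An irreducible divisor \<open>u\<close> of \<open>u0\<close> with norm divisible
    by \<open>p\<close> has norm \<open>p * q\<close> up to sign, where \<open>q\<close> is not a
    norm because \<open>p\<close> is not. As \<open>p\<close> divides \<open>qnorm u0\<close> only
    once, \<open>q\<close> differs from \<open>p\<close>; as no other ramified prime divides
    \<open>qnorm u0\<close>, multiplying \<open>u\<close> by \<open>p\<close> makes it
    adjustable.\<close>
  obtain u0 where u0: "u0 \<in> \<O>" "p dvd qnorm u0" "\<not> p * p dvd qnorm u0"
    "\<And>q. prime q \<Longrightarrow> q dvd disc \<Longrightarrow> q dvd qnorm u0 \<Longrightarrow> q = p"
    using exists_qnorm_ramified[OF pD(1,3)] by blast
  have "u0 \<noteq> 0" using u0(3) by auto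
  then obtain u where u: "max_irreducible u" "dvdO u u0" "p dvd qnorm u"
    using max_irreducible_divisor[OF u0(1) _ pD(1) u0(2)] by blast
  have uO: "u \<in> \<O>" using u max_irreducibleD by blast
  have du: "qnorm u dvd qnorm u0" using dvdO_qnorm u uO by blast
  have "\<exists>q. prime q \<and> \<not> is_norm q \<and> \<bar>qnorm u\<bar> = p * q"
    using card_Pic_O u(1)
  proof (cases rule: max_irreducible_qnorm_cases)
    case (prime q)
    then have "p dvd q" using u(3) by (metis dvd_abs_iff)
    then have "p = q" using primes_dvd_imp_eq[OF pD(1) prime(1)] by simp
    then show ?thesis using prime pD by blast
  next
    case (two q q')
    then have "p dvd q * q'" using u(3) by (metis dvd_abs_iff)
    then have "p dvd q \<or> p dvd q'" using pD(1) prime_dvd_mult_iff by blast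
    then have "p = q \<or> p = q'" using two pD(1) primes_dvd_imp_eq by blast
    then show ?thesis using two by (metis mult.commute)
  qed
  then obtain q where q: "prime q" "\<not> is_norm q" "\<bar>qnorm u\<bar> = p * q" by blast
  have qp: "q \<noteq> p"
  proof
    assume "q = p"
    then have "p * p dvd qnorm u" using q(3) by (metis dvd_abs_iff dvd_refl)
    then show False using u0(3) du dvd_trans by blast
  qed
  have gt: "p > 0" "q > 0" using pD(1) q(1) prime_gt_0_int by auto
  have nu: "\<bar>qnorm (of_int p * u)\<bar> = p * p * p * q" using uO q(3) gt by (simp add: abs_mult)
  have "adjustable (of_int p * u)" unfolding adjustable_iff
  proof (intro conjI allI impI)
    fix r assume r: "ramified_divisor r \<and> r dvd qnorm (of_int p * u)"
    then have "r dvd p \<or> r dvd qnorm u0"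
      using uO ramified_divisorD(1)[of r] du by (auto simp: prime_dvd_mult_iff intro: dvd_trans)
    then have "r = p"
      using r ramified_divisorD(1,3)[of r] u0(4)[of r] primes_dvd_imp_eq[OF _ pD(1), of r] by auto
    then show "r * r dvd qnorm (of_int p * u)" using uO by simp
  qed (use uO pD u max_irreducibleD in auto)
  then obtain \<epsilon> where \<epsilon>: "\<epsilon> \<in> \<O>" "\<bar>qnorm \<epsilon>\<bar> = 1"
    "of_int p * u * \<epsilon> \<in> R" using adjustable_adjust by blast
  define a where "a = of_int p * u * \<epsilon>"
  have aR: "a \<in> R" "a \<in> \<O>" using \<epsilon> R_in_O by (auto simp: a_def)
  have na: "\<bar>qnorm a\<bar> = p * p * p * q"
    unfolding a_def
      using nu \<epsilon> uO qnorm_mult[of "of_int p * u" \<epsilon>]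
      by (simp add: abs_mult del: qnorm_of_int_mult)
  have at: "order_atom a" "order_atom (qconj a)"
    using order_atom_of_qnorm[OF p q(1,2) qp] aR na by auto
  have at': "order_atom (of_int p)" "order_atom (of_int q)" using order_atom_of_prime pD q by auto
  define A where "A = a * qconj a"
  have A: "A = of_int (qnorm a)" using aR by (simp add: A_def mult_conj)
  have "2 \<in> length_set RR A"
    unfolding length_set_RR using at by (auto simp: A_def intro!: exI[of _ "[a, qconj a]"] bexI[of _ 1])
  moreover have "4 \<in> length_set RR A"
  proof -
    have "qnorm a = sgn (qnorm a) * (p * p * p * q)" by (metis na mult.commute abs_mult_sgn)
    then have "A = of_int (sgn (qnorm a)) * prod_list [of_int p, of_int p, of_int p, of_int q]"
      unfolding A
        by (metis (no_types) list.simps of_int_mult mult.assoc mult.right_neutral prod_list.Cons prod_list.Nil)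
    moreover have "\<bar>qnorm (of_int (sgn (qnorm a)))\<bar> = 1"
      using na gt by (auto simp: sgn_if)
    ultimately show ?thesis unfolding length_set_RR using at'
      by (intro CollectI exI[of _ "[of_int p, of_int p, of_int p, of_int q]"] conjI bexI[of _
      "of_int (sgn (qnorm a))"]) auto
  qed
  moreover have "A \<in> R - {0}" unfolding A using na gt by auto
  ultimately show ?thesis by blast
qed

theorem min_distance_eq_2: "min_distance RR = 2"
proof -
  obtain a where a: "a \<in> R - {0}" "2 \<in> length_set RR a" "4 \<in> length_set RR a"
    using exists_lengths_2_4 by blast
  have "\<not> (\<exists>m\<in>length_set RR a. 2 < m \<and> m < 4)"
  proof
    assume "\<exists>m\<in>length_set RR a. 2 < m \<and> m < 4"
    then obtain m where m: "m \<in> length_set RR a" "2 < m" "m < 4" by blast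
    then have "m = 3" by simp
    then show False using length_set_parity[OF m(1) a(2)] by simp
  qed
  then have "\<exists>k\<in>length_set RR a. \<exists>l\<in>length_set RR a.
      k < l \<and> 2 = l - k \<and> \<not> (\<exists>m\<in>length_set RR a. k < m \<and> m < l)"
    using a(2,3) by (intro bexI[OF bexI[of _ 4] a(2)]) auto
  then have "2 \<in> distances (length_set RR a)" by (simp add: distances_def)
  then have 2: "2 \<in> distance_set RR" using a(1) by (auto simp: distance_set_def RR_eq)
  moreover have "2 \<le> n" if n: "n \<in> distance_set RR" for n
  proof -
    from n obtain b k l
      where "0 < n" "k \<in> length_set RR b" "l \<in> length_set RR b" "k < l" "n = l - k"
      by (auto simp: distance_set_def distances_def)
    moreover from this have "even k \<longleftrightarrow> even l" using length_set_parity by blast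
    ultimately show ?thesis by presburger
  qed
  ultimately have "(LEAST n. n \<in> distance_set RR) = 2" by (intro Least_equality)
  then show ?thesis using 2 by (auto simp: min_distance_def)
qed

end

theorem proposition3p6:
  fixes d f :: int
  assumes "d \<ge> 2" and "squarefree d"
    and "f > 0" and "squarefree f"
    and "\<exists>p. ramified_prime d p \<and> p dvd f"
    and "\<not> (\<exists>p. split_prime d p \<and> p dvd f)"
    and "order (Pic (quadratic_field d) (quadratic_order d f)) = 2"
    and "order (Pic (quadratic_field d) (ring_of_integers d)) = 2"
    and "\<forall>\<alpha>\<in>{-1, 1}. \<forall>p. ramified_prime d p \<and> p dvd f \<longrightarrow>
           (odd p \<and> kronecker (\<alpha> * (d div p)) p = -1) \<or>
           (\<exists>q. prime q \<and> odd q \<and> q dvd d * f \<and> kronecker (- \<alpha> * p) q = -1)"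
  shows "min_distance (quadratic_order_ring d f) = 2"
proof -
  interpret real_quadratic d using assms by unfold_locales
  interpret unusual_order d f
    using assms by unfold_locales (auto simp: ring_of_integers_eq)
  interpret unusual_order_ramified d f
  proof
    fix p assume p: "prime p" "p dvd f" "p dvd quadratic_discriminant d"
    then have "ramified_prime d p \<and> p dvd f" by (simp add: ramified_prime_iff)
    then show "\<not> is_norm p" using assms(9) by (intro ramified_not_norm[OF p]) blast
  next
    show "\<exists>p. prime p \<and> p dvd f \<and> p dvd quadratic_discriminant d"
      using assms(5) by (auto simp: ramified_prime_iff)
  qed
  show ?thesis by (rule min_distance_eq_2)
qed

end
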